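(* Let $\alpha$ be a strong composition of $n$. The set $\{\pi(\mathfrak S_w(\mathbf y,\mathbf x))\mid w\in W(\alpha)\}$ forms an $S(\mathfrak s^* )$-module basis of the equivariant cohomology $H_S^*(\mathcal B^\alpha)\simeq\mathcal A$.
   Context: Ring. A strong composition $\alpha=(\alpha_1,\dots,\alpha_k)$ of $n$ is a sequence of positive integers with sum $n$. Let $W=S_n$ and $\mathfrak t=\{(t_1,\dots,t_n)\in\mathbb C^n:\sum t_i=0\}$ (diagonal matrices, trace-zero normalization), with $W$ acting by $(w\cdot t)_{w(i)}=t_i$. Then $\mathbb C[\mathfrak t\times\mathfrak t]=\mathbb C[y_1,\dots,y_n;x_1,\dots,x_n]/\langle\sum y_i,\sum x_i\rangle$. Let $\mathfrak s\subseteq\mathfrak t$ be the subspace of vectors $((z_1)^{\alpha_1},\dots,(z_k)^{\alpha_k})$, where $(z_i)^{\alpha_i}$ means $z_i$ repeated $\alpha_i$ times, so $S(\mathfrak s^* )=\mathbb C[z_1,\dots,z_k]/\langle\sum\alpha_iz_i\rangle$. Let $Z_\alpha=\{(h,w\cdot h): h\in\mathfrak s,w\in W\}$, a reduced closed subvariety of $\mathfrak s\times\mathfrak t\subseteq\mathfrak t\times\mathfrak t$, and $\mathcal A=\mathbb C[Z_\alpha]=\mathbb C[\mathfrak t\times\mathfrak t]/\mathcal I(Z_\alpha)$, where $\mathcal I(Z_\alpha)$ is the vanishing ideal. It is an $S(\mathfrak s^* )$-algebra via the first projection, and $\pi:\mathbb C[\mathfrak t\times\mathfrak t]\to\mathcal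 A$ is the quotient map (i.e. restriction of functions to $Z_\alpha$). Geometry. Let $L\subseteq GL_n(\mathbb C)$ be the block diagonal Levi subgroup with block sizes $\alpha_1,\dots,\alpha_k$, $X_\alpha$ a principal nilpotent element of $\mathrm{Lie}(L)$ (one nilpotent Jordan block per diagonal block), $B$ the upper triangular matrices, $\mathfrak b=\mathrm{Lie}(B)$, $\mathcal B=GL_n(\mathbb C)/B$, and $\mathcal B^\alpha=\{gB\in\mathcal B: g^{-1}X_\alpha g\in\mathfrak b\}$ the Springer fiber. The torus $S$ with Lie algebra $\mathfrak s$ (identity component of the centralizer of $L$) acts on $\mathcal B^\alpha$ by left multiplication. Cohomology has complex coefficients. By a theorem of Kumar and Procesi there is a graded $S(\mathfrak s^* )$-algebra isomorphism $\mathcal A\simeq H_S^*(\mathcal B^\alpha)$ sending $x_i$ to the restriction of $-c_1(\mathcal L_i)$, where $\mathcal L_i$ is the equivariant line bundle on $\mathcal B$ with fiber $V_i/V_{i-1}$ over a flag $V_\bullet$. Double Schubert polynomials. $\mathfrak S_{w_0}(\mathbf y,\mathbf x)=\prod_{i+j\le n}(x_i-y_j)$ for the longest $w_0\in W$, and $\mathfrak S_w=\partial_i\mathfrak S_{ws_i}$ if $\ell(ws_i)=\ell(w)+1$, where $s_i$ is the transposition of $i,i+1$ and $\partial_i(f)=\frac{f-s_i(f)}{x_i-x_{i+1}}$ with $s_i$ acting only on the $x$-variables. The set $W(\alpha)$. $\mathrm{RSCT}_n(\alpha)$ is the set of fillings of the diagram with $\alpha_i$ left-justified boxes in row $i$ (rows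 numbered from top to bottom) by $1,\dots,n$, each used once, with entries decreasing from left to right in each row. A pair $(i,j)$ is a Springer inversion of $\Upsilon\in\mathrm{RSCT}_n(\alpha)$ if there is an entry $j'$ in row $j$ with $i<j'$ such that either $j'$ appears above $i$ in the same column, or $j'$ appears in a column strictly to the right of the column containing $i$. The inversion vector of $\Upsilon$ is $\gamma=(\gamma_1,\dots,\gamma_{n-1})$, where $\gamma_i$ is the number of Springer inversions of $\Upsilon$ with first entry $i$. The Lehmer code of $w\in W$ is $(\gamma_1(w),\dots,\gamma_n(w))$ with $\gamma_k(w)=\#\{j>k: w(k)>w(j)\}$ (so $\gamma_n(w)=0$). $u_\Upsilon\in W$ is the unique permutation whose Lehmer code equals the inversion vector of $\Upsilon$ (with a final $0$ appended), and $W(\alpha)=\{u_\Upsilon\mid\Upsilon\in\mathrm{RSCT}_n(\alpha)\}$. *)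

theory Defs
  imports
    Complex_Main
    "HOL-Library.Poly_Mapping"
    "HOL-Combinatorics.Permutations"
    "HOL-Algebra.Module"
    "HOL-Algebra.QuotRing"
begin

section \<open>Polynomials and rings of polynomial functions\<close>

type_synonym 'v cpoly = "('v \<Rightarrow>\<^sub>0 nat) \<Rightarrow>\<^sub>0 complex"

definition pvar :: "'v \<Rightarrow> 'v cpoly" where
  "pvar v = Poly_Mapping.single (Poly_Mapping.single v 1) 1"

definition pconst :: "complex \<Rightarrow> 'v cpoly" where
  "pconst c = Poly_Mapping.single 0 c"

definition pvars :: "'v cpoly \<Rightarrow> 'v set" where
  "pvars p = (\<Union>m\<in>Poly_Mapping.keys p. Poly_Mapping.keys m)"

text \<open>The value at \<open>p\<close> of the homomorphism that is \<open>h\<close> on constants and sends the variable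
  \<open>v\<close> to \<open>\<sigma> v\<close>.\<close>

definition pinsert :: "(complex \<Rightarrow> 'r) \<Rightarrow> ('v \<Rightarrow> 'r) \<Rightarrow> 'v cpoly \<Rightarrow> 'r::comm_ring_1" where
  "pinsert h \<sigma> p =
     (\<Sum>m\<in>Poly_Mapping.keys p. h (Poly_Mapping.lookup p m) *
        (\<Prod>v\<in>Poly_Mapping.keys m. \<sigma> v ^ Poly_Mapping.lookup m v))"

abbreviation peval :: "('v \<Rightarrow> complex) \<Rightarrow> 'v cpoly \<Rightarrow> complex" where
  "peval \<equiv> pinsert (\<lambda>c. c)"

abbreviation psubst :: "('v \<Rightarrow> 'v cpoly) \<Rightarrow> 'v cpoly \<Rightarrow> 'v cpoly" where
  "psubst \<equiv> pinsert pconst"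

text \<open>\<open>co q v\<close> is the coordinate \<open>v\<close> of the point \<open>q\<close>. For a set \<open>V\<close> of points,
  \<open>coord_ring I co V\<close> is the ring \<open>\<complex>[V]\<close> of functions on \<open>V\<close> given by polynomials
  in the coordinates \<open>v \<in> I\<close>. Functions on \<open>V\<close> are \<open>undefined\<close> off \<open>V\<close>.\<close>

definition poly_fun :: "('p \<Rightarrow> 'v \<Rightarrow> complex) \<Rightarrow> 'p set \<Rightarrow> 'v cpoly \<Rightarrow> 'p \<Rightarrow> complex" where
  "poly_fun co V p = (\<lambda>q\<in>V. peval (co q) p)"

definition coord_ring ::
    "'v set \<Rightarrow> ('p \<Rightarrow> 'v \<Rightarrow> complex) \<Rightarrow> 'p set \<Rightarrow> ('p \<Rightarrow> complex) ring" where
  "coord_ring I co V =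
     \<lparr>carrier = {poly_fun co V p |p. pvars p \<subseteq> I},
      mult = (\<lambda>f g. \<lambda>q\<in>V. f q * g q),
      one = (\<lambda>q\<in>V. 1),
      zero = (\<lambda>q\<in>V. 0),
      add = (\<lambda>f g. \<lambda>q\<in>V. f q + g q)\<rparr>"

lemma pinsert_superset:
  assumes "finite A" "Poly_Mapping.keys p \<subseteq> A" "h 0 = 0"
  shows "pinsert h \<sigma> p = (\<Sum>m\<in>A. h (Poly_Mapping.lookup p m) *
        (\<Prod>v\<in>Poly_Mapping.keys m. \<sigma> v ^ Poly_Mapping.lookup m v))"
  unfolding pinsert_def
  by (rule sum.mono_neutral_left) (use assms in \<open>auto simp: in_keys_iff\<close>)

lemma peval_add: "peval a (p + q) = peval a p + peval a q"
proof -
  let ?A = "Poly_Mapping.keys p \<union> Poly_Mapping.keys q"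
  have "Poly_Mapping.keys (p + q) \<subseteq> ?A" by (rule keys_add)
  then show ?thesis
    by (simp add: pinsert_superset[of ?A] lookup_add distrib_right sum.distrib)
qed

lemma peval_single:
  "peval a (Poly_Mapping.single m c) =
     c * (\<Prod>v\<in>Poly_Mapping.keys m. a v ^ Poly_Mapping.lookup m v)"
  by (simp add: pinsert_superset[of "{m}"])

lemma monom_eval_superset:
  fixes a :: "'v \<Rightarrow> complex"
  assumes "finite A" "Poly_Mapping.keys m \<subseteq> A"
  shows "(\<Prod>v\<in>Poly_Mapping.keys m. a v ^ Poly_Mapping.lookup m v) =
     (\<Prod>v\<in>A. a v ^ Poly_Mapping.lookup m v)"
  by (rule prod.mono_neutral_left) (use assms in \<open>auto simp: in_keys_iff\<close>)

lemma monom_eval_add: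
  fixes a :: "'v \<Rightarrow> complex"
  shows "(\<Prod>v\<in>Poly_Mapping.keys (m + m'). a v ^ Poly_Mapping.lookup (m + m') v) =
     (\<Prod>v\<in>Poly_Mapping.keys m. a v ^ Poly_Mapping.lookup m v) *
     (\<Prod>v\<in>Poly_Mapping.keys m'. a v ^ Poly_Mapping.lookup m' v)"
proof -
  let ?A = "Poly_Mapping.keys m \<union> Poly_Mapping.keys m'"
  let ?e = "\<lambda>m B. \<Prod>v\<in>B. a v ^ Poly_Mapping.lookup m v"
  have "?e (m + m') (Poly_Mapping.keys (m + m')) = ?e (m + m') ?A"
    by (rule monom_eval_superset) (simp_all add: keys_add)
  also have "\<dots> = ?e m ?A * ?e m' ?A"
    by (simp add: lookup_add power_add prod.distrib)
  also have "?e m ?A = ?e m (Poly_Mapping.keys m)"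
    by (rule monom_eval_superset[symmetric]) simp_all
  also have "?e m' ?A = ?e m' (Poly_Mapping.keys m')"
    by (rule monom_eval_superset[symmetric]) simp_all
  finally show ?thesis .
qed

lemma cpoly_induct [case_names zero monom]:
  assumes "P 0"
    and "\<And>p m c. P p \<Longrightarrow> P (p + Poly_Mapping.single m c)"
  shows "P (p :: 'v cpoly)"
proof (induction p rule: update_induct)
  case const
  then show ?case using assms(1) by simp
next
  case (update f m c)
  have "Poly_Mapping.update m c f = f + Poly_Mapping.single m c"
    by (rule poly_mapping_eqI)
      (use update in \<open>auto simp: lookup_update lookup_add lookup_single in_keys_iff when_def\<close>)
  then show ?case using assms(2) update by simp
qed

lemma peval_0: "peval a 0 = 0"
  by (simp add: pinsert_def)

lemma peval_mult: "peval a (p * q) = peval a p * peval a q"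
proof (induction p rule: cpoly_induct)
  case zero
  then show ?case by (simp add: peval_0)
next
  case (monom p m c)
  have "peval a (Poly_Mapping.single m c * q) = peval a (Poly_Mapping.single m c) * peval a q"
    by (induction q rule: cpoly_induct)
      (simp_all add: peval_0 distrib_left peval_add mult_single peval_single monom_eval_add)
  then show ?case using monom by (simp add: distrib_right peval_add)
qed

lemma peval_pconst: "peval a (pconst c) = c"
  by (simp add: pconst_def peval_single)

lemma peval_pvar: "peval a (pvar v) = a v"
  by (simp add: pvar_def peval_single)

lemma pvars_add: "pvars (p + q) \<subseteq> pvars p \<union> pvars q"
  using keys_add[of p q] by (auto simp: pvars_def)

lemma pvars_mult: "pvars (p * q) \<subseteq> pvars p \<union> pvars q"
proof
  fix v assume "v \<in> pvars (p * q)"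
  then obtain m where m: "m \<in> Poly_Mapping.keys (p * q)" "v \<in> Poly_Mapping.keys m"
    by (auto simp: pvars_def)
  then obtain a b where "a \<in> Poly_Mapping.keys p" "b \<in> Poly_Mapping.keys q" "m = a + b"
    using keys_mult[of p q] by blast
  then show "v \<in> pvars p \<union> pvars q"
    using m(2) keys_add[of a b] by (auto simp: pvars_def)
qed

lemma pvars_pconst: "pvars (pconst c) = {}"
  by (auto simp: pvars_def pconst_def)

lemma coord_ring_simps:
  "carrier (coord_ring I co V) = {poly_fun co V p |p. pvars p \<subseteq> I}"
  "f \<otimes>\<^bsub>coord_ring I co V\<^esub> g = (\<lambda>q\<in>V. f q * g q)"
  "f \<oplus>\<^bsub>coord_ring I co V\<^esub> g = (\<lambda>q\<in>V. f q + g q)"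
  "\<one>\<^bsub>coord_ring I co V\<^esub> = (\<lambda>q\<in>V. 1)"
  "\<zero>\<^bsub>coord_ring I co V\<^esub> = (\<lambda>q\<in>V. 0)"
  by (simp_all add: coord_ring_def)

lemma poly_fun_closed: "pvars p \<subseteq> I \<Longrightarrow> poly_fun co V p \<in> carrier (coord_ring I co V)"
  by (auto simp: coord_ring_simps(1))

lemma coord_ring_undefined:
  "\<lbrakk>f \<in> carrier (coord_ring I co V); q \<notin> V\<rbrakk> \<Longrightarrow> f q = undefined"
  by (auto simp: coord_ring_simps poly_fun_def)

lemma coord_ring_add_closed:
  assumes "f \<in> carrier (coord_ring I co V)" "g \<in> carrier (coord_ring I co V)"
  shows "(\<lambda>q\<in>V. f q + g q) \<in> carrier (coord_ring I co V)"
proof -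
  obtain p r where f: "f = poly_fun co V p" and g: "g = poly_fun co V r"
    and pr: "pvars p \<subseteq> I" "pvars r \<subseteq> I"
    using assms by (auto simp: coord_ring_simps(1))
  have eq: "(\<lambda>q\<in>V. f q + g q) = poly_fun co V (p + r)"
    unfolding f g poly_fun_def by (rule restrict_ext) (simp add: peval_add)
  show ?thesis
    unfolding eq by (rule poly_fun_closed) (use pr pvars_add[of p r] in blast)
qed

lemma coord_ring_mult_closed:
  assumes "f \<in> carrier (coord_ring I co V)" "g \<in> carrier (coord_ring I co V)"
  shows "(\<lambda>q\<in>V. f q * g q) \<in> carrier (coord_ring I co V)"
proof -
  obtain p r where f: "f = poly_fun co V p" and g: "g = poly_fun co V r"
    and pr: "pvars p \<subseteq> I" "pvars r \<subseteq> I"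
    using assms by (auto simp: coord_ring_simps(1))
  have eq: "(\<lambda>q\<in>V. f q * g q) = poly_fun co V (p * r)"
    unfolding f g poly_fun_def by (rule restrict_ext) (simp add: peval_mult)
  show ?thesis
    unfolding eq by (rule poly_fun_closed) (use pr pvars_mult[of p r] in blast)
qed

lemma coord_ring_const_closed: "(\<lambda>q\<in>V. c) \<in> carrier (coord_ring I co V)"
  using poly_fun_closed[of "pconst c" I co V] by (simp add: poly_fun_def peval_pconst pvars_pconst)

lemma coord_ring_sum_closed:
  assumes "\<And>i. i \<in> A \<Longrightarrow> (\<lambda>q\<in>V. f i q) \<in> carrier (coord_ring I co V)"
  shows "(\<lambda>q\<in>V. \<Sum>i\<in>A. f i q) \<in> carrier (coord_ring I co V)"
  using assms
proof (induction A rule: infinite_finite_induct)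
  case (insert x F)
  have closed: "(\<lambda>q\<in>V. (\<lambda>q\<in>V. f x q) q + (\<lambda>q\<in>V. \<Sum>i\<in>F. f i q) q) \<in> carrier (coord_ring I co V)"
    by (intro coord_ring_add_closed[OF insert(4)[OF insertI1] insert(3)[OF insert(4)[OF insertI2]]])
  have eq: "(\<lambda>q\<in>V. (\<lambda>q\<in>V. f x q) q + (\<lambda>q\<in>V. \<Sum>i\<in>F. f i q) q) =
      (\<lambda>q\<in>V. \<Sum>i\<in>insert x F. f i q)"
    using insert(1,2) by (intro restrict_ext) simp
  show ?case using closed unfolding eq .
next
  case (infinite A)
  show ?case unfolding sum.infinite[OF infinite(1)] by (rule coord_ring_const_closed)
next
  case empty
  show ?case unfolding sum.empty by (rule coord_ring_const_closed)
qed

lemma coord_ring_prod_closed: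
  assumes "\<And>i. i \<in> A \<Longrightarrow> (\<lambda>q\<in>V. f i q) \<in> carrier (coord_ring I co V)"
  shows "(\<lambda>q\<in>V. \<Prod>i\<in>A. f i q) \<in> carrier (coord_ring I co V)"
  using assms
proof (induction A rule: infinite_finite_induct)
  case (insert x F)
  have closed: "(\<lambda>q\<in>V. (\<lambda>q\<in>V. f x q) q * (\<lambda>q\<in>V. \<Prod>i\<in>F. f i q) q) \<in> carrier (coord_ring I co V)"
    by (intro coord_ring_mult_closed[OF insert(4)[OF insertI1] insert(3)[OF insert(4)[OF insertI2]]])
  have eq: "(\<lambda>q\<in>V. (\<lambda>q\<in>V. f x q) q * (\<lambda>q\<in>V. \<Prod>i\<in>F. f i q) q) =
      (\<lambda>q\<in>V. \<Prod>i\<in>insert x F. f i q)"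
    using insert(1,2) by (intro restrict_ext) simp
  show ?case using closed unfolding eq .
next
  case (infinite A)
  show ?case unfolding prod.infinite[OF infinite(1)] by (rule coord_ring_const_closed)
next
  case empty
  show ?case unfolding prod.empty by (rule coord_ring_const_closed)
qed

lemma coord_ring_peval_closed:
  assumes "\<And>v. v \<in> pvars p \<Longrightarrow> (\<lambda>q\<in>V. a q v) \<in> carrier (coord_ring I co V)"
  shows "(\<lambda>q\<in>V. peval (a q) p) \<in> carrier (coord_ring I co V)"
  unfolding pinsert_def
proof (rule coord_ring_sum_closed)
  fix m assume m: "m \<in> Poly_Mapping.keys p"
  have pow: "(\<lambda>q\<in>V. a q v ^ k) \<in> carrier (coord_ring I co V)"
    if "v \<in> Poly_Mapping.keys m" for v k
  proof -
    have "v \<in> pvars p" using that m by (auto simp: pvars_def)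
    from coord_ring_prod_closed[of "{..<k}" "\<lambda>_ q. a q v" V I co, OF assms[OF this]]
    show ?thesis by (simp only: prod_constant card_lessThan)
  qed
  have closed: "(\<lambda>q\<in>V. (\<lambda>q\<in>V. Poly_Mapping.lookup p m) q *
      (\<lambda>q\<in>V. \<Prod>v\<in>Poly_Mapping.keys m. a q v ^ Poly_Mapping.lookup m v) q)
      \<in> carrier (coord_ring I co V)"
    by (rule coord_ring_mult_closed[OF coord_ring_const_closed coord_ring_prod_closed[OF pow]])
  have eq: "(\<lambda>q\<in>V. (\<lambda>q\<in>V. Poly_Mapping.lookup p m) q *
      (\<lambda>q\<in>V. \<Prod>v\<in>Poly_Mapping.keys m. a q v ^ Poly_Mapping.lookup m v) q) =
      (\<lambda>q\<in>V. Poly_Mapping.lookup p m *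
        (\<Prod>v\<in>Poly_Mapping.keys m. a q v ^ Poly_Mapping.lookup m v))"
    by (rule restrict_ext) simp
  show "(\<lambda>q\<in>V. Poly_Mapping.lookup p m *
      (\<Prod>v\<in>Poly_Mapping.keys m. a q v ^ Poly_Mapping.lookup m v))
      \<in> carrier (coord_ring I co V)"
    using closed unfolding eq .
qed

lemma cring_coord_ring: "cring (coord_ring I co V)"
proof (rule cringI)
  show "abelian_group (coord_ring I co V)"
  proof (rule abelian_groupI, goal_cases)
    case (6 f)
    have "(\<lambda>q\<in>V. - 1 * f q) \<in> carrier (coord_ring I co V)"
      using coord_ring_mult_closed[OF coord_ring_const_closed 6, of "- 1"]
      by (simp cong: restrict_cong)
    then show ?case by (rule rev_bexI) (auto simp: coord_ring_simps(3,5))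
  qed (simp_all add: coord_ring_simps(2-) coord_ring_add_closed coord_ring_const_closed,
      auto simp: fun_eq_iff restrict_def coord_ring_undefined)
  show "Group.comm_monoid (coord_ring I co V)"
    by (rule comm_monoidI)
      (simp_all add: coord_ring_simps(2-) coord_ring_mult_closed coord_ring_const_closed,
        auto simp: fun_eq_iff restrict_def coord_ring_undefined)
qed (auto simp: coord_ring_simps(2-) fun_eq_iff restrict_def algebra_simps)


section \<open>Bases of modules and isomorphisms of algebras\<close>

definition module_independent :: "'a ring \<Rightarrow> ('a, 'b) module \<Rightarrow> 'b set \<Rightarrow> bool" where
  "module_independent R M B \<longleftrightarrow>
     (\<forall>F c. finite F \<and> F \<subseteq> B \<and> c \<in> F \<rightarrow> carrier R \<and>
        (\<Oplus>\<^bsub>M\<^esub>b\<in>F. c b \<odot>\<^bsub>M\<^esub> b) = \<zero>\<^bsub>M\<^esub> \<longrightarrow> (\<forall>b\<in>F. c b = \<zero>\<^bsub>R\<^esub>))"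

definition module_span :: "'a ring \<Rightarrow> ('a, 'b) module \<Rightarrow> 'b set \<Rightarrow> 'b set" where
  "module_span R M B =
     {(\<Oplus>\<^bsub>M\<^esub>b\<in>F. c b \<odot>\<^bsub>M\<^esub> b) |F c. finite F \<and> F \<subseteq> B \<and> c \<in> F \<rightarrow> carrier R}"

definition module_basis :: "'a ring \<Rightarrow> ('a, 'b) module \<Rightarrow> 'b set \<Rightarrow> bool" where
  "module_basis R M B \<longleftrightarrow>
     Module.module R M \<and> B \<subseteq> carrier M \<and> module_independent R M B \<and> module_span R M B = carrier M"

definition algebra_iso :: "'a ring \<Rightarrow> ('a, 'b) module \<Rightarrow> ('a, 'c) module \<Rightarrow> ('b \<Rightarrow> 'c) set" where
  "algebra_iso R M N =
     {\<phi> \<in> ring_iso M N. \<forall>c\<in>carrier R. \<forall>a\<in>carrier M. \<phi> (c \<odot>\<^bsub>M\<^esub> a) = c \<odot>\<^bsub>N\<^esub> \<phi> a}"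


section \<open>The algebra \<open>\<A>\<close>\<close>

definition strong_composition :: "nat \<Rightarrow> nat list \<Rightarrow> bool" where
  "strong_composition n \<alpha> \<longleftrightarrow> (\<forall>a\<in>set \<alpha>. 0 < a) \<and> sum_list \<alpha> = n"

text \<open>Vectors in \<open>\<complex>\<^sup>n\<close> are functions on \<open>{1..n}\<close>, extended by \<open>undefined\<close>.\<close>

definition torus_lie :: "nat \<Rightarrow> (nat \<Rightarrow> complex) set" where
  "torus_lie n = {t \<in> {1..n} \<rightarrow>\<^sub>E UNIV. (\<Sum>i=1..n. t i) = 0}"

definition perm_act :: "(nat \<Rightarrow> nat) \<Rightarrow> (nat \<Rightarrow> complex) \<Rightarrow> nat \<Rightarrow> complex" where
  "perm_act w t = (\<lambda>j. t (inv_into UNIV w j))"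

text \<open>The part \<open>\<alpha>\<^sub>r\<close> is \<open>\<alpha> ! (r - 1)\<close>.\<close>

definition block :: "nat list \<Rightarrow> nat \<Rightarrow> nat set" where
  "block \<alpha> r = {sum_list (take (r - 1) \<alpha>) <.. sum_list (take r \<alpha>)}"

definition levi_center :: "nat list \<Rightarrow> (nat \<Rightarrow> complex) set" where
  "levi_center \<alpha> =
     {h \<in> torus_lie (sum_list \<alpha>). \<exists>z. \<forall>r\<in>{1..length \<alpha>}. \<forall>i\<in>block \<alpha> r. h i = z r}"

definition Zvar :: "nat list \<Rightarrow> ((nat \<Rightarrow> complex) \<times> (nat \<Rightarrow> complex)) set" where
  "Zvar \<alpha> = {(h, perm_act w h) |h w. h \<in> levi_center \<alpha> \<and> w permutes {1..sum_list \<alpha>}}"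

datatype yxvar = Y nat | X nat

definition yxvars :: "nat \<Rightarrow> yxvar set" where
  "yxvars n = Y ` {1..n} \<union> X ` {1..n}"

fun yxcoord :: "(nat \<Rightarrow> complex) \<times> (nat \<Rightarrow> complex) \<Rightarrow> yxvar \<Rightarrow> complex" where
  "yxcoord (h, t) (Y i) = h i"
| "yxcoord (h, t) (X i) = t i"

definition ctt :: "nat \<Rightarrow> ((nat \<Rightarrow> complex) \<times> (nat \<Rightarrow> complex) \<Rightarrow> complex) ring" where
  "ctt n = coord_ring (yxvars n) yxcoord (torus_lie n \<times> torus_lie n)"

text \<open>\<open>S(\<ss>\<^sup>*)\<close> as the ring of polynomial functions on \<open>\<ss>\<close>: the coordinate \<open>z\<^sub>r\<close> of the
  presentation \<open>\<complex>[z\<^sub>1,\<dots>,z\<^sub>k]/\<langle>\<Sum>\<alpha>\<^sub>r z\<^sub>r\<rangle>\<close> is the restriction to \<open>\<ss>\<close> of any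
  \<open>h \<mapsto> h i\<close> with \<open>i \<in> block \<alpha> r\<close>.\<close>

definition sym_s :: "nat list \<Rightarrow> ((nat \<Rightarrow> complex) \<Rightarrow> complex) ring" where
  "sym_s \<alpha> = coord_ring {1..sum_list \<alpha>} (\<lambda>h. h) (levi_center \<alpha>)"

text \<open>The algebra \<open>\<A> = \<complex>[Z\<^sub>\<alpha>]\<close>; \<open>S(\<ss>\<^sup>*)\<close> acts on it by pull-back along the
  first projection \<open>Z\<^sub>\<alpha> \<rightarrow> \<ss>\<close>. The quotient map \<open>\<pi>\<close> from \<open>\<complex>[\<t> \<times> \<t>]\<close> is \<open>restr_Z\<close>
  below; that its kernel is the vanishing ideal of \<open>Z\<^sub>\<alpha>\<close>, and \<open>\<A>\<close> the quotient by it, is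
  proved in \<open>restr_Z_kernel\<close> and \<open>alg_A_quotient\<close>.

  By a theorem of Kumar and Procesi, \<open>\<A>\<close> is isomorphic as an \<open>S(\<ss>\<^sup>*)\<close>-algebra to the
  equivariant cohomology ring of the Springer fiber. Cohomology itself is not constructed here:
  statements about it are made for every algebra \<open>H\<close> with an \<open>algebra_iso\<close> from \<open>\<A>\<close>.\<close>

definition alg_A :: "nat list \<Rightarrow>
    ((nat \<Rightarrow> complex) \<Rightarrow> complex, (nat \<Rightarrow> complex) \<times> (nat \<Rightarrow> complex) \<Rightarrow> complex) module" where
  "alg_A \<alpha> = ring.extend (coord_ring (yxvars (sum_list \<alpha>)) yxcoord (Zvar \<alpha>))
     (module.fields (\<lambda>c f. \<lambda>q\<in>Zvar \<alpha>. c (fst q) * f q))"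

definition restr_Z :: "nat list \<Rightarrow> ((nat \<Rightarrow> complex) \<times> (nat \<Rightarrow> complex) \<Rightarrow> complex) \<Rightarrow>
    (nat \<Rightarrow> complex) \<times> (nat \<Rightarrow> complex) \<Rightarrow> complex" where
  "restr_Z \<alpha> f = restrict f (Zvar \<alpha>)"

definition vanishing_ideal ::
    "nat list \<Rightarrow> ((nat \<Rightarrow> complex) \<times> (nat \<Rightarrow> complex) \<Rightarrow> complex) set" where
  "vanishing_ideal \<alpha> = {f \<in> carrier (ctt (sum_list \<alpha>)). \<forall>q\<in>Zvar \<alpha>. f q = 0}"

lemma alg_A_simps:
  "carrier (alg_A \<alpha>) = carrier (coord_ring (yxvars (sum_list \<alpha>)) yxcoord (Zvar \<alpha>))"
  "f \<otimes>\<^bsub>alg_A \<alpha>\<^esub> g = (\<lambda>q\<in>Zvar \<alpha>. f q * g q)"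
  "f \<oplus>\<^bsub>alg_A \<alpha>\<^esub> g = (\<lambda>q\<in>Zvar \<alpha>. f q + g q)"
  "\<one>\<^bsub>alg_A \<alpha>\<^esub> = (\<lambda>q\<in>Zvar \<alpha>. 1)"
  "\<zero>\<^bsub>alg_A \<alpha>\<^esub> = (\<lambda>q\<in>Zvar \<alpha>. 0)"
  "c \<odot>\<^bsub>alg_A \<alpha>\<^esub> f = (\<lambda>q\<in>Zvar \<alpha>. c (fst q) * f q)"
  by (simp_all add: alg_A_def coord_ring_def ring.defs monoid.defs partial_object.defs module.defs)

lemma Zvar_subset: "Zvar \<alpha> \<subseteq> torus_lie (sum_list \<alpha>) \<times> torus_lie (sum_list \<alpha>)"
proof -
  have "perm_act w h \<in> torus_lie n" if h: "h \<in> torus_lie n" and w: "w permutes {1..n}" for w h n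
  proof -
    have w': "inv_into UNIV w permutes {1..n}" using w by (rule permutes_inv)
    have "(\<Sum>i=1..n. h (inv_into UNIV w i)) = (\<Sum>i=1..n. h i)"
      using sum.permute[OF w', of h] by (simp add: o_def)
    then show ?thesis
      using h permutes_not_in[OF w']
      by (auto simp: torus_lie_def perm_act_def PiE_iff extensional_def)
  qed
  then show ?thesis by (auto simp: Zvar_def levi_center_def)
qed

lemma cring_alg_A: "cring (alg_A \<alpha>)"
proof (rule cringI)
  note s = alg_A_simps coord_ring_add_closed coord_ring_mult_closed coord_ring_const_closed
  show "abelian_group (alg_A \<alpha>)"
  proof (rule abelian_groupI, goal_cases)
    case (6 f)
    have "(\<lambda>q\<in>Zvar \<alpha>. - 1 * f q) \<in> carrier (alg_A \<alpha>)"
      using coord_ring_mult_closed[OF coord_ring_const_closed 6[unfolded alg_A_simps], of "- 1"]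
      by (simp add: alg_A_simps(1) cong: restrict_cong)
    then show ?case by (rule rev_bexI) (auto simp: alg_A_simps(3,5))
  qed (simp_all add: s, auto simp: fun_eq_iff restrict_def coord_ring_undefined)
  show "Group.comm_monoid (alg_A \<alpha>)"
    by (rule comm_monoidI)
      (simp_all add: s, auto simp: fun_eq_iff restrict_def coord_ring_undefined)
qed (auto simp: alg_A_simps fun_eq_iff restrict_def algebra_simps)

lemma Zvar_fst: "(h, t) \<in> Zvar \<alpha> \<Longrightarrow> h \<in> levi_center \<alpha>"
  by (auto simp: Zvar_def)

lemma algebra_alg_A: "algebra (sym_s \<alpha>) (alg_A \<alpha>)"
proof (rule algebraI)
  fix c f assume c: "c \<in> carrier (sym_s \<alpha>)" and f: "f \<in> carrier (alg_A \<alpha>)"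
  show "c \<odot>\<^bsub>alg_A \<alpha>\<^esub> f \<in> carrier (alg_A \<alpha>)"
  proof -
    let ?n = "sum_list \<alpha>" and ?R = "coord_ring (yxvars (sum_list \<alpha>)) yxcoord (Zvar \<alpha>)"
    obtain p where p: "c = poly_fun (\<lambda>h. h) (levi_center \<alpha>) p" "pvars p \<subseteq> {1..?n}"
      using c by (auto simp: sym_s_def coord_ring_simps)
    have "(\<lambda>q\<in>Zvar \<alpha>. fst q i) \<in> carrier ?R" if "i \<in> {1..?n}" for i
    proof -
      have "(\<lambda>q\<in>Zvar \<alpha>. fst q i) = poly_fun yxcoord (Zvar \<alpha>) (pvar (Y i))"
        by (auto simp: poly_fun_def peval_pvar)
      moreover have "pvars (pvar (Y i)) \<subseteq> yxvars ?n"
        using that by (auto simp: pvars_def pvar_def yxvars_def)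
      ultimately show ?thesis using poly_fun_closed by metis
    qed
    then have pull: "(\<lambda>q\<in>Zvar \<alpha>. peval (fst q) p) \<in> carrier ?R"
      using p(2) by (intro coord_ring_peval_closed) auto
    have eq: "(\<lambda>q\<in>Zvar \<alpha>. (\<lambda>q\<in>Zvar \<alpha>. peval (fst q) p) q * f q) = c \<odot>\<^bsub>alg_A \<alpha>\<^esub> f"
      unfolding alg_A_simps by (rule restrict_ext) (auto simp: p(1) poly_fun_def Zvar_def)
    show ?thesis
      using coord_ring_mult_closed[OF pull f[unfolded alg_A_simps(1)]] unfolding eq alg_A_simps(1) .
  qed
qed (auto simp: alg_A_simps sym_s_def coord_ring_simps(2-) fun_eq_iff restrict_def algebra_simps
    cring_coord_ring cring_alg_A coord_ring_undefined dest: Zvar_fst)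

lemma restr_Z_poly_fun:
  "restr_Z \<alpha> (poly_fun yxcoord (torus_lie (sum_list \<alpha>) \<times> torus_lie (sum_list \<alpha>)) p) =
     poly_fun yxcoord (Zvar \<alpha>) p"
  using Zvar_subset[of \<alpha>] by (auto simp: restr_Z_def poly_fun_def fun_eq_iff restrict_def)

lemma restr_Z_surj: "restr_Z \<alpha> ` carrier (ctt (sum_list \<alpha>)) = carrier (alg_A \<alpha>)"
  by (force simp: ctt_def alg_A_simps coord_ring_simps image_iff restr_Z_poly_fun)

lemma restr_Z_hom: "ring_hom_ring (ctt (sum_list \<alpha>)) (alg_A \<alpha>) (restr_Z \<alpha>)"
proof (rule ring_hom_ringI)
  show "ring (ctt (sum_list \<alpha>))" unfolding ctt_def by (intro cring.axioms(1) cring_coord_ring)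
  show "ring (alg_A \<alpha>)" by (intro cring.axioms(1) cring_alg_A)
  show "restr_Z \<alpha> f \<in> carrier (alg_A \<alpha>)" if "f \<in> carrier (ctt (sum_list \<alpha>))" for f
    using restr_Z_surj that by blast
qed (use Zvar_subset[of \<alpha>] in \<open>auto simp: ctt_def alg_A_simps coord_ring_simps(2-) restr_Z_def
    fun_eq_iff restrict_def\<close>)

lemma restr_Z_kernel: "a_kernel (ctt (sum_list \<alpha>)) (alg_A \<alpha>) (restr_Z \<alpha>) = vanishing_ideal \<alpha>"
  by (auto simp: a_kernel_def' alg_A_simps restr_Z_def vanishing_ideal_def fun_eq_iff restrict_def)

lemma alg_A_quotient: "ctt (sum_list \<alpha>) Quot vanishing_ideal \<alpha> \<simeq> alg_A \<alpha>"
  using ring_hom_ring.FactRing_iso[OF restr_Z_hom restr_Z_surj] by (simp add: restr_Z_kernel)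


section \<open>Double Schubert polynomials\<close>

text \<open>Elements of \<open>S\<^sub>n\<close> are functions \<open>w\<close> with \<open>w permutes {1..n}\<close>.\<close>

definition longest_perm :: "nat \<Rightarrow> nat \<Rightarrow> nat" where
  "longest_perm n i = (if i \<in> {1..n} then n + 1 - i else i)"

definition perm_length :: "nat \<Rightarrow> (nat \<Rightarrow> nat) \<Rightarrow> nat" where
  "perm_length n w = card {(i, j). 1 \<le> i \<and> i < j \<and> j \<le> n \<and> w j < w i}"

abbreviation simple_refl :: "nat \<Rightarrow> nat \<Rightarrow> nat" where
  "simple_refl i \<equiv> Transposition.transpose i (Suc i)"

fun refl_var :: "nat \<Rightarrow> yxvar \<Rightarrow> yxvar" where
  "refl_var i (Y j) = Y j"
| "refl_var i (X j) = X (simple_refl i j)"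

definition refl_x :: "nat \<Rightarrow> yxvar cpoly \<Rightarrow> yxvar cpoly" where
  "refl_x i = psubst (\<lambda>v. pvar (refl_var i v))"

definition divided_diff :: "nat \<Rightarrow> yxvar cpoly \<Rightarrow> yxvar cpoly" where
  "divided_diff i f = (THE g. (pvar (X i) - pvar (X (Suc i))) * g = f - refl_x i f)"

inductive is_double_schubert :: "nat \<Rightarrow> (nat \<Rightarrow> nat) \<Rightarrow> yxvar cpoly \<Rightarrow> bool" for n where
  longest: "is_double_schubert n (longest_perm n)
     (\<Prod>(i, j)\<in>{(i, j). 1 \<le> i \<and> 1 \<le> j \<and> i + j \<le> n}. pvar (X i) - pvar (Y j))"
| step: "\<lbrakk>w permutes {1..n}; 1 \<le> i; i < n;
      perm_length n (w \<circ> simple_refl i) = perm_length n w + 1;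
      is_double_schubert n (w \<circ> simple_refl i) g\<rbrakk>
    \<Longrightarrow> is_double_schubert n w (divided_diff i g)"

text \<open>Every chain of steps from the longest permutation down to \<open>w\<close> gives the same polynomial
  (divided differences satisfy the braid relations), so that \<open>SOME\<close> makes no real choice.\<close>

definition double_schubert :: "nat \<Rightarrow> (nat \<Rightarrow> nat) \<Rightarrow> yxvar cpoly" where
  "double_schubert n w = (SOME f. is_double_schubert n w f)"

definition schubert_fun :: "nat \<Rightarrow> (nat \<Rightarrow> nat) \<Rightarrow>
    (nat \<Rightarrow> complex) \<times> (nat \<Rightarrow> complex) \<Rightarrow> complex" where
  "schubert_fun n w = poly_fun yxcoord (torus_lie n \<times> torus_lie n) (double_schubert n w)"


section \<open>The set \<open>W(\<alpha>)\<close>\<close>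

text \<open>Boxes are pairs (row, column), both counted from 1, rows from top to bottom.\<close>

definition diagram :: "nat list \<Rightarrow> (nat \<times> nat) set" where
  "diagram \<alpha> = {(r, c). r \<in> {1..length \<alpha>} \<and> c \<in> {1..\<alpha> ! (r - 1)}}"

definition RSCT :: "nat list \<Rightarrow> (nat \<times> nat \<Rightarrow> nat) set" where
  "RSCT \<alpha> = {T \<in> extensional (diagram \<alpha>).
     bij_betw T (diagram \<alpha>) {1..sum_list \<alpha>} \<and>
     (\<forall>r c c'. (r, c) \<in> diagram \<alpha> \<and> (r, c') \<in> diagram \<alpha> \<and> c < c' \<longrightarrow> T (r, c') < T (r, c))}"

definition springer_inversion :: "nat list \<Rightarrow> (nat \<times> nat \<Rightarrow> nat) \<Rightarrow> nat \<Rightarrow> nat \<Rightarrow> bool" where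
  "springer_inversion \<alpha> T i j \<longleftrightarrow>
     (\<exists>r c c'. (r, c) \<in> diagram \<alpha> \<and> T (r, c) = i \<and> (j, c') \<in> diagram \<alpha> \<and> i < T (j, c') \<and>
        (c' = c \<and> j < r \<or> c < c'))"

definition inversion_vector :: "nat list \<Rightarrow> (nat \<times> nat \<Rightarrow> nat) \<Rightarrow> nat \<Rightarrow> nat" where
  "inversion_vector \<alpha> T i = card {j. springer_inversion \<alpha> T i j}"

definition lehmer :: "nat \<Rightarrow> (nat \<Rightarrow> nat) \<Rightarrow> nat \<Rightarrow> nat" where
  "lehmer n w k = card {j. k < j \<and> j \<le> n \<and> w j < w k}"

definition u_perm :: "nat list \<Rightarrow> (nat \<times> nat \<Rightarrow> nat) \<Rightarrow> nat \<Rightarrow> nat" where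
  "u_perm \<alpha> T = (THE w. w permutes {1..sum_list \<alpha>} \<and>
     (\<forall>k\<in>{1..sum_list \<alpha>}. lehmer (sum_list \<alpha>) w k =
        (if k < sum_list \<alpha> then inversion_vector \<alpha> T k else 0)))"

definition W_set :: "nat list \<Rightarrow> (nat \<Rightarrow> nat) set" where
  "W_set \<alpha> = u_perm \<alpha> ` RSCT \<alpha>"

end

theory Submission
  imports Defs "HOL-Computational_Algebra.Formal_Power_Series" "HOL-Library.Function_Algebras"
begin

text \<open>
  The Schubert classes are compared with the monomials \<open>x\<^sup>m\<close> on \<open>Z\<^sub>\<alpha>\<close>. Exponent vectors are
  ordered by total degree and, within one degree, by calling the lexicographically larger vector
  the smaller one. Everything happens modulo smaller monomials, with coefficients in \<open>S(\<ss>\<^sup>*)\<close>.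

  On \<open>Z\<^sub>\<alpha>\<close> the \<open>y\<close>-coordinates are scalars, so a term of \<open>\<SS>\<^sub>w(y, x)\<close> that contains a \<open>y\<close> has
  smaller degree in \<open>x\<close>. Among the terms free of \<open>y\<close>, the largest one is \<open>x\<^sup>c\<close> with \<open>c\<close> the
  Lehmer code of \<open>w\<close>, with coefficient 1 (\<open>double_schubert_leading\<close>). This is proved by
  descending from the longest permutation along last ascents. The polynomial of \<open>w\<close> is defined
  through arbitrary chains of divided differences; because these commute or satisfy the braid
  relation, the choice of the chain does not matter (\<open>is_double_schubert_unique\<close>).

  A monomial whose exponent vector is not an inversion vector is a combination of smaller
  monomials (\<open>straightening\<close> and \<open>greedy_filling\<close>). The source is a relation of Tanisaki type.
  Among any \<open>v\<close> coordinates of a point of \<open>Z\<^sub>\<alpha>\<close>, the value \<open>z\<^sub>j\<close> occurs at most \<open>min(\<alpha>\<^sub>j, v)\<close>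
  times. Hence the product \<open>\<Prod>\<^sub>j (1 - z\<^sub>j u)\<^bsup>min(\<alpha>\<^sub>j, v)\<^esup> \<cdot> \<Prod>\<^sub>i (1 - x\<^sub>i u)\<^sup>-\<^sup>1\<close> is a polynomial
  in \<open>u\<close>, and a complete homogeneous symmetric polynomial of large degree in these \<open>v\<close>
  coordinates reduces to lower degree (\<open>hsym_spanned_lower\<close>). Now try to build a filling with
  inversion vector \<open>m\<close> by placing \<open>1, 2, \<dots>\<close> in turn at row ends: \<open>m\<^sub>i\<close> is the rank, by length,
  of the row that receives \<open>i\<close>. If this succeeds, \<open>m\<close> is an inversion vector. If it gets stuck,
  the relation, carried along the placements made so far, rewrites \<open>x\<^sup>m\<close>
  (\<open>greedy_straightening\<close>).

  By well-founded induction the Schubert classes span (\<open>xmonomial_spanned_schubert\<close>). Over a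
  generic point of \<open>\<ss>\<close> the fibre of \<open>Z\<^sub>\<alpha>\<close> contains a distinct point for every filling, and the
  functions on such points are interpolated by elements of \<open>\<A>\<close>. There are at most as many
  Schubert classes as fillings, so they are independent over each generic point
  (\<open>relation_vanishes_generic\<close>), and a coefficient that vanishes at all generic points vanishes
  (\<open>vanishing_on_generic\<close>). Bases are carried over to \<open>H\<close> by the algebra isomorphism.
\<close>

section \<open>Substitution in polynomials\<close>

text \<open>The order of the variables makes the polynomial ring an integral domain, since it gives
  a monomial order and leading terms then multiply.\<close>

instantiation yxvar :: linorder
begin

fun less_eq_yxvar :: "yxvar \<Rightarrow> yxvar \<Rightarrow> bool" where
  "less_eq_yxvar (Y i) (Y j) \<longleftrightarrow> i \<le> j"
| "less_eq_yxvar (Y i) (X j) \<longleftrightarrow> True"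
| "less_eq_yxvar (X i) (Y j) \<longleftrightarrow> False"
| "less_eq_yxvar (X i) (X j) \<longleftrightarrow> i \<le> j"

definition less_yxvar :: "yxvar \<Rightarrow> yxvar \<Rightarrow> bool" where
  "less_yxvar u v \<longleftrightarrow> u \<le> v \<and> u \<noteq> v"

instance
proof
  fix u v w :: yxvar
  show "u < v \<longleftrightarrow> u \<le> v \<and> \<not> v \<le> u"
    by (cases u; cases v) (auto simp: less_yxvar_def)
  show "u \<le> u" by (cases u) auto
  show "u \<le> v \<Longrightarrow> v \<le> w \<Longrightarrow> u \<le> w" by (cases u; cases v; cases w) auto
  show "u \<le> v \<Longrightarrow> v \<le> u \<Longrightarrow> u = v" by (cases u; cases v) auto
  show "u \<le> v \<or> v \<le> u" by (cases u; cases v) auto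
qed

end

abbreviation lookup where "lookup \<equiv> Poly_Mapping.lookup"
abbreviation keys where "keys \<equiv> Poly_Mapping.keys"
abbreviation single where "single \<equiv> Poly_Mapping.single"

lemma monomial_prod_superset:
  fixes \<sigma> :: "'v \<Rightarrow> 'r::comm_ring_1"
  assumes "finite A" "keys m \<subseteq> A"
  shows "(\<Prod>v\<in>keys m. \<sigma> v ^ lookup m v) =
     (\<Prod>v\<in>A. \<sigma> v ^ lookup m v)"
  by (rule prod.mono_neutral_left) (use assms in \<open>auto simp: in_keys_iff\<close>)

lemma monomial_prod_add:
  fixes \<sigma> :: "'v \<Rightarrow> 'r::comm_ring_1"
  shows "(\<Prod>v\<in>keys (m + m'). \<sigma> v ^ lookup (m + m') v) =
     (\<Prod>v\<in>keys m. \<sigma> v ^ lookup m v) *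
     (\<Prod>v\<in>keys m'. \<sigma> v ^ lookup m' v)"
proof -
  let ?A = "keys m \<union> keys m'"
  have "keys (m + m') \<subseteq> ?A" by (rule keys_add)
  then show ?thesis
    by (simp only: monomial_prod_superset[of ?A "m + m'"] monomial_prod_superset[of ?A m]
        monomial_prod_superset[of ?A m'] finite_Un finite_keys Un_upper1 Un_upper2 simp_thms)
      (simp add: lookup_add power_add prod.distrib)
qed

lemma pconst_add: "pconst (a + b) = pconst a + pconst b"
  by (simp add: pconst_def single_add)

lemma pconst_mult: "pconst (a * b) = pconst a * pconst b"
  by (simp add: pconst_def mult_single)

lemma pconst_0: "pconst 0 = 0" and pconst_1: "pconst 1 = 1"
  by (simp_all add: pconst_def)

lemma psubst_0: "psubst \<sigma> 0 = 0"
  by (simp add: pinsert_def)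

lemma psubst_add: "psubst \<sigma> (p + q) = psubst \<sigma> p + psubst \<sigma> q"
proof -
  let ?A = "keys p \<union> keys q"
  have "keys (p + q) \<subseteq> ?A" by (rule keys_add)
  then show ?thesis
    by (simp add: pinsert_superset[of ?A] lookup_add distrib_right sum.distrib pconst_0 pconst_add)
qed

lemma psubst_single:
  "psubst \<sigma> (single m c) =
     pconst c * (\<Prod>v\<in>keys m. \<sigma> v ^ lookup m v)"
  by (simp add: pinsert_superset[of "{m}"] pconst_0)

lemma psubst_mult: "psubst \<sigma> (p * q) = psubst \<sigma> p * psubst \<sigma> q"
proof (induction p rule: cpoly_induct)
  case zero
  then show ?case by (simp add: psubst_0)
next
  case (monom p m c)
  have "psubst \<sigma> (single m c * q) =
      psubst \<sigma> (single m c) * psubst \<sigma> q"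
  proof (induction q rule: cpoly_induct)
    case zero
    then show ?case by (simp add: psubst_0)
  next
    case (monom q m' c')
    then show ?case
      by (simp only: distrib_left psubst_add mult_single psubst_single monomial_prod_add
          pconst_mult)
        (simp only: ac_simps)
  qed
  then show ?case using monom by (simp add: distrib_right psubst_add)
qed

lemma psubst_diff: "psubst \<sigma> (p - q) = psubst \<sigma> p - psubst \<sigma> q"
  using psubst_add[of \<sigma> "p - q" q] by (simp add: algebra_simps)

lemma psubst_pconst: "psubst \<sigma> (pconst c) = pconst c"
  using psubst_single[of \<sigma> 0 c] by (simp add: pconst_def)

lemma psubst_pvar: "psubst \<sigma> (pvar v) = \<sigma> v"
  using psubst_single[of \<sigma> "single v 1" 1] by (simp add: pvar_def pconst_1)

lemma psubst_power: "psubst \<sigma> (p ^ k) = psubst \<sigma> p ^ k"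
  using psubst_pconst[of \<sigma> 1] by (induction k) (simp_all add: psubst_mult pconst_1)

lemma psubst_prod: "psubst \<sigma> (\<Prod>i\<in>A. f i) = (\<Prod>i\<in>A. psubst \<sigma> (f i))"
  using psubst_pconst[of \<sigma> 1]
  by (induction A rule: infinite_finite_induct) (simp_all add: psubst_mult pconst_1)

lemma psubst_psubst: "psubst \<sigma> (psubst \<tau> p) = psubst (\<lambda>v. psubst \<sigma> (\<tau> v)) p"
  by (induction p rule: cpoly_induct)
    (simp_all only: psubst_0 psubst_add psubst_single psubst_mult psubst_pconst psubst_prod
        psubst_power)

lemma pvar_power: "pvar v ^ k = single (single v k) 1"
proof (induction k)
  case (Suc k)
  have "single v 1 + single v k = single v (Suc k)"
    by (simp add: single_add[symmetric])
  then show ?case using Suc by (simp add: pvar_def mult_single)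
qed simp

lemma poly_mapping_sum_single:
  "(\<Sum>k\<in>keys m. single k (lookup m k)) = m"
  by (rule poly_mapping_eqI) (auto simp: lookup_sum lookup_single when_def in_keys_iff)

lemma psubst_pvar_id: "psubst pvar p = p"
proof (induction p rule: cpoly_induct)
  case (monom p m c)
  have "(\<Prod>v\<in>A. single (f v) (1::complex)) = single (\<Sum>v\<in>A. f v) 1"
    if "finite A" for A and f :: "'a \<Rightarrow> 'a \<Rightarrow>\<^sub>0 nat"
    using that by induction (simp_all add: mult_single)
  then have "(\<Prod>v\<in>keys m. pvar v ^ lookup m v) = single m 1"
    by (simp add: pvar_power poly_mapping_sum_single)
  then have "psubst pvar (single m c) = single m c"
    by (simp only: psubst_single) (simp add: pconst_def mult_single)
  then show ?case using monom by (simp only: psubst_add)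
qed (simp add: psubst_0)

section \<open>Reflections and divided differences\<close>

lemma refl_x_hom:
  "refl_x i 0 = 0"
  "refl_x i (p + q) = refl_x i p + refl_x i q"
  "refl_x i (p - q) = refl_x i p - refl_x i q"
  "refl_x i (p * q) = refl_x i p * refl_x i q"
  "refl_x i (p ^ k) = refl_x i p ^ k"
  "refl_x i (pvar v) = pvar (refl_var i v)"
  by (simp_all add: refl_x_def psubst_0 psubst_add psubst_diff psubst_mult psubst_power psubst_pvar)

lemma refl_x_refl_x: "refl_x i (refl_x j p) = psubst (\<lambda>v. pvar (refl_var i (refl_var j v))) p"
  by (simp add: refl_x_def psubst_psubst psubst_pvar)

lemma refl_var_involutive: "refl_var i (refl_var i v) = v"
  by (cases v) (auto simp: Transposition.transpose_def)

lemma refl_x_involutive: "refl_x i (refl_x i p) = p"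
  by (simp add: refl_x_refl_x refl_var_involutive psubst_pvar_id)

lemma refl_x_commute:
  assumes "Suc i < j"
  shows "refl_x i (refl_x j p) = refl_x j (refl_x i p)"
proof -
  have "refl_var i (refl_var j v) = refl_var j (refl_var i v)" for v
    using assms by (cases v) (auto simp: Transposition.transpose_def)
  then show ?thesis by (simp add: refl_x_refl_x)
qed

lemma refl_x_braid:
  "refl_x i (refl_x (Suc i) (refl_x i p)) = refl_x (Suc i) (refl_x i (refl_x (Suc i) p))"
proof -
  have "refl_var i (refl_var (Suc i) (refl_var i v)) =
      refl_var (Suc i) (refl_var i (refl_var (Suc i) v))" for v
    by (cases v) (auto simp: Transposition.transpose_def)
  then show ?thesis by (simp add: refl_x_refl_x refl_x_def psubst_psubst psubst_pvar)
qed

lemma pvar_inject: "pvar u = pvar v \<longleftrightarrow> u = v"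
proof
  assume "(pvar u :: 'a cpoly) = pvar v"
  then have "peval (\<lambda>x. if x = u then 1 else 0) (pvar u) = peval (\<lambda>x. if x = u then 1 else 0)
      (pvar v)"
    by simp
  then show "u = v" by (simp add: peval_pvar split: if_splits)
qed simp

text \<open>Polynomials in linearly ordered variables form an integral domain, so the factor
  \<open>x\<^sub>i - x\<^bsub>i+1\<^esub>\<close> can be cancelled.\<close>

lemma divided_diff_unique:
  assumes "(pvar (X i) - pvar (X (Suc i))) * g = f - refl_x i f"
  shows "divided_diff i f = g"
  unfolding divided_diff_def
proof (rule the_equality)
  fix g' assume "(pvar (X i) - pvar (X (Suc i))) * g' = f - refl_x i f"
  with assms have "(pvar (X i) - pvar (X (Suc i))) * g' = (pvar (X i) - pvar (X (Suc i))) * g"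
    by simp
  then show "g' = g" by (simp add: pvar_inject)
qed (fact assms)

text \<open>The monomial \<open>\<nu> x\<^sub>i\<^sup>a x\<^bsub>i+1\<^esub>\<^sup>b\<close>, used for \<open>\<nu>\<close> free of the two variables that the
  reflection exchanges.\<close>

definition two_exp :: "nat \<Rightarrow> (yxvar \<Rightarrow>\<^sub>0 nat) \<Rightarrow> nat \<Rightarrow> nat \<Rightarrow> yxvar \<Rightarrow>\<^sub>0 nat" where
  "two_exp i \<nu> a b = \<nu> + single (X i) a + single (X (Suc i)) b"

lemma lookup_two_exp:
  "lookup (two_exp i \<nu> a b) v = lookup \<nu> v +
     (if v = X i then a else if v = X (Suc i) then b else 0)"
  by (auto simp: two_exp_def lookup_add lookup_single when_def)

lemma two_exp_decompose:
  obtains \<nu> where "\<mu> = two_exp i \<nu> (lookup \<mu> (X i)) (lookup \<mu> (X (Suc i)))"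
    "X i \<notin> keys \<nu>" "X (Suc i) \<notin> keys \<nu>"
proof
  let ?\<nu> = "Poly_Mapping.update (X i) 0 (Poly_Mapping.update (X (Suc i)) 0 \<mu>)"
  show "\<mu> = two_exp i ?\<nu> (lookup \<mu> (X i)) (lookup \<mu> (X (Suc i)))"
    by (rule poly_mapping_eqI) (auto simp: lookup_two_exp lookup_update)
qed (auto simp: in_keys_iff lookup_update)

lemma single_two_exp:
  "single (two_exp i \<nu> a b) c =
     single \<nu> c * pvar (X i) ^ a * pvar (X (Suc i)) ^ b"
  by (simp add: pvar_power mult_single two_exp_def)

lemma refl_x_fixed:
  assumes "X i \<notin> keys \<nu>" "X (Suc i) \<notin> keys \<nu>"
  shows "refl_x i (single \<nu> c) = single \<nu> c"
proof -
  have "refl_var i v = v" if "v \<in> keys \<nu>" for v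
    using that assms by (cases v) (auto simp: Transposition.transpose_def)
  then have "refl_x i (single \<nu> c) = psubst pvar (single \<nu> c)"
    by (simp add: refl_x_def psubst_single)
  then show ?thesis by (simp add: psubst_pvar_id)
qed

lemma refl_x_two_exp:
  assumes "X i \<notin> keys \<nu>" "X (Suc i) \<notin> keys \<nu>"
  shows "refl_x i (single (two_exp i \<nu> a b) c) =
    single (two_exp i \<nu> b a) c"
  by (simp add: single_two_exp refl_x_hom refl_x_fixed[OF assms] Transposition.transpose_def)

text \<open>The common factor \<open>\<nu> (x\<^sub>i x\<^bsub>i+1\<^esub>)\<^sup>b\<close> splits off, and what remains is the telescoping
  factorization of \<open>x\<^sub>i\<^bsup>a-b\<^esup> - x\<^bsub>i+1\<^esub>\<^bsup>a-b\<^esup>\<close>.\<close>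

lemma divided_diff_two_exp_ge:
  assumes "X i \<notin> keys \<nu>" "X (Suc i) \<notin> keys \<nu>" "b \<le> a"
  shows "(pvar (X i) - pvar (X (Suc i))) *
      (\<Sum>p<a - b. single (two_exp i \<nu> (b + p) (a - Suc p)) c) =
    single (two_exp i \<nu> a b) c - single (two_exp i \<nu> b a) c"
proof -
  let ?x = "pvar (X i) :: yxvar cpoly" and ?y = "pvar (X (Suc i)) :: yxvar cpoly"
  let ?N = "single \<nu> c"
  have a: "a = b + (a - b)" using assms(3) by simp
  have summand: "single (two_exp i \<nu> (b + p) (a - Suc p)) c =
      ?N * ?x ^ b * ?y ^ b * (?y ^ (a - b - Suc p) * ?x ^ p)" if "p < a - b" for p
  proof -
    have "a - Suc p = b + (a - b - Suc p)" using that by simp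
    then have "?y ^ (a - Suc p) = ?y ^ b * ?y ^ (a - b - Suc p)" by (metis power_add)
    then show ?thesis by (simp add: single_two_exp power_add algebra_simps)
  qed
  have "(\<Sum>p<a - b. single (two_exp i \<nu> (b + p) (a - Suc p)) c) =
      ?N * ?x ^ b * ?y ^ b * (\<Sum>p<a - b. ?y ^ (a - b - Suc p) * ?x ^ p)"
    unfolding sum_distrib_left by (rule sum.cong) (use summand in auto)
  then have "(?x - ?y) * (\<Sum>p<a - b. single (two_exp i \<nu> (b + p) (a - Suc p)) c) =
      ?N * ?x ^ b * ?y ^ b * ((?x - ?y) * (\<Sum>p<a - b. ?y ^ (a - b - Suc p) * ?x ^ p))"
    by (simp only: ac_simps)
  also have "\<dots> = ?N * ?x ^ b * ?y ^ b * (?x ^ (a - b) - ?y ^ (a - b))"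
    by (simp add: power_diff_sumr2)
  also have "\<dots> = ?N * ?x ^ (b + (a - b)) * ?y ^ b - ?N * ?x ^ b * ?y ^ (b + (a - b))"
    by (simp only: power_add) (simp add: algebra_simps)
  also have "\<dots> = single (two_exp i \<nu> a b) c - single (two_exp i \<nu> b a) c"
    by (simp only: a[symmetric] single_two_exp)
  finally show ?thesis .
qed

lemma divided_diff_single_ge:
  assumes "X i \<notin> keys \<nu>" "X (Suc i) \<notin> keys \<nu>" "b \<le> a"
  shows "divided_diff i (single (two_exp i \<nu> a b) c) =
      (\<Sum>p<a - b. single (two_exp i \<nu> (b + p) (a - Suc p)) c)"
  by (rule divided_diff_unique)
    (simp only: divided_diff_two_exp_ge[OF assms] refl_x_two_exp[OF assms(1,2)])

lemma divided_diff_single_le: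
  assumes "X i \<notin> keys \<nu>" "X (Suc i) \<notin> keys \<nu>" "a \<le> b"
  shows "divided_diff i (single (two_exp i \<nu> a b) c) =
      - (\<Sum>p<b - a. single (two_exp i \<nu> (a + p) (b - Suc p)) c)"
  by (rule divided_diff_unique)
    (simp only: divided_diff_two_exp_ge[OF assms] refl_x_two_exp[OF assms(1,2)]
      mult_minus_right minus_diff_eq)

lemma divided_diff_ex: "\<exists>g. (pvar (X i) - pvar (X (Suc i))) * g = f - refl_x i f"
proof (induction f rule: cpoly_induct)
  case zero
  then show ?case by (intro exI[of _ 0]) (simp add: refl_x_hom)
next
  case (monom f \<mu> c)
  let ?a = "lookup \<mu> (X i)" and ?b = "lookup \<mu> (X (Suc i))"
  obtain \<nu> where \<nu>: "\<mu> = two_exp i \<nu> ?a ?b" "X i \<notin> keys \<nu>"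
      "X (Suc i) \<notin> keys \<nu>"
    by (rule two_exp_decompose)
  have "\<exists>g. (pvar (X i) - pvar (X (Suc i))) * g =
      single \<mu> c - refl_x i (single \<mu> c)"
  proof (cases "?b \<le> ?a")
    case True
    from divided_diff_two_exp_ge[OF \<nu>(2,3) this, of c] refl_x_two_exp[OF \<nu>(2,3), of ?a ?b c]
    show ?thesis unfolding \<nu>(1)[symmetric] by auto
  next
    case False
    then have "?a \<le> ?b" by simp
    from divided_diff_two_exp_ge[OF \<nu>(2,3) this, of c, THEN arg_cong[of _ _ uminus]]
      refl_x_two_exp[OF \<nu>(2,3), of ?a ?b c]
    show ?thesis unfolding \<nu>(1)[symmetric]
      by (intro exI) (simp only: mult_minus_right[symmetric] minus_diff_eq)
  qed
  with monom obtain g h where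
    "(pvar (X i) - pvar (X (Suc i))) * g = f - refl_x i f"
    "(pvar (X i) - pvar (X (Suc i))) * h =
      single \<mu> c - refl_x i (single \<mu> c)" by blast
  then have "(pvar (X i) - pvar (X (Suc i))) * (g + h) =
      (f + single \<mu> c) - refl_x i (f + single \<mu> c)"
    by (simp add: distrib_left refl_x_hom)
  then show ?case by blast
qed

lemma divided_diff_eq: "(pvar (X i) - pvar (X (Suc i))) * divided_diff i f = f - refl_x i f"
  using divided_diff_ex[of i f] divided_diff_unique by metis

lemma divided_diff_add: "divided_diff i (f + g) = divided_diff i f + divided_diff i g"
  by (rule divided_diff_unique) (simp add: distrib_left divided_diff_eq refl_x_hom)

text \<open>Each of the two linear factors is fixed by the other reflection, so the product of both
  factors with either side is the alternating sum over the group generated by the two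
  reflections.\<close>

lemma divided_diff_commute:
  assumes "Suc i < j"
  shows "divided_diff i (divided_diff j f) = divided_diff j (divided_diff i f)"
proof -
  let ?u = "pvar (X i) - pvar (X (Suc i)) :: yxvar cpoly"
  let ?v = "pvar (X j) - pvar (X (Suc j)) :: yxvar cpoly"
  have "?u \<noteq> 0" "?v \<noteq> 0" by (simp_all add: pvar_inject)
  have inv: "refl_x i ?v = ?v" "refl_x j ?u = ?u"
    using assms by (auto simp: refl_x_hom Transposition.transpose_def)
  have twice: "v * (u * divided_diff k (divided_diff l f)) =
      f - refl_x l f - refl_x k (f - refl_x l f)"
    if "u = pvar (X k) - pvar (X (Suc k))" "v = pvar (X l) - pvar (X (Suc l))" "refl_x k v = v"
    for k l u v
  proof -
    have "v * (u * divided_diff k (divided_diff l f)) =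
        v * divided_diff l f - refl_x k v * refl_x k (divided_diff l f)"
      by (simp only: that(1) divided_diff_eq[of k] right_diff_distrib that(3))
    also have "\<dots> = v * divided_diff l f - refl_x k (v * divided_diff l f)"
      by (simp only: refl_x_hom)
    finally show ?thesis by (simp only: that(2) divided_diff_eq)
  qed
  have "?v * (?u * divided_diff i (divided_diff j f)) = ?v *
      (?u * divided_diff j (divided_diff i f))"
    using twice[of ?u i ?v j] twice[of ?v j ?u i] inv
    by (simp add: refl_x_hom(3) refl_x_commute[OF assms] mult.left_commute)
  then show ?thesis using \<open>?u \<noteq> 0\<close> \<open>?v \<noteq> 0\<close> by simp
qed

text \<open>Multiplied by the Vandermonde product of three variables, a threefold divided difference
  is the alternating sum of \<open>f\<close> over the six permutations of these variables, written with \<open>s\<close>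
  and \<open>t\<close>. This sum is the same for both sides of the braid relation.\<close>

lemma antisymmetrization_of_chain:
  fixes s t :: "'a::idom \<Rightarrow> 'a"
  assumes s: "\<And>a b. s (a - b) = s a - s b" "\<And>a b. s (a * b) = s a * s b" "\<And>a. s (s a) = a"
    and t: "\<And>a b. t (a - b) = t a - t b" "\<And>a b. t (a * b) = t a * t b"
    and x: "s x1 = x2" "s x2 = x1" "s x3 = x3" "t x1 = x1" "t x2 = x3" "t x3 = x2" "x1 \<noteq> x2"
    and g: "(x1 - x2) * g = f - s f" and k: "(x2 - x3) * k = g - t g"
        and l: "(x1 - x2) * l = k - s k"
  shows "(x1 - x2) * (x1 - x3) * (x2 - x3) * l = f - s f - t f + t (s f) + s (t f) - s (t (s f))"
proof -
  have "(x2 - x1) * s g = s f - f"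
    using arg_cong[OF g, of s] by (simp add: s x)
  moreover have "(x1 - x2) * s g = - ((x2 - x1) * s g)"
      by (simp only: left_diff_distrib minus_diff_eq)
  ultimately have "(x1 - x2) * s g = (x1 - x2) * g" unfolding g by (simp only: minus_diff_eq)
  \<comment> \<open>A divided difference is symmetric in the two variables.\<close>
  then have sg: "s g = g" using x(7) by simp
  have sk: "(x1 - x3) * s k = g - s (t g)"
    using arg_cong[OF k, of s] by (simp add: s x sg)
  have tg: "(x1 - x3) * t g = t f - t (s f)"
    using arg_cong[OF g, of t] by (simp add: t x)
  have stg: "(x2 - x3) * s (t g) = s (t f) - s (t (s f))"
    using arg_cong[OF tg, of s] by (simp add: s x)
  have "(x1 - x2) * (x1 - x3) * (x2 - x3) * l = (x1 - x3) * (x2 - x3) * ((x1 - x2) * l)"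
    by (simp only: ac_simps)
  also have "\<dots> = (x1 - x3) * ((x2 - x3) * k) - (x2 - x3) * ((x1 - x3) * s k)"
    unfolding l by (simp only: algebra_simps)
  also have "\<dots> = (x1 - x2) * g - (x1 - x3) * t g + (x2 - x3) * s (t g)"
    unfolding k sk by (simp only: algebra_simps)
  also have "\<dots> = f - s f - t f + t (s f) + s (t f) - s (t (s f))"
    unfolding g tg stg by simp
  finally show ?thesis .
qed

lemma divided_diff_braid:
  "divided_diff i (divided_diff (Suc i) (divided_diff i f)) =
   divided_diff (Suc i) (divided_diff i (divided_diff (Suc i) f))" (is "?l = ?r")
proof -
  let ?x1 = "pvar (X i) :: yxvar cpoly" and ?x2 = "pvar (X (Suc i)) :: yxvar cpoly"
    and ?x3 = "pvar (X (Suc (Suc i))) :: yxvar cpoly"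
  let ?s = "refl_x i" and ?t = "refl_x (Suc i)"
  have 1: "(?x1 - ?x2) * (?x1 - ?x3) * (?x2 - ?x3) * ?l =
      f - ?s f - ?t f + ?t (?s f) + ?s (?t f) - ?s (?t (?s f))"
    by (rule antisymmetrization_of_chain[where g = "divided_diff i f"
          and k = "divided_diff (Suc i) (divided_diff i f)"])
      (simp_all add: refl_x_hom(3,4,6) refl_x_involutive Transposition.transpose_def pvar_inject
        divided_diff_eq)
  have uminus: "?s (- h) = - ?s h" for h
    using refl_x_hom(3)[of i 0 h] by (simp add: refl_x_hom(1))
  have swap: "(c - b) * (c - a) * (b - a) * - r = (a - b) * (a - c) * (b - c) * r"
    "(b - a) * - r = (a - b) * r" for a b c r :: "yxvar cpoly"
    by (simp_all add: algebra_simps)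
  \<comment> \<open>The other chain is the same one for the variables in reverse order, which costs
    a sign at the first and at the last step.\<close>
  have 2: "(?x3 - ?x2) * (?x3 - ?x1) * (?x2 - ?x1) * - ?r =
      f - ?t f - ?s f + ?s (?t f) + ?t (?s f) - ?t (?s (?t f))"
  proof (rule antisymmetrization_of_chain[where g = "- divided_diff (Suc i) f"
          and k = "divided_diff i (divided_diff (Suc i) f)"])
    show "(?x2 - ?x1) * divided_diff i (divided_diff (Suc i) f) =
        - divided_diff (Suc i) f - ?s (- divided_diff (Suc i) f)"
      using divided_diff_eq[of i "divided_diff (Suc i) f"] by (simp add: uminus algebra_simps)
  qed (simp_all add: refl_x_hom(3,4,6) refl_x_involutive Transposition.transpose_def pvar_inject
        divided_diff_eq swap(2) del: mult_minus_right)
  have "(?x1 - ?x2) * (?x1 - ?x3) * (?x2 - ?x3) * ?l = (?x1 - ?x2) * (?x1 - ?x3) * (?x2 - ?x3) * ?r"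
    unfolding 1 2[unfolded swap(1)] refl_x_braid[of i f] by (simp only: algebra_simps)
  then show ?thesis by (simp add: pvar_inject)
qed

section \<open>Lehmer codes\<close>

lemma lehmer_swap_left:
  assumes "w i < w (Suc i)" "i < n"
  shows "lehmer n (w \<circ> simple_refl i) i = Suc (lehmer n w (Suc i))"
proof -
  have "{j. i < j \<and> j \<le> n \<and> (w \<circ> simple_refl i) j < (w \<circ> simple_refl i) i} =
      insert (Suc i) {j. Suc i < j \<and> j \<le> n \<and> w j < w (Suc i)}"
    using assms by (auto simp: Transposition.transpose_def split: if_splits)
  then show ?thesis by (simp add: lehmer_def)
qed

lemma lehmer_swap_right:
  assumes "w i < w (Suc i)"
  shows "lehmer n (w \<circ> simple_refl i) (Suc i) = lehmer n w i"
proof -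
  have "{j. Suc i < j \<and> j \<le> n \<and> (w \<circ> simple_refl i) j < (w \<circ> simple_refl i) (Suc i)} =
      {j. i < j \<and> j \<le> n \<and> w j < w i}"
    using assms by (auto simp: Transposition.transpose_def split: if_splits)
  then show ?thesis by (simp add: lehmer_def)
qed

lemma lehmer_swap_other:
  assumes "j \<noteq> i" "j \<noteq> Suc i" "i < n"
  shows "lehmer n (w \<circ> simple_refl i) j = lehmer n w j"
proof -
  have "{k. j < k \<and> k \<le> n \<and> (w \<circ> simple_refl i) k < (w \<circ> simple_refl i) j} =
      simple_refl i ` {k. j < k \<and> k \<le> n \<and> w k < w j}" (is "?A = ?B")
  proof
    show "?A \<subseteq> ?B"
    proof
      fix k assume "k \<in> ?A"
      then have "simple_refl i k \<in> {k. j < k \<and> k \<le> n \<and> w k < w j}"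
        using assms by (auto simp: Transposition.transpose_def split: if_splits)
      then show "k \<in> ?B" by (metis image_eqI transpose_involutory)
    qed
    show "?B \<subseteq> ?A"
      using assms by (auto simp: Transposition.transpose_def split: if_splits)
  qed
  then show ?thesis by (simp add: lehmer_def card_image)
qed

lemma perm_length_sum_lehmer: "perm_length n w = (\<Sum>k=1..n. lehmer n w k)"
proof -
  have "{(i, j). 1 \<le> i \<and> i < j \<and> j \<le> n \<and> w j < w i} =
      Sigma {1..n} (\<lambda>i. {j. i < j \<and> j \<le> n \<and> w j < w i})" by auto
  then show ?thesis by (simp add: perm_length_def lehmer_def)
qed

lemma perm_length_le: "perm_length n w \<le> n * n"
proof -
  have "{(i, j). 1 \<le> i \<and> i < j \<and> j \<le> n \<and> w j < w i} \<subseteq> {1..n} \<times> {1..n}" by auto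
  from card_mono[OF _ this] show ?thesis by (simp add: perm_length_def)
qed

lemma perm_length_swap:
  assumes "w i < w (Suc i)" "1 \<le> i" "i < n"
  shows "perm_length n (w \<circ> simple_refl i) = perm_length n w + 1"
proof -
  have split: "(\<Sum>k=1..n. f k) = f i + f (Suc i) + (\<Sum>k\<in>{1..n} - {i, Suc i}. f k)"
    for f :: "nat \<Rightarrow> nat"
    using assms(2,3) sum.subset_diff[of "{i, Suc i}" "{1..n}" f] by simp
  show ?thesis
    unfolding perm_length_sum_lehmer split
    using assms by (simp add: lehmer_swap_left lehmer_swap_right lehmer_swap_other)
qed

lemma perm_length_swap_iff:
  assumes "w permutes {1..n}" "1 \<le> i" "i < n"
  shows "perm_length n (w \<circ> simple_refl i) = perm_length n w + 1 \<longleftrightarrow> w i < w (Suc i)"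
proof (cases "w i < w (Suc i)")
  case False
  have "w i \<noteq> w (Suc i)" using permutes_inj[OF assms(1)] by (simp add: inj_eq)
  then have "w (Suc i) < w i" using False by simp
  then have "perm_length n ((w \<circ> simple_refl i) \<circ> simple_refl i) =
      perm_length n (w \<circ> simple_refl i) + 1"
    using assms by (intro perm_length_swap) auto
  then show ?thesis using False by (simp add: comp_assoc)
qed (use perm_length_swap assms in auto)

lemma permutes_swap:
  assumes "w permutes {1..n}" "1 \<le> i" "i < n"
  shows "(w \<circ> simple_refl i) permutes {1..n}"
  using assms by (intro permutes_compose[OF permutes_swap_id]) auto

lemma longest_perm_permutes: "longest_perm n permutes {1..n}"
  by (rule bij_imp_permutes, rule bij_betw_byWitness[where f' = "longest_perm n"])
    (auto simp: longest_perm_def)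

lemma no_ascent_longest_perm:
  assumes w: "w permutes {1..n}" and desc: "\<And>i. 1 \<le> i \<Longrightarrow> i < n \<Longrightarrow> w (Suc i) < w i"
  shows "w = longest_perm n"
proof
  fix j
  have range: "w j \<in> {1..n}" if "j \<in> {1..n}" for j using that
      by (simp only: permutes_in_image[OF w])
  have upper: "j \<in> {1..n} \<Longrightarrow> w j + j \<le> n + 1" for j
  proof (induction j)
    case (Suc j)
    show ?case
    proof (cases "j = 0")
      case True
      then show ?thesis using range[of 1] Suc.prems by auto
    next
      case False
      then show ?thesis using Suc desc[of j] by force
    qed
  qed simp
  have lower: "d < n \<Longrightarrow> d + 1 \<le> w (n - d)" for d
  proof (induction d)
    case 0
    then show ?case using range[of n] by auto
  next
    case (Suc d)
    then have "w (n - d) < w (n - Suc d)" using desc[of "n - Suc d"] by (simp add: Suc_diff_Suc)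
    then show ?case using Suc by simp
  qed
  show "w j = longest_perm n j"
  proof (cases "j \<in> {1..n}")
    case True
    then show ?thesis using upper[of j] lower[of "n - j"] by (auto simp: longest_perm_def)
  next
    case False
    then show ?thesis using w by (auto simp: permutes_def longest_perm_def)
  qed
qed

lemma longest_perm_descends: "1 \<le> i \<Longrightarrow> i < n \<Longrightarrow> longest_perm n (Suc i) < longest_perm n i"
  by (simp add: longest_perm_def)

section \<open>Uniqueness of double Schubert polynomials\<close>

lemma is_double_schubert_permutes: "is_double_schubert n w f \<Longrightarrow> w permutes {1..n}"
  by (induction rule: is_double_schubert.induct) (rule longest_perm_permutes, assumption)

lemma is_double_schubert_step:
  assumes "w permutes {1..n}" "1 \<le> i" "i < n" "w i < w (Suc i)"
    "is_double_schubert n (w \<circ> simple_refl i) g"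
  shows "is_double_schubert n w (divided_diff i g)"
  using assms by (intro is_double_schubert.step perm_length_swap) auto

text \<open>Descending from the longest permutation always through the last ascent keeps control
  over the leading monomials; see \<open>divided_diff_monomials_tail\<close>.\<close>

lemma last_ascent:
  assumes w: "w permutes {1..n}" and "w \<noteq> longest_perm n"
  obtains i where "1 \<le> i" "i < n" "w i < w (Suc i)" "\<And>j. i < j \<Longrightarrow> j < n \<Longrightarrow> w (Suc j) < w j"
proof -
  let ?A = "{i. 1 \<le> i \<and> i < n \<and> w i < w (Suc i)}"
  have desc: "w (Suc j) < w j" if "\<not> w j < w (Suc j)" for j
    using that permutes_inj[OF w] by (metis inj_eq n_not_Suc_n nat_neq_iff)
  have "?A \<noteq> {}" using no_ascent_longest_perm[OF w] desc assms(2) by blast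
  moreover have "finite ?A" by simp
  ultimately have "Max ?A \<in> ?A" "\<And>j. j \<in> ?A \<Longrightarrow> j \<le> Max ?A" using Max_in Max_ge by blast+
  moreover define i where "i = Max ?A"
  ultimately have i: "i \<in> ?A" and max: "\<And>j. j \<in> ?A \<Longrightarrow> j \<le> i" by simp_all
  show thesis
  proof (rule that[of i])
    fix j assume "i < j" "j < n"
    then have "j \<notin> ?A" using max by (meson not_le)
    then show "w (Suc j) < w j" using desc \<open>i < j\<close> \<open>j < n\<close> by simp
  qed (use i in auto)
qed

lemma is_double_schubert_ex: "w permutes {1..n} \<Longrightarrow> \<exists>f. is_double_schubert n w f"
proof (induction "n * n - perm_length n w" arbitrary: w rule: less_induct)
  case less
  show ?case
  proof (cases "w = longest_perm n")
    case True
    then show ?thesis using is_double_schubert.longest by blast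
  next
    case False
    then obtain i where i: "1 \<le> i" "i < n" "w i < w (Suc i)" by (rule last_ascent[OF less.prems])
    let ?u = "w \<circ> simple_refl i"
    have "n * n - perm_length n ?u < n * n - perm_length n w"
      using perm_length_swap[OF i(3,1,2)] perm_length_le[of n ?u] by simp
    with less.hyps permutes_swap[OF less.prems i(1,2)] obtain g where "is_double_schubert n ?u g"
      by blast
    then show ?thesis using is_double_schubert_step[OF less.prems i] by blast
  qed
qed

lemma is_double_schubert_cases:
  assumes "is_double_schubert n w f"
  obtains
    (longest) "w = longest_perm n"
        "f = (\<Prod>(i, j)\<in>{(i, j). 1 \<le> i \<and> 1 \<le> j \<and> i + j \<le> n}. pvar (X i) - pvar (Y j))"
  | (step) i g where "1 \<le> i" "i < n" "w i < w (Suc i)"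
      "is_double_schubert n (w \<circ> simple_refl i) g" "f = divided_diff i g"
  using assms
proof cases
  case longest
  then show ?thesis using that(1) by blast
next
  case (step i g)
  then show ?thesis using that(2) perm_length_swap_iff[of w n i] by blast
qed

text \<open>A diamond argument by induction on the colength. Two chains that end with different
  steps \<open>i\<close> and \<open>j\<close> are both compared with chains that come from a common longer permutation,
  namely \<open>w s\<^sub>i s\<^sub>j\<close> if the reflections commute, and \<open>w s\<^sub>i s\<^sub>j s\<^sub>i = w s\<^sub>j s\<^sub>i s\<^sub>j\<close> if they are
  adjacent.\<close>

lemma is_double_schubert_unique:
  "is_double_schubert n w f \<Longrightarrow> is_double_schubert n w f' \<Longrightarrow> f = f'"
proof (induction "n * n - perm_length n w" arbitrary: w f f' rule: less_induct)
  case less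
  have w: "w permutes {1..n}" by (rule is_double_schubert_permutes[OF less.prems(1)])
  have IH: "g = g'"
    if "1 \<le> i" "i < n" "w i < w (Suc i)"
      "is_double_schubert n (w \<circ> simple_refl i) g" "is_double_schubert n (w \<circ> simple_refl i) g'"
    for i g g'
  proof -
    have "n * n - perm_length n (w \<circ> simple_refl i) < n * n - perm_length n w"
      using perm_length_swap[OF that(3,1,2)] perm_length_le[of n "w \<circ> simple_refl i"] by simp
    then show ?thesis using less.hyps that by blast
  qed
  have ordered: "divided_diff i g = divided_diff j g'"
    if ij: "i < j" and i: "1 \<le> i" "i < n" "w i < w (Suc i)"
        "is_double_schubert n (w \<circ> simple_refl i) g"
      and j: "j < n" "w j < w (Suc j)" "is_double_schubert n (w \<circ> simple_refl j) g'"
    for i j g g'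
  proof -
    let ?i = "simple_refl i" and ?j = "simple_refl j"
    have perm: "(v \<circ> simple_refl k) permutes {1..n}" if "v permutes {1..n}" "k = i \<or> k = j" for v k
      using that i ij j(1) by (intro permutes_swap) auto
    have perms: "(w \<circ> ?i) permutes {1..n}" "(w \<circ> ?j) permutes {1..n}"
      "(w \<circ> ?i \<circ> ?j) permutes {1..n}" "(w \<circ> ?j \<circ> ?i) permutes {1..n}"
      "(w \<circ> ?i \<circ> ?j \<circ> ?i) permutes {1..n}"
      using perm[OF w] perm[OF perm[OF w]] perm[OF perm[OF perm[OF w]]] by blast+
    show ?thesis
    proof (cases "j = Suc i")
      case False
      then have far: "Suc i < j" using ij by simp
      have eq: "w \<circ> ?i \<circ> ?j = w \<circ> ?j \<circ> ?i"
        using far by (auto simp: fun_eq_iff Transposition.transpose_def)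
      obtain h where h: "is_double_schubert n (w \<circ> ?i \<circ> ?j) h"
        using is_double_schubert_ex perms(3) by blast
      have "is_double_schubert n (w \<circ> ?i) (divided_diff j h)"
        by (rule is_double_schubert_step[OF perms(1) _ _ _ h])
          (use far j i in \<open>auto simp: Transposition.transpose_def\<close>)
      moreover have "is_double_schubert n (w \<circ> ?j) (divided_diff i h)"
        by (rule is_double_schubert_step[OF perms(2) _ _ _ h[unfolded eq]])
          (use far j i in \<open>auto simp: Transposition.transpose_def\<close>)
      ultimately show ?thesis
        using IH[of i g] IH[of j g'] i j ij divided_diff_commute[OF far, of h] by auto
    next
      case True
      have eq: "w \<circ> ?i \<circ> ?j \<circ> ?i = w \<circ> ?j \<circ> ?i \<circ> ?j"
        using True by (auto simp: fun_eq_iff Transposition.transpose_def)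
      obtain h where h: "is_double_schubert n (w \<circ> ?i \<circ> ?j \<circ> ?i) h"
        using is_double_schubert_ex perms(5) by blast
      have "is_double_schubert n (w \<circ> ?i \<circ> ?j) (divided_diff i h)"
        by (rule is_double_schubert_step[OF perms(3) _ _ _ h])
          (use True j i in \<open>auto simp: Transposition.transpose_def\<close>)
      then have "is_double_schubert n (w \<circ> ?i) (divided_diff j (divided_diff i h))"
        by (rule is_double_schubert_step[OF perms(1), rotated 3])
          (use True j i in \<open>auto simp: Transposition.transpose_def\<close>)
      moreover have "is_double_schubert n (w \<circ> ?j \<circ> ?i) (divided_diff j h)"
        by (rule is_double_schubert_step[OF perms(4) _ _ _ h[unfolded eq]])
          (use True j i in \<open>auto simp: Transposition.transpose_def\<close>)
      then have "is_double_schubert n (w \<circ> ?j) (divided_diff i (divided_diff j h))"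
        by (rule is_double_schubert_step[OF perms(2), rotated 3])
          (use True j i in \<open>auto simp: Transposition.transpose_def\<close>)
      ultimately show ?thesis
        using IH[of i g] IH[of j g'] i j True divided_diff_braid[of i h] by auto
    qed
  qed
  from less.prems(1) show ?case
  proof (cases rule: is_double_schubert_cases)
    case longest
    from less.prems(2) show ?thesis
      by (cases rule: is_double_schubert_cases)
        (use longest longest_perm_descends[of _ n] in \<open>auto dest: order_less_asym\<close>)
  next
    case (step i g)
    note i = step
    from less.prems(2) show ?thesis
    proof (cases rule: is_double_schubert_cases)
      case longest
      then show ?thesis using i longest_perm_descends[of i n] by simp
    next
      case (step j g')
      consider "i < j" | "i = j" | "j < i" by linarith
      then show ?thesis
      proof cases
        case 1
        then show ?thesis using ordered[of i j g g'] i step by simp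
      next
        case 2
        then show ?thesis using IH[of i g g'] i step by simp
      next
        case 3
        then show ?thesis using ordered[of j i g' g] i step by simp
      qed
    qed
  qed
qed

lemma double_schubert_eqI: "is_double_schubert n w f \<Longrightarrow> double_schubert n w = f"
  unfolding double_schubert_def using is_double_schubert_unique by blast

section \<open>Leading monomials of double Schubert polynomials\<close>

text \<open>In one degree these are the vectors \<open>m\<close> that may replace \<open>c\<close> in straightening.\<close>

definition lex_above :: "nat \<Rightarrow> (nat \<Rightarrow> nat) \<Rightarrow> (nat \<Rightarrow> nat) \<Rightarrow> bool" where
  "lex_above n c m \<longleftrightarrow> (\<exists>l\<in>{1..n}. (\<forall>j\<in>{1..<l}. m j = c j) \<and> c l < m l)"

definition xexponent :: "nat \<Rightarrow> (nat \<Rightarrow> nat) \<Rightarrow> yxvar \<Rightarrow>\<^sub>0 nat" where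
  "xexponent n c = (\<Sum>i=1..n. single (X i) (c i))"

lemma lookup_xexponent:
  "lookup (xexponent n c) (X i) = (if i \<in> {1..n} then c i else 0)"
  "lookup (xexponent n c) (Y i) = 0"
  by (auto simp: xexponent_def lookup_sum lookup_single when_def)

text \<open>The monomials that may accompany the leading monomial \<open>x\<^sup>c\<close>. The bound by \<open>n - i\<close> is the
  one that the staircase product satisfies; divided differences preserve it, and it is what
  makes the lexicographic comparison survive them.\<close>

definition tail_monomials :: "nat \<Rightarrow> (nat \<Rightarrow> nat) \<Rightarrow> (yxvar \<Rightarrow>\<^sub>0 nat) set" where
  "tail_monomials n c = {\<mu>. keys \<mu> \<subseteq> yxvars n \<and>
     (\<forall>i\<in>{1..n}. lookup \<mu> (X i) \<le> n - i) \<and>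
     (\<Sum>v\<in>yxvars n. lookup \<mu> v) = (\<Sum>i=1..n. c i) \<and>
     ((\<exists>i. lookup \<mu> (Y i) \<noteq> 0) \<or>
       lex_above n c (\<lambda>i. lookup \<mu> (X i)))}"

definition has_leading_code :: "nat \<Rightarrow> (nat \<Rightarrow> nat) \<Rightarrow> yxvar cpoly \<Rightarrow> bool" where
  "has_leading_code n c f \<longleftrightarrow>
     (\<exists>g. f = single (xexponent n c) 1 + g \<and> keys g \<subseteq> tail_monomials n c)"

lemma keys_sum_subset: "keys (sum f A) \<subseteq> (\<Union>a\<in>A. keys (f a))"
proof (induction A rule: infinite_finite_induct)
  case (insert a A)
  then show ?case using keys_add[of "f a" "sum f A"] by auto
qed auto

lemma keys_uminus: "keys (- f) = keys (f :: 'a \<Rightarrow>\<^sub>0 complex)"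
  by (auto simp: in_keys_iff)

text \<open>Contains the monomials of the \<open>i\<close>-th divided difference of \<open>\<mu>\<close>, by the telescoping
  factorization.\<close>

definition divided_diff_monomials :: "nat \<Rightarrow> (yxvar \<Rightarrow>\<^sub>0 nat) \<Rightarrow> (yxvar \<Rightarrow>\<^sub>0 nat) set" where
  "divided_diff_monomials i \<mu> = {\<kappa>. (\<forall>v. v \<noteq> X i \<and> v \<noteq> X (Suc i) \<longrightarrow> lookup \<kappa> v = lookup \<mu> v) \<and>
     lookup \<kappa> (X i) + lookup \<kappa> (X (Suc i)) + 1 =
       lookup \<mu> (X i) + lookup \<mu> (X (Suc i)) \<and>
     min (lookup \<mu> (X i)) (lookup \<mu> (X (Suc i))) \<le> lookup \<kappa> (X i) \<and>
     lookup \<kappa> (X i) < max (lookup \<mu> (X i)) (lookup \<mu> (X (Suc i)))}"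

lemma keys_divided_diff_single:
  "keys (divided_diff i (single \<mu> k)) \<subseteq> divided_diff_monomials i \<mu>"
proof -
  let ?a = "lookup \<mu> (X i)" and ?b = "lookup \<mu> (X (Suc i))"
  obtain \<nu> where \<nu>: "\<mu> = two_exp i \<nu> ?a ?b" "X i \<notin> keys \<nu>"
      "X (Suc i) \<notin> keys \<nu>"
    by (rule two_exp_decompose)
  have look: "lookup \<mu> v = lookup \<nu> v" if "v \<noteq> X i" "v \<noteq> X (Suc i)" for v
    using arg_cong[OF \<nu>(1), of "\<lambda>m. lookup m v"] that by (simp add: lookup_two_exp)
  have mem: "two_exp i \<nu> p q \<in> divided_diff_monomials i \<mu>"
    if "p + q + 1 = ?a + ?b" "min ?a ?b \<le> p" "p < max ?a ?b" for p q
    using that \<nu>(2,3) by (simp add: divided_diff_monomials_def lookup_two_exp look in_keys_iff)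
  show ?thesis
  proof (cases "?b \<le> ?a")
    case True
    have "divided_diff i (single \<mu> k) =
        (\<Sum>p<?a - ?b. single (two_exp i \<nu> (?b + p) (?a - Suc p)) k)"
      using divided_diff_single_ge[OF \<nu>(2,3) True, of k] \<nu>(1) by simp
    then show ?thesis using True
      by (auto intro!: mem dest!: subsetD[OF keys_sum_subset] split: if_splits)
  next
    case False
    then have le: "?a \<le> ?b" by simp
    have "divided_diff i (single \<mu> k) =
        - (\<Sum>p<?b - ?a. single (two_exp i \<nu> (?a + p) (?b - Suc p)) k)"
      using divided_diff_single_le[OF \<nu>(2,3) le, of k] \<nu>(1) by simp
    then show ?thesis using le
      by (auto intro!: mem simp: keys_uminus dest!: subsetD[OF keys_sum_subset] split: if_splits)
  qed
qed

text \<open>If \<open>x\<^sub>i\<close> has the larger exponent, the term with the smallest power of \<open>x\<^sub>i\<close> is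
  lexicographically least; it is \<open>\<kappa>\<close>.\<close>

lemma divided_diff_single_leading:
  assumes "lookup \<mu> (X (Suc i)) < lookup \<mu> (X i)"
  obtains \<kappa> g where "divided_diff i (single \<mu> k) = single \<kappa> k + g"
    "\<And>v. v \<noteq> X i \<Longrightarrow> v \<noteq> X (Suc i) \<Longrightarrow> lookup \<kappa> v = lookup \<mu> v"
    "lookup \<kappa> (X i) = lookup \<mu> (X (Suc i))"
    "lookup \<kappa> (X (Suc i)) = lookup \<mu> (X i) - 1"
    "\<And>\<rho>. \<rho> \<in> keys g \<Longrightarrow> \<rho> \<in> divided_diff_monomials i \<mu> \<and>
       lookup \<mu> (X (Suc i)) < lookup \<rho> (X i)"
proof -
  let ?a = "lookup \<mu> (X i)" and ?b = "lookup \<mu> (X (Suc i))"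
  obtain \<nu> where \<nu>: "\<mu> = two_exp i \<nu> ?a ?b" "X i \<notin> keys \<nu>"
      "X (Suc i) \<notin> keys \<nu>"
    by (rule two_exp_decompose)
  have look: "lookup \<mu> v = lookup \<nu> v" if "v \<noteq> X i" "v \<noteq> X (Suc i)" for v
    using arg_cong[OF \<nu>(1), of "\<lambda>m. lookup m v"] that by (simp add: lookup_two_exp)
  let ?g = "\<Sum>p\<in>{1..<?a - ?b}. single (two_exp i \<nu> (?b + p) (?a - Suc p)) k"
  have "{..<?a - ?b} = insert 0 {1..<?a - ?b}" using assms by auto
  then have split: "(\<Sum>p<?a - ?b. single (two_exp i \<nu> (?b + p) (?a - Suc p)) k) =
      single (two_exp i \<nu> ?b (?a - 1)) k + ?g" by simp
  show thesis
  proof (rule that)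
    show "divided_diff i (single \<mu> k) = single (two_exp i \<nu> ?b (?a - 1)) k + ?g"
      unfolding split[symmetric]
      using divided_diff_single_ge[OF \<nu>(2,3), of ?b ?a k] assms \<nu>(1) by simp
  next
    fix \<rho> assume "\<rho> \<in> keys ?g"
    then obtain p where "p \<in> {1..<?a - ?b}" "\<rho> = two_exp i \<nu> (?b + p) (?a - Suc p)"
      by (auto dest!: subsetD[OF keys_sum_subset] split: if_splits)
    then show "\<rho> \<in> divided_diff_monomials i \<mu> \<and> ?b < lookup \<rho> (X i)"
      using \<nu>(2,3) by (auto simp: divided_diff_monomials_def lookup_two_exp look in_keys_iff)
  qed (use \<nu>(2,3) in \<open>auto simp: lookup_two_exp look in_keys_iff\<close>)
qed

lemma keys_divided_diff:
  assumes "keys f \<subseteq> A" "\<And>\<mu>. \<mu> \<in> A \<Longrightarrow> divided_diff_monomials i \<mu> \<subseteq> B"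
  shows "keys (divided_diff i f) \<subseteq> B"
proof -
  have dd_sum: "divided_diff i (\<Sum>m\<in>M. h m) = (\<Sum>m\<in>M. divided_diff i (h m))" if "finite M"
    for M :: "(yxvar \<Rightarrow>\<^sub>0 nat) set" and h
    using that
  proof induction
    case empty
    show ?case by (simp, rule divided_diff_unique) (simp add: refl_x_hom)
  qed (simp add: divided_diff_add)
  have "divided_diff i f =
      (\<Sum>m\<in>keys f. divided_diff i (single m (lookup f m)))"
    using dd_sum[of "keys f" "\<lambda>m. single m (lookup f m)"]
    by (simp add: poly_mapping_sum_single)
  then show ?thesis
    using assms keys_divided_diff_single by (fastforce dest!: subsetD[OF keys_sum_subset])
qed

lemma sum_yxvars_split:
  assumes "1 \<le> i" "i < n"
  shows "(\<Sum>v\<in>yxvars n. f v) = f (X i) + f (X (Suc i)) +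
      (\<Sum>v\<in>yxvars n - {X i, X (Suc i)}. (f v :: nat))"
  using assms sum.subset_diff[of "{X i, X (Suc i)}" "yxvars n" f] by (auto simp: yxvars_def)

lemma sum_atLeastAtMost_split:
  assumes "1 \<le> i" "i < n"
  shows "(\<Sum>k=1..n. f k) = f i + f (Suc i) + (\<Sum>k\<in>{1..n} - {i, Suc i}. (f k :: nat))"
  using assms sum.subset_diff[of "{i, Suc i}" "{1..n}" f] by simp

text \<open>The induction step for leading monomials. It is applied at the last ascent \<open>i\<close> of a
  permutation with code \<open>c(i := c (Suc i), Suc i := c i - 1)\<close>, where \<open>c i\<close> has the largest
  possible value \<open>n - i\<close>. A divided difference could turn a lexicographically larger monomial
  into a smaller one only if the first difference were a larger exponent of \<open>x\<^sub>i\<close>, and this is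
  excluded by the bound on the exponents.\<close>

lemma divided_diff_monomials_tail:
  assumes i: "1 \<le> i" "i < n" and c: "c i = n - i" "c (Suc i) < c i"
    and keys: "keys \<mu> \<subseteq> yxvars n"
    and bound: "\<forall>i\<in>{1..n}. lookup \<mu> (X i) \<le> n - i"
    and deg: "(\<Sum>v\<in>yxvars n. lookup \<mu> v) = (\<Sum>i=1..n. c i)"
    and \<kappa>: "\<kappa> \<in> divided_diff_monomials i \<mu>"
    and tail: "(\<exists>i. lookup \<mu> (Y i) \<noteq> 0) \<or>
       lex_above n c (\<lambda>i. lookup \<mu> (X i)) \<or>
       (\<mu> = xexponent n c \<and> c (Suc i) < lookup \<kappa> (X i))"
  shows "\<kappa> \<in> tail_monomials n (c(i := c (Suc i), Suc i := c i - 1))" (is "_ \<in> tail_monomials n ?c")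
proof -
  have other: "lookup \<kappa> v = lookup \<mu> v" if "v \<noteq> X i" "v \<noteq> X (Suc i)" for v
    using \<kappa> that by (simp add: divided_diff_monomials_def)
  let ?a = "lookup \<mu> (X i)" and ?b = "lookup \<mu> (X (Suc i))"
  let ?p = "lookup \<kappa> (X i)" and ?q = "lookup \<kappa> (X (Suc i))"
  have pq: "?p + ?q + 1 = ?a + ?b" "min ?a ?b \<le> ?p" "?p < max ?a ?b"
    using \<kappa> by (simp_all add: divided_diff_monomials_def)
  have ab: "?a \<le> n - i" "?b \<le> n - Suc i" using bound i by auto
  have "keys \<kappa> \<subseteq> yxvars n"
  proof
    fix v assume v: "v \<in> keys \<kappa>"
    then show "v \<in> yxvars n"
    proof (cases "v = X i \<or> v = X (Suc i)")
      case True
      then show ?thesis using i by (auto simp: yxvars_def)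
    next
      case False
      then show ?thesis using v other[of v] subsetD[OF keys, of v] by (simp add: in_keys_iff)
    qed
  qed
  moreover have "\<forall>j\<in>{1..n}. lookup \<kappa> (X j) \<le> n - j"
  proof
    fix j assume j: "j \<in> {1..n}"
    consider "j = i" | "j = Suc i" | "j \<noteq> i" "j \<noteq> Suc i" by blast
    then show "lookup \<kappa> (X j) \<le> n - j"
    proof cases
      case 1
      then show ?thesis using pq ab by simp
    next
      case 2
      then show ?thesis using pq ab i by simp
    next
      case 3
      then show ?thesis using other[of "X j"] bound j by simp
    qed
  qed
  moreover have "(\<Sum>v\<in>yxvars n. lookup \<kappa> v) = (\<Sum>j=1..n. ?c j)"
  proof -
    have "(\<Sum>v\<in>yxvars n - {X i, X (Suc i)}. lookup \<kappa> v) =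
        (\<Sum>v\<in>yxvars n - {X i, X (Suc i)}. lookup \<mu> v)"
      by (rule sum.cong) (use other in auto)
    moreover have "(\<Sum>k\<in>{1..n} - {i, Suc i}. ?c k) = (\<Sum>k\<in>{1..n} - {i, Suc i}. c k)"
      by (rule sum.cong) auto
    ultimately show ?thesis
      using deg pq c unfolding sum_yxvars_split[OF i] sum_atLeastAtMost_split[OF i] by simp
  qed
  moreover have "(\<exists>j. lookup \<kappa> (Y j) \<noteq> 0) \<or>
      lex_above n ?c (\<lambda>j. lookup \<kappa> (X j))"
    using tail
  proof (elim disjE)
    assume "\<exists>j. lookup \<mu> (Y j) \<noteq> 0"
    then show ?thesis using other by auto
  next
    assume "lex_above n c (\<lambda>j. lookup \<mu> (X j))"
    then obtain l where l: "l \<in> {1..n}" "\<forall>j\<in>{1..<l}. lookup \<mu> (X j) = c j"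
        "c l < lookup \<mu> (X l)"
      by (auto simp: lex_above_def)
    consider "l < i" | "l = i" | "l = Suc i" | "Suc i < l" by linarith
    then have "lex_above n ?c (\<lambda>j. lookup \<kappa> (X j))"
    proof cases
      case 1
      then show ?thesis unfolding lex_above_def using l other by (intro bexI[of _ l]) auto
    next
      case 2
      then show ?thesis using l ab c by simp
    next
      case 3
      then have a: "?a = c i" "c (Suc i) < ?b" using l i by auto
      then have "c (Suc i) < ?p" using pq(2) ab c i by simp
      then show ?thesis unfolding lex_above_def using l other i 3 by (intro bexI[of _ i]) auto
    next
      case 4
      then have a: "?a = c i" "?b = c (Suc i)" using l i by auto
      show ?thesis
      proof (cases "?p = ?b")
        case True
        then show ?thesis unfolding lex_above_def using l other i 4 a pq
          by (intro bexI[of _ l]) auto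
      next
        case False
        then have "c (Suc i) < ?p" using pq(2) a c by simp
        then show ?thesis unfolding lex_above_def using l other i 4 by (intro bexI[of _ i]) auto
      qed
    qed
    then show ?thesis ..
  next
    assume "\<mu> = xexponent n c \<and> c (Suc i) < ?p"
    then have "lex_above n ?c (\<lambda>j. lookup \<kappa> (X j))"
      unfolding lex_above_def using other i by (intro bexI[of _ i]) (auto simp: lookup_xexponent)
    then show ?thesis ..
  qed
  ultimately show ?thesis by (simp add: tail_monomials_def)
qed

lemma sum_lookup_yxvars:
  "(\<Sum>v\<in>yxvars n. lookup \<mu> v) =
     (\<Sum>i=1..n. lookup \<mu> (Y i)) + (\<Sum>i=1..n. lookup \<mu> (X i))"
proof -
  have "inj Y" "inj X" by (auto intro: injI)
  then show ?thesis
    unfolding yxvars_def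
    by (subst sum.union_disjoint) (auto simp: sum.reindex inj_on_def)
qed

lemma keys_xexponent: "keys (xexponent n c) \<subseteq> yxvars n"
proof
  fix v assume "v \<in> keys (xexponent n c)"
  then show "v \<in> yxvars n"
      by (cases v) (auto simp: in_keys_iff lookup_xexponent yxvars_def split: if_splits)
qed

lemma has_leading_code_divided_diff:
  assumes i: "1 \<le> i" "i < n" and c: "c i = n - i" "c (Suc i) < c i" "\<forall>i\<in>{1..n}. c i \<le> n - i"
    and f: "has_leading_code n c f"
  shows "has_leading_code n (c(i := c (Suc i), Suc i := c i - 1)) (divided_diff i f)"
    (is "has_leading_code n ?c _")
proof -
  obtain g where g: "f = single (xexponent n c) 1 + g" "keys g \<subseteq> tail_monomials n c"
    using f by (auto simp: has_leading_code_def)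
  have lt: "lookup (xexponent n c) (X (Suc i)) < lookup (xexponent n c) (X i)"
    using c i by (simp add: lookup_xexponent)
  obtain \<kappa> h where h: "divided_diff i (single (xexponent n c) 1) = single \<kappa> 1 + h"
    and \<kappa>: "\<And>v. v \<noteq> X i \<Longrightarrow> v \<noteq> X (Suc i) \<Longrightarrow> lookup \<kappa> v = lookup (xexponent n c) v"
      "lookup \<kappa> (X i) = lookup (xexponent n c) (X (Suc i))"
      "lookup \<kappa> (X (Suc i)) = lookup (xexponent n c) (X i) - 1"
    and keys_h: "\<And>\<rho>. \<rho> \<in> keys h \<Longrightarrow> \<rho> \<in> divided_diff_monomials i (xexponent n c) \<and>
       lookup (xexponent n c) (X (Suc i)) < lookup \<rho> (X i)"
    using divided_diff_single_leading[OF lt, of 1] by blast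
  have "\<kappa> = xexponent n ?c"
  proof (rule poly_mapping_eqI)
    fix v
    show "lookup \<kappa> v = lookup (xexponent n ?c) v"
      using \<kappa>(1)[of v] \<kappa>(2,3) i by (cases v) (auto simp: lookup_xexponent)
  qed
  moreover have "keys h \<subseteq> tail_monomials n ?c"
  proof
    fix \<rho> assume "\<rho> \<in> keys h"
    from keys_h[OF this] show "\<rho> \<in> tail_monomials n ?c"
      using i c by (intro divided_diff_monomials_tail[of i n c "xexponent n c"])
        (auto simp: keys_xexponent lookup_xexponent sum_lookup_yxvars)
  qed
  moreover have "keys (divided_diff i g) \<subseteq> tail_monomials n ?c"
  proof (rule keys_divided_diff[OF g(2)], rule subsetI)
    fix \<mu> \<rho> assume "\<mu> \<in> tail_monomials n c" "\<rho> \<in> divided_diff_monomials i \<mu>"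
    then show "\<rho> \<in> tail_monomials n ?c"
      using i c by (intro divided_diff_monomials_tail[of i n c \<mu>]) (auto simp: tail_monomials_def)
  qed
  ultimately show ?thesis
    unfolding has_leading_code_def g(1) divided_diff_add h
    using keys_add[of h "divided_diff i g"]
        by (intro exI[of _ "h + divided_diff i g"]) (auto simp: add.assoc)
qed

lemma card_eq_sum_rows:
  fixes P :: "(nat \<times> nat) set"
  assumes "finite P" "P \<subseteq> {1..n} \<times> {1..n}"
  shows "card P = (\<Sum>i=1..n. card {j. (i, j) \<in> P})"
proof -
  have eq: "P = Sigma {1..n} (\<lambda>i. {j. (i, j) \<in> P})" using assms(2) by auto
  have "finite {j. (k, j) \<in> P}" for k
    using finite_imageI[OF assms(1), of snd] by (rule rev_finite_subset) force
  then have "card (Sigma {1..n} (\<lambda>i. {j. (i, j) \<in> P})) = (\<Sum>i=1..n. card {j. (i, j) \<in> P})"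
    by simp
  then show ?thesis by (rule trans[OF arg_cong[OF eq, of card]])
qed

text \<open>Choosing the \<open>x\<close>-variable in every factor gives the leading monomial. Every other choice
  picks some \<open>y\<close>-variable and so fewer \<open>x\<close>-variables.\<close>

lemma prod_differences_leading:
  assumes "finite P" "P \<subseteq> {1..n} \<times> {1..n}"
  shows "\<exists>g. (\<Prod>(i, j)\<in>P. pvar (X i) - pvar (Y j)) =
      single (xexponent n (\<lambda>i. card {j. (i, j) \<in> P})) 1 + g \<and>
    (\<forall>\<mu>\<in>keys g. keys \<mu> \<subseteq> yxvars n \<and>
      (\<forall>i\<in>{1..n}. lookup \<mu> (X i) \<le> card {j. (i, j) \<in> P}) \<and>
      (\<Sum>v\<in>yxvars n. lookup \<mu> v) = card P \<and>
      (\<exists>i. lookup \<mu> (Y i) \<noteq> 0))"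
  using assms
proof (induction P)
  case empty
  have "xexponent n (\<lambda>i. card {j. (i, j) \<in> {}}) = 0"
    by (simp add: xexponent_def)
  then show ?case by (intro exI[of _ 0]) simp
next
  case (insert ij P)
  obtain i j where ij: "ij = (i, j)" by (cases ij)
  have i: "i \<in> {1..n}" and j: "j \<in> {1..n}" using insert.prems ij by auto
  define c where "c = (\<lambda>i. card {j. (i, j) \<in> P})"
  define c' where "c' = (\<lambda>k. card {j. (k, j) \<in> insert ij P})"
  let ?M = "{\<mu>. keys \<mu> \<subseteq> yxvars n \<and>
      (\<forall>i\<in>{1..n}. lookup \<mu> (X i) \<le> c i) \<and>
      (\<Sum>v\<in>yxvars n. lookup \<mu> v) = card P}"
  let ?M' = "{\<mu>. keys \<mu> \<subseteq> yxvars n \<and>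
      (\<forall>i\<in>{1..n}. lookup \<mu> (X i) \<le> c' i) \<and>
      (\<Sum>v\<in>yxvars n. lookup \<mu> v) = card (insert ij P) \<and>
      (\<exists>i. lookup \<mu> (Y i) \<noteq> 0)}"
  obtain g where g: "(\<Prod>(i, j)\<in>P. pvar (X i) - pvar (Y j)) = single (xexponent n c) 1 + g"
    and keys_g: "keys g \<subseteq> ?M \<inter> {\<mu>. \<exists>i. lookup \<mu> (Y i) \<noteq> 0}"
    using insert.IH insert.prems unfolding c_def by (auto simp: subset_iff)
  have finP: "finite {j. (k, j) \<in> P}" for k
    using finite_imageI[OF insert.hyps(1), of snd] by (rule rev_finite_subset) force
  have c'_eq: "c' k = c k + (if k = i then 1 else 0)" for k
  proof -
    have "{j. (k, j) \<in> insert ij P} = (if k = i then insert j {j. (k, j) \<in> P} else {j. (k, j) \<in> P})"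
      using ij by auto
    then show ?thesis unfolding c_def c'_def using insert.hyps(2) finP ij by simp
  qed
  have card: "card (insert ij P) = Suc (card P)" using insert.hyps by simp
  have yx: "X i \<in> yxvars n" "Y j \<in> yxvars n" using i j by (auto simp: yxvars_def)
  have fin: "finite (yxvars n)" by (simp add: yxvars_def)
  have lead: "xexponent n c \<in> ?M"
  proof -
    have "card P = (\<Sum>i=1..n. c i)"
      unfolding c_def by (rule card_eq_sum_rows) (use insert.hyps(1) insert.prems in auto)
    then show ?thesis by (auto simp: keys_xexponent[THEN subsetD] lookup_xexponent
        sum_lookup_yxvars)
  qed
  have degree: "(\<Sum>u\<in>yxvars n. lookup (single v 1 + \<mu>) u) = Suc (\<Sum>u\<in>yxvars n. lookup \<mu> u)"
    if "v \<in> yxvars n" for v \<mu>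
    using that fin by (simp add: lookup_add lookup_single sum.distrib when_def)
  have mult_x: "single (X i) 1 + \<mu> \<in> ?M'"
    if "\<mu> \<in> ?M" "\<exists>i. lookup \<mu> (Y i) \<noteq> 0" for \<mu>
    using that i degree[of "X i" \<mu>] keys_add[of "single (X i) 1" \<mu>]
    by (auto simp: yx c'_eq card lookup_add lookup_single when_def)
  have mult_y: "single (Y j) 1 + \<mu> \<in> ?M'" if "\<mu> \<in> ?M" for \<mu>
    using that j degree[of "Y j" \<mu>] keys_add[of "single (Y j) 1" \<mu>]
    by (auto simp: yx c'_eq card lookup_add lookup_single when_def intro: le_SucI
        intro!: exI[of _ j])
  let ?G = "pvar (X i) * g - pvar (Y j) * (single (xexponent n c) 1 + g)"
  have "xexponent n c' = single (X i) 1 + xexponent n c"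
  proof (rule poly_mapping_eqI)
    fix v
    show "lookup (xexponent n c') v = lookup (single (X i) 1 + xexponent n c) v"
      using i by (cases v) (auto simp: lookup_add lookup_single lookup_xexponent c'_eq when_def)
  qed
  then have "(\<Prod>(i, j)\<in>insert ij P. pvar (X i) - pvar (Y j)) = single (xexponent n c') 1 + ?G"
    using insert.hyps ij g by (simp add: pvar_def mult_single algebra_simps)
  moreover have "keys ?G \<subseteq> ?M'"
  proof
    fix \<mu> assume "\<mu> \<in> keys ?G"
    then have "\<mu> \<in> keys (pvar (X i) * g) \<or>
        \<mu> \<in> keys (pvar (Y j) * (single (xexponent n c) 1 + g))"
      by (auto simp: in_keys_iff lookup_minus)
    then show "\<mu> \<in> ?M'"
    proof
      assume "\<mu> \<in> keys (pvar (X i) * g)"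
      then obtain \<mu>' where "\<mu>' \<in> keys g" "\<mu> = single (X i) 1 + \<mu>'"
        using keys_mult[of "pvar (X i)" g] by (auto simp: pvar_def)
      then show ?thesis using mult_x keys_g by blast
    next
      assume "\<mu> \<in> keys (pvar (Y j) * (single (xexponent n c) 1 + g))"
      then obtain \<mu>' where \<mu>': "\<mu>' \<in> keys (single (xexponent n c) (1::complex) + g)"
          "\<mu> = single (Y j) 1 + \<mu>'"
        using keys_mult[of "pvar (Y j)" "single (xexponent n c) 1 + g"] by (auto simp: pvar_def)
      then have "\<mu>' = xexponent n c \<or> \<mu>' \<in> keys g"
        using keys_add[of "single (xexponent n c) (1::complex)" g] by auto
      then have "\<mu>' \<in> ?M" using lead keys_g by blast
      then show ?thesis using mult_y \<mu>' by blast
    qed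
  qed
  ultimately show ?case unfolding c'_def by (intro exI[of _ ?G]) blast
qed

lemma lehmer_le: "lehmer n w i \<le> n - i"
proof -
  have "{j. i < j \<and> j \<le> n \<and> w j < w i} \<subseteq> {i<..n}" by auto
  from card_mono[OF _ this] show ?thesis by (simp add: lehmer_def)
qed

lemma lehmer_longest_perm:
  assumes "i \<in> {1..n}"
  shows "lehmer n (longest_perm n) i = n - i"
proof -
  have "{j. i < j \<and> j \<le> n \<and> longest_perm n j < longest_perm n i} = {i<..n}"
    using assms by (auto simp: longest_perm_def)
  then show ?thesis by (simp add: lehmer_def)
qed

lemma xexponent_cong: "(\<And>i. i \<in> {1..n} \<Longrightarrow> c i = c' i) \<Longrightarrow> xexponent n c = xexponent n c'"
  unfolding xexponent_def by (rule sum.cong) auto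

lemma staircase_product_leading:
  "has_leading_code n (lehmer n (longest_perm n))
     (\<Prod>(i, j)\<in>{(i, j). 1 \<le> i \<and> 1 \<le> j \<and> i + j \<le> n}. pvar (X i) - pvar (Y j))"
proof -
  let ?P = "{(i, j). 1 \<le> i \<and> 1 \<le> j \<and> i + j \<le> n}"
  have sub: "?P \<subseteq> {1..n} \<times> {1..n}" by auto
  then have fin: "finite ?P" by (rule finite_subset) simp
  have row: "card {j. (i, j) \<in> ?P} = n - i" if "i \<in> {1..n}" for i
  proof -
    have "{j. (i, j) \<in> ?P} = {1..n - i}" using that by auto
    then show ?thesis by simp
  qed
  have "card ?P = (\<Sum>i=1..n. card {j. (i, j) \<in> ?P})" by (rule card_eq_sum_rows[OF fin sub])
  then have card: "card ?P = (\<Sum>i=1..n. lehmer n (longest_perm n) i)"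
    using row lehmer_longest_perm by simp
  have "xexponent n (\<lambda>i. card {j. (i, j) \<in> ?P}) = xexponent n (lehmer n (longest_perm n))"
    by (rule xexponent_cong) (simp only: row lehmer_longest_perm)
  then show ?thesis
    using prod_differences_leading[OF fin sub] row card
    unfolding has_leading_code_def tail_monomials_def by (auto simp: subset_iff)
qed

text \<open>At the last ascent \<open>i\<close> of \<open>w\<close>, the entries after position \<open>i + 1\<close> decrease and lie below
  \<open>w (i + 1)\<close>. Hence the code of \<open>w s\<^sub>i\<close> takes the value \<open>n - i\<close> at \<open>i\<close>, as the induction step
  requires.\<close>

theorem double_schubert_leading:
  assumes "w permutes {1..n}"
  shows "has_leading_code n (lehmer n w) (double_schubert n w)"
proof -
  have "\<exists>f. is_double_schubert n w f \<and> has_leading_code n (lehmer n w) f"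
    using assms
  proof (induction "n * n - perm_length n w" arbitrary: w rule: less_induct)
    case less
    show ?case
    proof (cases "w = longest_perm n")
      case True
      then show ?thesis using is_double_schubert.longest staircase_product_leading by blast
    next
      case False
      then obtain i where i: "1 \<le> i" "i < n" "w i < w (Suc i)"
        and last: "\<And>j. i < j \<Longrightarrow> j < n \<Longrightarrow> w (Suc j) < w j"
        by (rule last_ascent[OF less.prems]) blast
      let ?u = "w \<circ> simple_refl i"
      have "n * n - perm_length n ?u < n * n - perm_length n w"
        using perm_length_swap[OF i(3,1,2)] perm_length_le[of n ?u] by simp
      with less.hyps permutes_swap[OF less.prems i(1,2)]
      obtain g where g: "is_double_schubert n ?u g" "has_leading_code n (lehmer n ?u) g"
        by blast
      have dec: "w j < w (Suc i)" if "Suc i < j" "j \<le> n" for j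
        using that
      proof (induction j)
        case (Suc j)
        then show ?case using last[of j] i(2) by (cases "j = Suc i") auto
      qed simp
      have "{j. Suc i < j \<and> j \<le> n \<and> w j < w (Suc i)} = {Suc i<..n}" using dec by auto
      then have "lehmer n w (Suc i) = n - Suc i" by (simp add: lehmer_def)
      then have ci: "lehmer n ?u i = n - i" using lehmer_swap_left[OF i(3,2)] i(2) by simp
      have csi: "lehmer n ?u (Suc i) < lehmer n ?u i"
      proof -
        have "{j. i < j \<and> j \<le> n \<and> w j < w i} \<subseteq> {j. Suc i < j \<and> j \<le> n \<and> w j < w (Suc i)}"
          using i(3) by (auto simp: Suc_lessI) (metis Suc_lessI order_less_asym)
        from card_mono[OF _ this] show ?thesis
          unfolding lehmer_swap_left[OF i(3,2)] lehmer_swap_right[OF i(3)]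
          by (simp add: lehmer_def less_Suc_eq_le)
      qed
      have "(lehmer n ?u)(i := lehmer n ?u (Suc i), Suc i := lehmer n ?u i - 1) = lehmer n w"
        using lehmer_swap_left[OF i(3,2)] lehmer_swap_right[OF i(3)] lehmer_swap_other[of _ i n w]
            i(2)
        by (auto simp: fun_eq_iff)
      then have "has_leading_code n (lehmer n w) (divided_diff i g)"
        using has_leading_code_divided_diff[OF i(1,2) ci csi _ g(2)] lehmer_le by simp
      then show ?thesis using is_double_schubert_step[OF less.prems i g(1)] by blast
    qed
  qed
  then show ?thesis using double_schubert_eqI by blast
qed

section \<open>Permutations with a given Lehmer code\<close>

text \<open>Read from left to right, the code tells which of the values not yet used comes next.\<close>

lemma lehmer_as_remaining_values:
  assumes w: "w permutes {1..n}" and k: "k \<in> {1..n}"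
  shows "lehmer n w k = card {v \<in> {1..n} - w ` {1..<k}. v < w k}"
proof -
  have inj: "inj w" by (rule permutes_inj[OF w])
  have eq: "w ` {j. k < j \<and> j \<le> n \<and> w j < w k} = {v \<in> {1..n} - w ` {1..<k}. v < w k}" (is "?L = ?R")
  proof
    show "?L \<subseteq> ?R"
    proof
      fix v assume "v \<in> ?L"
      then obtain j where j: "v = w j" "k < j" "j \<le> n" "w j < w k" by auto
      then have "j \<in> {1..n}" by simp
      then have "w j \<in> {1..n}" by (simp only: permutes_in_image[OF w])
      moreover have "w j \<notin> w ` {1..<k}" using j(2) inj by (auto simp: inj_eq)
      ultimately show "v \<in> ?R" using j by simp
    qed
    show "?R \<subseteq> ?L"
    proof
      fix v assume v: "v \<in> ?R"
      then have "v \<in> w ` {1..n}" using permutes_image[OF w] by blast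
      then obtain j where j: "j \<in> {1..n}" "v = w j" by blast
      with v have "j \<notin> {1..<k}" "j \<noteq> k" by auto
      then show "v \<in> ?L" using j v by auto
    qed
  qed
  have "card (w ` {j. k < j \<and> j \<le> n \<and> w j < w k}) = card {j. k < j \<and> j \<le> n \<and> w j < w k}"
    by (rule card_image[OF inj_on_subset[OF inj subset_UNIV]])
  then show ?thesis unfolding lehmer_def eq by (rule sym)
qed

lemma lehmer_inj:
  assumes w: "w permutes {1..n}" and w': "w' permutes {1..n}"
    and eq: "\<And>k. k \<in> {1..n} \<Longrightarrow> lehmer n w k = lehmer n w' k"
  shows "w = w'"
proof
  have aux: "\<not> v k < v' k"
    if "v permutes {1..n}" "v' permutes {1..n}" "k \<in> {1..n}" "lehmer n v k = lehmer n v' k"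
      "\<And>j. j < k \<Longrightarrow> v j = v' j" for v v' k
  proof
    assume lt: "v k < v' k"
    have im: "v ` {1..<k} = v' ` {1..<k}" using that(5) by auto
    let ?S = "\<lambda>u. {x \<in> {1..n} - v' ` {1..<k}. x < u}"
    have "v k \<in> {1..n}" using that(3) by (simp only: permutes_in_image[OF that(1)])
    moreover have "v k \<notin> v ` {1..<k}" using permutes_inj[OF that(1)] by (auto simp: inj_eq)
    ultimately have "v k \<in> ?S (v' k) - ?S (v k)" using lt im by auto
    moreover have "?S (v k) \<subseteq> ?S (v' k)" using lt by auto
    ultimately have "?S (v k) \<subset> ?S (v' k)" by blast
    then have "card (?S (v k)) < card (?S (v' k))" by (intro psubset_card_mono) auto
    then show False
      using that(4) lehmer_as_remaining_values[OF that(1,3)]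
          lehmer_as_remaining_values[OF that(2,3)] im
      by simp
  qed
  fix k
  show "w k = w' k"
  proof (induction k rule: less_induct)
    case (less k)
    show ?case
    proof (cases "k \<in> {1..n}")
      case True
      then show ?thesis using aux[OF w w' True] aux[OF w' w True] eq less by force
    next
      case False
      then show ?thesis using w w' by (auto simp: permutes_def)
    qed
  qed
qed

text \<open>Codes determine permutations, and there are \<open>n!\<close> permutations and \<open>n!\<close> admissible codes.\<close>

lemma lehmer_code_ex1:
  assumes "\<And>k. k \<in> {1..n} \<Longrightarrow> c k \<le> n - k"
  shows "\<exists>!w. w permutes {1..n} \<and> (\<forall>k\<in>{1..n}. lehmer n w k = c k)"
proof -
  let ?P = "{w. w permutes {1..n}}" and ?C = "PiE {1..n} (\<lambda>k. {0..n - k})"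
  let ?f = "\<lambda>w. restrict (lehmer n w) {1..n}"
  have inj: "inj_on ?f ?P"
  proof (rule inj_onI)
    fix w w' assume "w \<in> ?P" "w' \<in> ?P" "?f w = ?f w'"
    then show "w = w'" by (intro lehmer_inj[of w n w'])
        (auto simp: restrict_def fun_eq_iff split: if_splits)
  qed
  have "card ?C = (\<Prod>k=1..n. Suc (n - k))" by (simp add: card_PiE)
  also have "\<dots> = fact n"
    unfolding fact_prod by (simp,
        rule prod.reindex_bij_witness[of _ "\<lambda>k. Suc n - k" "\<lambda>k. Suc n - k"]) auto
  finally have "card ?C = card ?P" using card_permutations[of "{1..n}" n] by simp
  moreover have "?f ` ?P \<subseteq> ?C" using lehmer_le by fastforce
  ultimately have "?f ` ?P = ?C"
    using inj by (intro card_subset_eq) (simp_all add: card_image finite_PiE)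
  moreover have "restrict c {1..n} \<in> ?C" using assms by auto
  ultimately have "restrict c {1..n} \<in> ?f ` ?P" by simp
  then obtain w where "w permutes {1..n}" "?f w = restrict c {1..n}"
      by (metis (mono_tags, lifting) imageE mem_Collect_eq)
  then have w: "w permutes {1..n} \<and> (\<forall>k\<in>{1..n}. lehmer n w k = c k)"
    by (metis restrict_apply')
  then show ?thesis
  proof (rule ex1I[of _ w])
    fix v assume "v permutes {1..n} \<and> (\<forall>k\<in>{1..n}. lehmer n v k = c k)"
    with w show "v = w" by (intro lehmer_inj[of v n w]) simp_all
  qed
qed

section \<open>Linear combinations of functions on \<open>Z\<^sub>\<alpha>\<close>\<close>

text \<open>The functions of \<open>h\<close> that may serve as coefficients, without the restriction to \<open>\<ss>\<close> that
  elements of the ring carry.\<close>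

definition scalar :: "nat list \<Rightarrow> ((nat \<Rightarrow> complex) \<Rightarrow> complex) \<Rightarrow> bool" where
  "scalar \<alpha> c \<longleftrightarrow> (\<lambda>h\<in>levi_center \<alpha>. c h) \<in> carrier (sym_s \<alpha>)"

lemma scalar_const: "scalar \<alpha> (\<lambda>h. c)"
  unfolding scalar_def sym_s_def by (rule coord_ring_const_closed)

lemma scalar_add: "scalar \<alpha> c \<Longrightarrow> scalar \<alpha> d \<Longrightarrow> scalar \<alpha> (\<lambda>h. c h + d h)"
  unfolding scalar_def sym_s_def by (drule (1) coord_ring_add_closed) (simp cong: restrict_cong)

lemma scalar_mult: "scalar \<alpha> c \<Longrightarrow> scalar \<alpha> d \<Longrightarrow> scalar \<alpha> (\<lambda>h. c h * d h)"
  unfolding scalar_def sym_s_def by (drule (1) coord_ring_mult_closed) (simp cong: restrict_cong)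

lemma scalar_sum: "(\<And>i. i \<in> A \<Longrightarrow> scalar \<alpha> (c i)) \<Longrightarrow> scalar \<alpha> (\<lambda>h. \<Sum>i\<in>A. c i h)"
  unfolding scalar_def sym_s_def by (rule coord_ring_sum_closed)

lemma scalar_prod: "(\<And>i. i \<in> A \<Longrightarrow> scalar \<alpha> (c i)) \<Longrightarrow> scalar \<alpha> (\<lambda>h. \<Prod>i\<in>A. c i h)"
  unfolding scalar_def sym_s_def by (rule coord_ring_prod_closed)

lemma scalar_power: "scalar \<alpha> c \<Longrightarrow> scalar \<alpha> (\<lambda>h. c h ^ k)"
  by (induction k) (simp_all add: scalar_const scalar_mult)

lemma scalar_coord: "i \<in> {1..sum_list \<alpha>} \<Longrightarrow> scalar \<alpha> (\<lambda>h. h i)"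
  using poly_fun_closed[of "pvar i" "{1..sum_list \<alpha>}" "\<lambda>h. h" "levi_center \<alpha>"]
  unfolding scalar_def sym_s_def
      by (simp add: poly_fun_def peval_pvar) (simp add: pvars_def pvar_def)

type_synonym zpoint = "(nat \<Rightarrow> complex) \<times> (nat \<Rightarrow> complex)"

text \<open>The \<open>S(\<ss>\<^sup>*)\<close>-linear span of \<open>G\<close>. Equality of functions is required on \<open>Z\<^sub>\<alpha>\<close> only, so
  that \<open>f\<close> and \<open>G\<close> may be given by formulas on all pairs of vectors.\<close>

inductive spanned :: "nat list \<Rightarrow> (zpoint \<Rightarrow> complex) set \<Rightarrow> (zpoint \<Rightarrow> complex) \<Rightarrow> bool"
  for \<alpha> G where
  zero: "(\<And>q. q \<in> Zvar \<alpha> \<Longrightarrow> f q = 0) \<Longrightarrow> spanned \<alpha> G f"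
| step: "\<lbrakk>spanned \<alpha> G f; g \<in> G; scalar \<alpha> c; \<And>q. q \<in> Zvar \<alpha> \<Longrightarrow> f' q = f q + c (fst q) * g q\<rbrakk>
    \<Longrightarrow> spanned \<alpha> G f'"

lemma spanned_cong:
  assumes "spanned \<alpha> G f" "\<And>q. q \<in> Zvar \<alpha> \<Longrightarrow> f' q = f q"
  shows "spanned \<alpha> G f'"
  by (rule spanned.cases[OF assms(1)]) (use assms(2) in \<open>auto intro: spanned.intros\<close>)

lemma spanned_add:
  assumes "spanned \<alpha> G f" "spanned \<alpha> G g"
  shows "spanned \<alpha> G (\<lambda>q. f q + g q)"
  using assms(2)
proof induction
  case (zero g)
  then show ?case using spanned_cong[OF assms(1)] by simp
next
  case (step g e c g')
  then show ?case by (intro spanned.step[OF step.IH step.hyps(2,3)]) simp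
qed

lemma spanned_scalar:
  assumes "spanned \<alpha> G f" "scalar \<alpha> d"
  shows "spanned \<alpha> G (\<lambda>q. d (fst q) * f q)"
  using assms(1)
proof induction
  case (zero f)
  then show ?case by (intro spanned.zero) simp
next
  case (step f g c f')
  then show ?case
    by (intro spanned.step[OF step.IH step.hyps(2) scalar_mult[OF assms(2) step.hyps(3)]])
      (simp add: algebra_simps)
qed

lemma spanned_uminus: "spanned \<alpha> G f \<Longrightarrow> spanned \<alpha> G (\<lambda>q. - f q)"
  using spanned_scalar[OF _ scalar_const, of \<alpha> G f "- 1"] by simp

lemma spanned_diff: "spanned \<alpha> G f \<Longrightarrow> spanned \<alpha> G g \<Longrightarrow> spanned \<alpha> G (\<lambda>q. f q - g q)"
  using spanned_add[OF _ spanned_uminus, of \<alpha> G f g] by simp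

lemma spanned_base: "g \<in> G \<Longrightarrow> spanned \<alpha> G g"
  using spanned.step[OF spanned.zero[of \<alpha> "\<lambda>_. 0" G] _ scalar_const, of g "\<lambda>q. g q" 1] by simp

lemma spanned_sum:
  "(\<And>i. i \<in> A \<Longrightarrow> spanned \<alpha> G (f i)) \<Longrightarrow> spanned \<alpha> G (\<lambda>q. \<Sum>i\<in>A. f i q)"
  by (induction A rule: infinite_finite_induct) (auto intro: spanned.zero spanned_add)

lemma spanned_mult:
  assumes "spanned \<alpha> G f" "\<And>g. g \<in> G \<Longrightarrow> spanned \<alpha> G' (\<lambda>q. e q * g q)"
  shows "spanned \<alpha> G' (\<lambda>q. e q * f q)"
  using assms(1)
proof induction
  case (zero f)
  then show ?case by (intro spanned.zero) simp
next
  case (step f g c f')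
  have "spanned \<alpha> G' (\<lambda>q. e q * f q + c (fst q) * (e q * g q))"
    by (intro spanned_add spanned_scalar step assms(2))
  then show ?case by (rule spanned_cong) (simp add: step algebra_simps)
qed

lemma spanned_trans:
  "spanned \<alpha> G f \<Longrightarrow> (\<And>g. g \<in> G \<Longrightarrow> spanned \<alpha> G' g) \<Longrightarrow> spanned \<alpha> G' f"
  using spanned_mult[of \<alpha> G f G' "\<lambda>_. 1"] by simp

lemma spanned_subset: "spanned \<alpha> G f \<Longrightarrow> G \<subseteq> G' \<Longrightarrow> spanned \<alpha> G' f"
  by (erule spanned_trans) (auto intro: spanned_base)

section \<open>The points of \<open>Z\<^sub>\<alpha>\<close>\<close>

text \<open>The coordinate of \<open>h \<in> \<ss>\<close> at the last index of block \<open>r\<close> serves as \<open>z\<^sub>r\<close>.\<close>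

definition block_end :: "nat list \<Rightarrow> nat \<Rightarrow> nat" where
  "block_end \<alpha> r = sum_list (take r \<alpha>)"

lemma block_end_Suc: "r < length \<alpha> \<Longrightarrow> block_end \<alpha> (Suc r) = block_end \<alpha> r + \<alpha> ! r"
  by (simp add: block_end_def take_Suc_conv_app_nth)

lemma block_end_mono: "r \<le> s \<Longrightarrow> block_end \<alpha> r \<le> block_end \<alpha> s"
proof (induction s)
  case (Suc s)
  show ?case
  proof (cases "r = Suc s")
    case False
    then have "block_end \<alpha> r \<le> block_end \<alpha> s" using Suc by simp
    also have "\<dots> \<le> block_end \<alpha> (Suc s)"
      by (cases "s < length \<alpha>") (simp_all add: block_end_Suc, simp add: block_end_def)
    finally show ?thesis .
  qed simp
qed simp

lemma block_end_0: "block_end \<alpha> 0 = 0"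
  and block_end_length: "block_end \<alpha> (length \<alpha>) = sum_list \<alpha>"
  by (simp_all add: block_end_def)

lemma block_eq: "block \<alpha> r = {block_end \<alpha> (r - 1)<..block_end \<alpha> r}"
  by (simp add: block_def block_end_def)

lemma card_block: "r \<in> {1..length \<alpha>} \<Longrightarrow> card (block \<alpha> r) = \<alpha> ! (r - 1)"
  using block_end_Suc[of "r - 1" \<alpha>] by (cases r) (simp_all add: block_eq)

lemma block_subset: "r \<in> {1..length \<alpha>} \<Longrightarrow> block \<alpha> r \<subseteq> {1..sum_list \<alpha>}"
  using block_end_mono[of r "length \<alpha>" \<alpha>] by (auto simp: block_eq block_end_length)

lemma block_disjoint:
  assumes "p \<in> block \<alpha> r" "p \<in> block \<alpha> s" "1 \<le> r" "1 \<le> s"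
  shows "r = s"
proof -
  have "False" if "p \<in> block \<alpha> r" "p \<in> block \<alpha> s" "r < s" for r s
  proof -
    have "r \<le> s - 1" using that(3) by simp
    then show ?thesis using that block_end_mono[of r "s - 1" \<alpha>] by (simp add: block_eq)
  qed
  then show ?thesis using assms(1,2) by (cases r s rule: linorder_cases) auto
qed

lemma block_ex:
  assumes "p \<in> {1..sum_list \<alpha>}"
  shows "\<exists>r\<in>{1..length \<alpha>}. p \<in> block \<alpha> r"
proof -
  let ?r = "LEAST r. p \<le> block_end \<alpha> r"
  have le: "p \<le> block_end \<alpha> (length \<alpha>)" using assms by (simp add: block_end_length)
  then have 1: "p \<le> block_end \<alpha> ?r" by (rule LeastI)
  have 2: "?r \<le> length \<alpha>" using le by (rule Least_le)
  have 3: "?r \<noteq> 0" using 1 assms by (auto simp: block_end_0 intro: ccontr)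
  then have "\<not> p \<le> block_end \<alpha> (?r - 1)" by (intro not_less_Least) simp
  then show ?thesis using 1 2 3 by (intro bexI[of _ ?r]) (auto simp: block_eq)
qed

definition block_of :: "nat list \<Rightarrow> nat \<Rightarrow> nat" where
  "block_of \<alpha> p = (THE r. r \<in> {1..length \<alpha>} \<and> p \<in> block \<alpha> r)"

lemma block_of:
  assumes "p \<in> {1..sum_list \<alpha>}"
  shows "block_of \<alpha> p \<in> {1..length \<alpha>}" "p \<in> block \<alpha> (block_of \<alpha> p)"
proof -
  have "\<exists>!r. r \<in> {1..length \<alpha>} \<and> p \<in> block \<alpha> r"
    using block_ex[OF assms] block_disjoint by (metis atLeastAtMost_iff)
  from theI'[OF this] show "block_of \<alpha> p \<in> {1..length \<alpha>}" "p \<in> block \<alpha> (block_of \<alpha> p)"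
    unfolding block_of_def by blast+
qed

lemma block_of_eqI:
  assumes "r \<in> {1..length \<alpha>}" "p \<in> block \<alpha> r"
  shows "block_of \<alpha> p = r"
proof -
  have "p \<in> {1..sum_list \<alpha>}" using block_subset assms by blast
  from block_of[OF this] show ?thesis using block_disjoint assms by (metis atLeastAtMost_iff)
qed

lemma block_end_in_block:
  assumes "\<forall>a\<in>set \<alpha>. 0 < a" "r \<in> {1..length \<alpha>}"
  shows "block_end \<alpha> r \<in> block \<alpha> r"
proof -
  have r: "r - 1 < length \<alpha>" "Suc (r - 1) = r" using assms(2) by auto
  then have "0 < \<alpha> ! (r - 1)" using assms(1) nth_mem by blast
  then show ?thesis using block_end_Suc[OF r(1)] r(2) by (simp add: block_eq)
qed

text \<open>A point of \<open>Z\<^sub>\<alpha>\<close> distributes the values \<open>z\<^sub>1, \<dots>, z\<^sub>k\<close> over the \<open>n\<close> positions, \<open>z\<^sub>j\<close>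
  being used \<open>\<alpha>\<^sub>j\<close> times. The colouring \<open>\<rho>\<close> records which value goes where, also when some of
  the values coincide.\<close>

lemma Zvar_colouring:
  assumes pos: "\<forall>a\<in>set \<alpha>. 0 < a" and q: "q \<in> Zvar \<alpha>"
  obtains \<rho> where "\<And>i. i \<in> {1..sum_list \<alpha>} \<Longrightarrow> \<rho> i \<in> {1..length \<alpha>}"
    "\<And>i. i \<in> {1..sum_list \<alpha>} \<Longrightarrow> snd q i = fst q (block_end \<alpha> (\<rho> i))"
    "\<And>j. j \<in> {1..length \<alpha>} \<Longrightarrow> card {i \<in> {1..sum_list \<alpha>}. \<rho> i = j} = \<alpha> ! (j - 1)"
proof -
  let ?n = "sum_list \<alpha>"
  obtain h w where hw: "q = (h, perm_act w h)" "h \<in> levi_center \<alpha>" "w permutes {1..?n}"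
    using q by (auto simp: Zvar_def)
  define w' where "w' = inv_into UNIV w"
  have w': "w' permutes {1..?n}" unfolding w'_def by (rule permutes_inv[OF hw(3)])
  have ran: "w' i \<in> {1..?n}" if "i \<in> {1..?n}" for i using that
      by (simp only: permutes_in_image[OF w'])
  obtain z where z: "\<forall>r\<in>{1..length \<alpha>}. \<forall>i\<in>block \<alpha> r. h i = z r"
    using hw(2) by (auto simp: levi_center_def)
  show thesis
  proof (rule that[of "\<lambda>i. block_of \<alpha> (w' i)"])
    fix i assume i: "i \<in> {1..?n}"
    show r: "block_of \<alpha> (w' i) \<in> {1..length \<alpha>}" using block_of ran[OF i] by blast
    show "snd q i = fst q (block_end \<alpha> (block_of \<alpha> (w' i)))"
      using z r block_of(2)[OF ran[OF i]] block_end_in_block[OF pos r]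
      by (simp add: hw(1) perm_act_def w'_def[symmetric])
  next
    fix j assume j: "j \<in> {1..length \<alpha>}"
    have "w' ` {i \<in> {1..?n}. block_of \<alpha> (w' i) = j} = block \<alpha> j" (is "_ ` ?A = _")
    proof
      show "w' ` ?A \<subseteq> block \<alpha> j" using block_of(2) ran by blast
      show "block \<alpha> j \<subseteq> w' ` ?A"
      proof
        fix p assume p: "p \<in> block \<alpha> j"
        then have "p \<in> {1..?n}" using block_subset[OF j] by blast
        then have "p \<in> w' ` {1..?n}" using permutes_image[OF w'] by blast
        then show "p \<in> w' ` ?A" using block_of_eqI[OF j p] by blast
      qed
    qed
    then show "card ?A = \<alpha> ! (j - 1)"
      using card_image[OF inj_on_subset[OF permutes_inj[OF w'] subset_UNIV], of ?A] card_block[OF j]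
      by simp
  qed
qed

section \<open>Relations among complete homogeneous symmetric polynomials\<close>

text \<open>The complete homogeneous symmetric polynomial of degree \<open>r\<close> in the variables \<open>t i\<close> with
  \<open>i \<in> V\<close>.\<close>

definition hsym :: "nat set \<Rightarrow> nat \<Rightarrow> (nat \<Rightarrow> complex) \<Rightarrow> complex" where
  "hsym V r t = fps_nth (\<Prod>i\<in>V. Abs_fps (\<lambda>p. t i ^ p)) r"

lemma hsym_empty: "hsym {} r t = (if r = 0 then 1 else 0)"
  by (simp add: hsym_def)

lemma hsym_insert:
  "finite V \<Longrightarrow> i \<notin> V \<Longrightarrow> hsym (insert i V) r t = (\<Sum>p=0..r. t i ^ p * hsym V (r - p) t)"
  by (simp add: hsym_def fps_mult_nth)

lemma geometric_fps: "(1 - fps_const c * fps_X) * Abs_fps (\<lambda>p. c ^ p) = (1 :: complex fps)"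
proof (rule fps_ext)
  fix r
  have "(1 - fps_const c * fps_X) * Abs_fps (\<lambda>p. c ^ p) =
      Abs_fps (\<lambda>p. c ^ p) - fps_const c * (fps_X * Abs_fps (\<lambda>p. c ^ p))"
    by (simp add: algebra_simps)
  then show "fps_nth ((1 - fps_const c * fps_X) * Abs_fps (\<lambda>p. c ^ p)) r = fps_nth 1 r"
    by (cases r) simp_all
qed

definition fps_deg_le :: "complex fps \<Rightarrow> nat \<Rightarrow> bool" where
  "fps_deg_le f d \<longleftrightarrow> (\<forall>r>d. fps_nth f r = 0)"

lemma fps_deg_le_mult:
  assumes "fps_deg_le f d" "fps_deg_le g e"
  shows "fps_deg_le (f * g) (d + e)"
  unfolding fps_deg_le_def
proof (intro allI impI)
  fix r assume r: "d + e < r"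
  have "fps_nth f p * fps_nth g (r - p) = 0" if "p \<le> r" for p
  proof (cases "d < p")
    case False
    then have "e < r - p" using r by simp
    then show ?thesis using assms(2) by (simp add: fps_deg_le_def)
  qed (use assms(1) in \<open>simp add: fps_deg_le_def\<close>)
  then show "fps_nth (f * g) r = 0" unfolding fps_mult_nth by (intro sum.neutral) simp
qed

lemma fps_deg_le_power: "fps_deg_le f d \<Longrightarrow> fps_deg_le (f ^ e) (e * d)"
  by (induction e) (auto simp: fps_deg_le_def[of 1] intro: fps_deg_le_mult)

lemma fps_deg_le_prod:
  "(\<And>i. i \<in> A \<Longrightarrow> fps_deg_le (f i) (d i)) \<Longrightarrow> fps_deg_le (\<Prod>i\<in>A. f i) (\<Sum>i\<in>A. d i)"
  by (induction A rule: infinite_finite_induct)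
    (auto simp: fps_deg_le_def[of 1] intro: fps_deg_le_mult)

lemma fps_deg_le_linear: "fps_deg_le (1 - fps_const c * fps_X) 1"
  by (auto simp: fps_deg_le_def)

definition scalar_fps :: "nat list \<Rightarrow> ((nat \<Rightarrow> complex) \<Rightarrow> complex fps) \<Rightarrow> bool" where
  "scalar_fps \<alpha> F \<longleftrightarrow> (\<forall>s. scalar \<alpha> (\<lambda>h. fps_nth (F h) s))"

lemma scalar_fps_1: "scalar_fps \<alpha> (\<lambda>h. 1)"
  by (simp add: scalar_fps_def scalar_const)

lemma scalar_fps_mult: "scalar_fps \<alpha> F \<Longrightarrow> scalar_fps \<alpha> G \<Longrightarrow> scalar_fps \<alpha> (\<lambda>h. F h * G h)"
  by (simp add: scalar_fps_def fps_mult_nth scalar_sum scalar_mult)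

lemma scalar_fps_power: "scalar_fps \<alpha> F \<Longrightarrow> scalar_fps \<alpha> (\<lambda>h. F h ^ e)"
  by (induction e) (simp_all add: scalar_fps_1 scalar_fps_mult)

lemma scalar_fps_prod: "(\<And>i. i \<in> A \<Longrightarrow> scalar_fps \<alpha> (F i)) \<Longrightarrow> scalar_fps \<alpha> (\<lambda>h. \<Prod>i\<in>A. F i h)"
  by (induction A rule: infinite_finite_induct) (simp_all add: scalar_fps_1 scalar_fps_mult)

lemma scalar_fps_linear:
  assumes "i \<in> {1..sum_list \<alpha>}"
  shows "scalar_fps \<alpha> (\<lambda>h. 1 - fps_const (h i) * fps_X)"
  unfolding scalar_fps_def
proof
  fix s :: nat
  consider "s = 0" | "s = 1" | "1 < s" by linarith
  then show "scalar \<alpha> (\<lambda>h. fps_nth (1 - fps_const (h i) * fps_X) s)"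
  proof cases
    case 2
    then show ?thesis using scalar_mult[OF scalar_const scalar_coord[OF assms], of "- 1"] by simp
  qed (simp_all add: scalar_const)
qed

text \<open>The factors \<open>1 - z\<^sub>j u\<close> cancel the geometric series of the coordinates coloured \<open>j\<close>:
  there are at most \<open>min(\<alpha>\<^sub>j, |V|)\<close> of these. What is left is a polynomial in \<open>u\<close> of degree at
  most \<open>\<Sum>\<^sub>j min(\<alpha>\<^sub>j, |V|) - |V|\<close>, and \<open>r\<close> exceeds this degree.\<close>

lemma hsym_relation:
  assumes pos: "\<forall>a\<in>set \<alpha>. 0 < a" and q: "q \<in> Zvar \<alpha>" and V: "V \<subseteq> {1..sum_list \<alpha>}"
    and r: "(\<Sum>j=1..length \<alpha>. min (\<alpha> ! (j - 1)) (card V)) < r + card V"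
  shows "(\<Sum>s=0..r. fps_nth (\<Prod>j=1..length \<alpha>.
      (1 - fps_const (fst q (block_end \<alpha> j)) * fps_X) ^ min (\<alpha> ! (j - 1)) (card V)) s *
      hsym V (r - s) (snd q)) = 0"
proof -
  obtain \<rho> where \<rho>: "\<And>i. i \<in> {1..sum_list \<alpha>} \<Longrightarrow> \<rho> i \<in> {1..length \<alpha>}"
    "\<And>i. i \<in> {1..sum_list \<alpha>} \<Longrightarrow> snd q i = fst q (block_end \<alpha> (\<rho> i))"
    "\<And>j. j \<in> {1..length \<alpha>} \<Longrightarrow> card {i \<in> {1..sum_list \<alpha>}. \<rho> i = j} = \<alpha> ! (j - 1)"
    using Zvar_colouring[OF pos q] by blast
  have fin: "finite V" using V finite_subset by blast
  define z where "z j = fst q (block_end \<alpha> j)" for j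
  define L where "L j = 1 - fps_const (z j) * fps_X" for j
  define G where "G j = Abs_fps (\<lambda>p. z j ^ p)" for j
  define e where "e j = min (\<alpha> ! (j - 1)) (card V)" for j
  define c where "c j = card {i \<in> V. \<rho> i = j}" for j
  have LG: "L j * G j = 1" for j by (simp add: L_def G_def geometric_fps)
  have ce: "c j \<le> e j" if "j \<in> {1..length \<alpha>}" for j
  proof -
    have "c j \<le> card {i \<in> {1..sum_list \<alpha>}. \<rho> i = j}" unfolding c_def using V
        by (intro card_mono) auto
    moreover have "c j \<le> card V" unfolding c_def using fin by (intro card_mono) auto
    ultimately show ?thesis using \<rho>(3)[OF that] by (simp add: e_def)
  qed
  have \<rho>V: "\<rho> ` V \<subseteq> {1..length \<alpha>}" using \<rho>(1) V by blast
  have "(\<Prod>i\<in>V. Abs_fps (\<lambda>p. snd q i ^ p)) = (\<Prod>i\<in>V. G (\<rho> i))"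
    by (rule prod.cong) (use \<rho>(2) V in \<open>auto simp: G_def z_def subset_iff\<close>)
  also have "\<dots> = (\<Prod>j=1..length \<alpha>. \<Prod>i\<in>{i \<in> V. \<rho> i = j}. G (\<rho> i))"
    by (rule prod.group[symmetric]) (use fin \<rho>V in auto)
  also have "\<dots> = (\<Prod>j=1..length \<alpha>. G j ^ c j)"
    by (rule prod.cong) (simp_all add: c_def)
  finally have "(\<Prod>j=1..length \<alpha>. L j ^ e j) * (\<Prod>i\<in>V. Abs_fps (\<lambda>p. snd q i ^ p)) =
      (\<Prod>j=1..length \<alpha>. L j ^ e j * G j ^ c j)"
    by (simp add: prod.distrib)
  also have "\<dots> = (\<Prod>j=1..length \<alpha>. L j ^ (e j - c j))"
  proof (rule prod.cong)
    fix j assume "j \<in> {1..length \<alpha>}"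
    then have "L j ^ e j = L j ^ (e j - c j) * L j ^ c j"
      using ce by (simp add: power_add[symmetric])
    then show "L j ^ e j * G j ^ c j = L j ^ (e j - c j)"
      using LG by (simp add: mult.assoc power_mult_distrib[symmetric])
  qed simp
  finally have eq: "(\<Prod>j=1..length \<alpha>. L j ^ e j) * (\<Prod>i\<in>V. Abs_fps (\<lambda>p. snd q i ^ p)) =
      (\<Prod>j=1..length \<alpha>. L j ^ (e j - c j))" .
  have "fps_deg_le (L j ^ m) m" for j m
    using fps_deg_le_power[OF fps_deg_le_linear[of "z j"], of m] by (simp add: L_def)
  then have deg: "fps_deg_le (\<Prod>j=1..length \<alpha>. L j ^ (e j - c j)) (\<Sum>j=1..length \<alpha>. e j - c j)"
    by (intro fps_deg_le_prod) blast
  have "card V = (\<Sum>j=1..length \<alpha>. c j)"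
    using sum.group[OF fin _ \<rho>V, of "\<lambda>_. 1::nat"] by (simp add: c_def)
  moreover have "(\<Sum>j=1..length \<alpha>. e j - c j) + (\<Sum>j=1..length \<alpha>. c j) = (\<Sum>j=1..length \<alpha>. e j)"
    unfolding sum.distrib[symmetric] by (rule sum.cong) (use ce in auto)
  ultimately have "(\<Sum>j=1..length \<alpha>. e j - c j) < r"
    using r by (simp add: e_def)
  then have "fps_nth ((\<Prod>j=1..length \<alpha>. L j ^ e j) * (\<Prod>i\<in>V. Abs_fps (\<lambda>p. snd q i ^ p))) r = 0"
    unfolding eq using deg by (simp add: fps_deg_le_def)
  then show ?thesis
    unfolding fps_mult_nth hsym_def L_def z_def e_def .
qed

section \<open>Straightening of monomials\<close>

definition xmonomial :: "nat \<Rightarrow> (nat \<Rightarrow> nat) \<Rightarrow> zpoint \<Rightarrow> complex" where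
  "xmonomial n m q = (\<Prod>i=1..n. snd q i ^ m i)"

definition xdegree :: "nat \<Rightarrow> (nat \<Rightarrow> nat) \<Rightarrow> nat" where
  "xdegree n m = (\<Sum>i=1..n. m i)"

lemma xmonomial_add: "xmonomial n (\<lambda>i. m i + m' i) q = xmonomial n m q * xmonomial n m' q"
  by (simp add: xmonomial_def power_add prod.distrib)

lemma xmonomial_single: "i \<in> {1..n} \<Longrightarrow> xmonomial n (\<lambda>j. if j = i then e else 0) q = snd q i ^ e"
proof -
  assume i: "i \<in> {1..n}"
  have "xmonomial n (\<lambda>j. if j = i then e else 0) q = (\<Prod>j\<in>{1..n}. if j = i then snd q i ^ e else 1)"
    unfolding xmonomial_def by (rule prod.cong) auto
  then show ?thesis using i by simp
qed

lemma xdegree_add: "xdegree n (\<lambda>i. m i + m' i) = xdegree n m + xdegree n m'"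
  by (simp add: xdegree_def sum.distrib)

lemma xdegree_single: "i \<in> {1..n} \<Longrightarrow> xdegree n (\<lambda>j. if j = i then e else 0) = e"
  by (simp add: xdegree_def)

lemma hsym_spanned:
  assumes "finite V" "V \<subseteq> {1..n}"
  shows "spanned \<alpha> (xmonomial n ` {m. (\<forall>i. i \<notin> V \<longrightarrow> m i = 0) \<and> xdegree n m = r})
      (\<lambda>q. hsym V r (snd q))"
  using assms
proof (induction V arbitrary: r)
  case empty
  show ?case
  proof (cases "r = 0")
    case True
    have "spanned \<alpha> (xmonomial n ` {m. (\<forall>i. i \<notin> {} \<longrightarrow> m i = 0) \<and> xdegree n m = r})
        (xmonomial n (\<lambda>_. 0))"
      using True by (intro spanned_base imageI) (simp add: xdegree_def)
    then show ?thesis by (rule spanned_cong) (simp add: hsym_empty True xmonomial_def)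
  qed (auto intro: spanned.zero simp: hsym_empty)
next
  case (insert i V)
  have i: "i \<in> {1..n}" using insert.prems by simp
  let ?G = "\<lambda>V r. xmonomial n ` {m. (\<forall>i. i \<notin> V \<longrightarrow> m i = 0) \<and> xdegree n m = r}"
  have "spanned \<alpha> (?G (insert i V) r) (\<lambda>q. \<Sum>p=0..r. snd q i ^ p * hsym V (r - p) (snd q))"
  proof (rule spanned_sum)
    fix p assume p: "p \<in> {0..r}"
    have "spanned \<alpha> (?G V (r - p)) (\<lambda>q. hsym V (r - p) (snd q))" using insert by simp
    then show "spanned \<alpha> (?G (insert i V) r) (\<lambda>q. snd q i ^ p * hsym V (r - p) (snd q))"
    proof (rule spanned_mult)
      fix g assume "g \<in> ?G V (r - p)"
      then obtain m where m: "g = xmonomial n m" "\<forall>i. i \<notin> V \<longrightarrow> m i = 0" "xdegree n m = r - p"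
          by blast
      let ?m = "\<lambda>j. (if j = i then p else 0) + m j"
      have "xmonomial n ?m \<in> ?G (insert i V) r"
        using m p i by (intro imageI) (simp add: xdegree_add xdegree_single)
      from spanned_base[OF this] show "spanned \<alpha> (?G (insert i V) r) (\<lambda>q. snd q i ^ p * g q)"
        by (rule spanned_cong) (simp add: m(1) xmonomial_add xmonomial_single[OF i])
    qed
  qed
  then show ?case by (rule spanned_cong) (simp add: hsym_insert insert.hyps)
qed

lemma fps_prod_nth_0: "fps_nth (\<Prod>i\<in>A. f i) 0 = (\<Prod>i\<in>A. fps_nth (f i) 0 :: complex)"
  by (induction A rule: infinite_finite_induct) simp_all

text \<open>The product over the rows in \<open>hsym_relation\<close> has constant term 1 and coefficients in
  \<open>S(\<ss>\<^sup>*)\<close>, so the relation can be solved for \<open>hsym V r\<close>.\<close>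

lemma hsym_spanned_lower:
  assumes pos: "\<forall>a\<in>set \<alpha>. 0 < a" and V: "V \<subseteq> {1..sum_list \<alpha>}"
    and r: "(\<Sum>j=1..length \<alpha>. min (\<alpha> ! (j - 1)) (card V)) < r + card V"
  shows "spanned \<alpha> (xmonomial (sum_list \<alpha>) ` {m. xdegree (sum_list \<alpha>) m < r})
      (\<lambda>q. hsym V r (snd q))"
proof -
  define E where "E h = (\<Prod>j=1..length \<alpha>.
      (1 - fps_const (h (block_end \<alpha> j)) * fps_X) ^ min (\<alpha> ! (j - 1)) (card V))"
          for h :: "nat \<Rightarrow> complex"
  have "block_end \<alpha> j \<in> {1..sum_list \<alpha>}" if "j \<in> {1..length \<alpha>}" for j
    using block_end_in_block[OF pos that] block_subset[OF that] by blast
  then have "scalar_fps \<alpha> E"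
    unfolding E_def by (intro scalar_fps_prod scalar_fps_power scalar_fps_linear)
  then have scalE: "scalar \<alpha> (\<lambda>h. fps_nth (E h) s)" for s by (simp add: scalar_fps_def)
  have E0: "fps_nth (E h) 0 = 1" for h
    unfolding E_def by (simp add: fps_prod_nth_0 fps_power_zeroth)
  have fin: "finite V" using V finite_subset by blast
  have "spanned \<alpha> (xmonomial (sum_list \<alpha>) ` {m. xdegree (sum_list \<alpha>) m < r})
      (\<lambda>q. - (\<Sum>s=1..r. fps_nth (E (fst q)) s * hsym V (r - s) (snd q)))"
  proof (intro spanned_uminus spanned_sum spanned_scalar scalE)
    fix s assume "s \<in> {1..r}"
    then show "spanned \<alpha> (xmonomial (sum_list \<alpha>) ` {m. xdegree (sum_list \<alpha>) m < r})
        (\<lambda>q. hsym V (r - s) (snd q))"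
      by (intro spanned_subset[OF hsym_spanned[OF fin V]]) auto
  qed
  then show ?thesis
  proof (rule spanned_cong)
    fix q assume "q \<in> Zvar \<alpha>"
    from hsym_relation[OF pos this V r]
    have "(\<Sum>s=0..r. fps_nth (E (fst q)) s * hsym V (r - s) (snd q)) = 0" by (simp only: E_def)
    then show "hsym V r (snd q) = - (\<Sum>s=1..r. fps_nth (E (fst q)) s * hsym V (r - s) (snd q))"
      by (simp add: sum.atLeast_Suc_atMost E0 eq_neg_iff_add_eq_0)
  qed
qed

text \<open>The position, counted from 0, of row \<open>r\<close> when the rows are sorted by decreasing length
  and rows of equal length from top to bottom.\<close>

definition row_rank :: "nat \<Rightarrow> (nat \<Rightarrow> nat) \<Rightarrow> nat \<Rightarrow> nat" where
  "row_rank k \<beta> r = card {j \<in> {1..k}. \<beta> r < \<beta> j \<or> (\<beta> j = \<beta> r \<and> j < r)}"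

text \<open>A map \<open>\<rho>\<close> from entries to rows describes a filling in which each of \<open>1, 2, \<dots>\<close> takes the
  last free box of its row; \<open>remaining \<alpha> \<rho> l r\<close> is the number of free boxes of row \<open>r\<close> after \<open>l\<close>
  entries.\<close>

definition remaining :: "nat list \<Rightarrow> (nat \<Rightarrow> nat) \<Rightarrow> nat \<Rightarrow> nat \<Rightarrow> nat" where
  "remaining \<alpha> \<rho> l r = \<alpha> ! (r - 1) - card {i \<in> {1..l}. \<rho> i = r}"

text \<open>For each of the first \<open>l\<close> entries, its row is the one prescribed by \<open>m\<close>. In the filling
  so obtained the Springer inversions with first entry \<open>i\<close> are counted by the rank of its row,
  since only the larger entries, which fill exactly the remaining boxes, matter.\<close>

definition greedy :: "nat list \<Rightarrow> (nat \<Rightarrow> nat) \<Rightarrow> (nat \<Rightarrow> nat) \<Rightarrow> nat \<Rightarrow> bool" where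
  "greedy \<alpha> m \<rho> l \<longleftrightarrow> (\<forall>i\<in>{1..l}. \<rho> i \<in> {1..length \<alpha>} \<and> 0 < remaining \<alpha> \<rho> (i - 1) (\<rho> i) \<and>
     m i = row_rank (length \<alpha>) (remaining \<alpha> \<rho> (i - 1)) (\<rho> i))"

lemma remaining_Suc:
  "remaining \<alpha> \<rho> (Suc l) r = (if \<rho> (Suc l) = r then remaining \<alpha> \<rho> l r - 1 else remaining \<alpha> \<rho> l r)"
proof -
  have "{i \<in> {1..Suc l}. \<rho> i = r} =
      (if \<rho> (Suc l) = r then insert (Suc l) {i \<in> {1..l}. \<rho> i = r} else {i \<in> {1..l}. \<rho> i = r})"
    by (auto simp: le_Suc_eq)
  then show ?thesis by (simp add: remaining_def)
qed

text \<open>The exponent vectors that precede, in the order used for straightening, every vector of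
  degree \<open>d\<close> whose first \<open>l\<close> entries are those of \<open>m\<close>. Fixing only a prefix leaves room for the
  later variables.\<close>

definition smaller :: "nat \<Rightarrow> nat \<Rightarrow> nat \<Rightarrow> (nat \<Rightarrow> nat) \<Rightarrow> (nat \<Rightarrow> nat) set" where
  "smaller n l d m = {m'. xdegree n m' < d \<or> (xdegree n m' = d \<and> lex_above l m m')}"

text \<open>The monomial \<open>e\<close> leaves alone the first \<open>l\<close> exponents, where the lexicographic
  comparison takes place.\<close>

lemma smaller_shift:
  assumes "spanned \<alpha> (xmonomial n ` smaller n l d m) f" "\<forall>i\<in>{1..l}. e i = 0"
  shows "spanned \<alpha> (xmonomial n ` smaller n l (d + xdegree n e) m) (\<lambda>q. xmonomial n e q * f q)"
  using assms(1)
proof (rule spanned_mult)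
  fix g assume "g \<in> xmonomial n ` smaller n l d m"
  then obtain m' where m': "g = xmonomial n m'" "m' \<in> smaller n l d m" by blast
  have "lex_above l m m' \<Longrightarrow> lex_above l m (\<lambda>i. e i + m' i)"
    unfolding lex_above_def using assms(2) by fastforce
  then have "(\<lambda>i. e i + m' i) \<in> smaller n l (d + xdegree n e) m"
    using m'(2) by (auto simp: smaller_def xdegree_add)
  then have "spanned \<alpha> (xmonomial n ` smaller n l (d + xdegree n e) m)
      (xmonomial n (\<lambda>i. e i + m' i))"
    by (intro spanned_base imageI)
  then show "spanned \<alpha> (xmonomial n ` smaller n l (d + xdegree n e) m) (\<lambda>q. xmonomial n e q * g q)"
    by (rule spanned_cong) (simp add: m'(1) xmonomial_add)
qed

lemma smaller_shift_single:
  assumes "spanned \<alpha> (xmonomial n ` smaller n l d m) f" "l < i" "i \<in> {1..n}" "d' = d + p"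
  shows "spanned \<alpha> (xmonomial n ` smaller n l d' m) (\<lambda>q. snd q i ^ p * f q)"
proof -
  have "spanned \<alpha> (xmonomial n ` smaller n l d' m)
      (\<lambda>q. xmonomial n (\<lambda>j. if j = i then p else 0) q * f q)"
    using smaller_shift[OF assms(1), of "\<lambda>j. if j = i then p else 0"] assms
        by (simp add: xdegree_single)
  then show ?thesis using assms(3) by (simp add: xmonomial_single)
qed

lemma smaller_Suc: "smaller n l d m \<subseteq> smaller n (Suc l) d m"
  by (fastforce simp: smaller_def lex_above_def)

lemma greedy_mono: "greedy \<alpha> m \<rho> l \<Longrightarrow> l' \<le> l \<Longrightarrow> greedy \<alpha> m \<rho> l'"
  by (simp add: greedy_def)

text \<open>Comparing the relations for \<open>v\<close> and \<open>v + 1\<close> coordinates: the degree bound grows by the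
  number of rows longer than \<open>v\<close>.\<close>

lemma sum_min_Suc:
  "(\<Sum>j\<in>A. min (b j) (Suc v)) = (\<Sum>j\<in>A. min (b j) v) + card {j \<in> A. v < b j}" if "finite A"
      for b :: "nat \<Rightarrow> nat"
proof -
  have "(\<Sum>j\<in>A. min (b j) (Suc v)) = (\<Sum>j\<in>A. min (b j) v + (if v < b j then 1 else 0))"
    by (rule sum.cong) auto
  also have "\<dots> = (\<Sum>j\<in>A. min (b j) v) + (\<Sum>j\<in>A. if v < b j then 1 else 0)"
    by (rule sum.distrib)
  also have "(\<Sum>j\<in>A. if v < b j then 1 else 0) = card {j \<in> A. v < b j}"
    using that by (simp add: sum.If_cases Int_def)
  finally show ?thesis .
qed

text \<open>The Tanisaki relations for the rows that are left, carried along the placement of the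
  first \<open>l\<close> entries. In the step, entry \<open>l + 1\<close> goes into row \<open>\<rho> (l + 1)\<close>. If that row is longer
  than \<open>|V|\<close>, or \<open>r\<close> exceeds the old bound, the relation for \<open>V\<close> is already available. Otherwise
  \<open>r\<close> lies exactly at the old bound, and the relation for \<open>V\<close> together with \<open>l + 1\<close> is used, in
  degree \<open>r + c\<close> with \<open>c\<close> the number of rows longer than \<open>|V|\<close>. It expands as
  \<open>\<Sum>\<^sub>p x\<^bsub>l+1\<^esub>\<^sup>p h\<^bsub>r+c-p\<^esub>(x\<^sub>V)\<close>. The terms with \<open>p < c\<close> are reducible by the relations for \<open>V\<close>,
  those with \<open>p > c\<close> are lexicographically larger, and the term with \<open>p = c\<close> is the one wanted,
  after multiplication by the missing power of \<open>x\<^bsub>l+1\<^esub>\<close>. That power exists because each of the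
  \<open>c\<close> longer rows is counted in the rank \<open>m (l + 1)\<close> of that row.\<close>

lemma greedy_straightening:
  fixes m :: "nat \<Rightarrow> nat"
  assumes pos: "\<forall>a\<in>set \<alpha>. 0 < a" and n: "n = sum_list \<alpha>"
  shows "greedy \<alpha> m \<rho> l \<Longrightarrow> l \<le> n \<Longrightarrow> V \<subseteq> {Suc l..n} \<Longrightarrow>
    (\<Sum>j=1..length \<alpha>. min (remaining \<alpha> \<rho> l j) (card V)) < r + card V \<Longrightarrow>
    spanned \<alpha> (xmonomial n ` smaller n l ((\<Sum>i=1..l. m i) + r) m)
      (\<lambda>q. (\<Prod>i=1..l. snd q i ^ m i) * hsym V r (snd q))"
proof (induction l arbitrary: V r)
  case 0
  have "spanned \<alpha> (xmonomial n ` {m. xdegree n m < r}) (\<lambda>q. hsym V r (snd q))"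
    using 0 unfolding n by (intro hsym_spanned_lower[OF pos]) (simp_all add: remaining_def)
  then show ?case by (auto intro: spanned_subset simp: smaller_def)
next
  case (Suc l)
  let ?S = "\<Sum>i=1..l. m i" and ?P = "\<lambda>q::zpoint. \<Prod>i=1..l. snd q i ^ m i"
  let ?k = "length \<alpha>" and ?r = "\<rho> (Suc l)" and ?v = "card V"
  let ?b = "remaining \<alpha> \<rho> l" and ?b' = "remaining \<alpha> \<rho> (Suc l)"
  have greedy: "greedy \<alpha> m \<rho> l" using Suc.prems(1) by (rule greedy_mono) simp
  have r: "?r \<in> {1..?k}" "0 < ?b ?r" "m (Suc l) = row_rank ?k ?b ?r"
    using Suc.prems(1)[unfolded greedy_def, THEN bspec, of "Suc l"] by simp_all
  have fin: "finite V" using Suc.prems(3) finite_subset by blast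
  have l: "Suc l \<in> {1..n}" "l < Suc l" using Suc.prems(2) by auto
  have IH: "spanned \<alpha> (xmonomial n ` smaller n l (?S + s) m) (\<lambda>q. ?P q * hsym U s (snd q))"
    if "U \<subseteq> {Suc l..n}" "(\<Sum>j=1..?k. min (?b j) (card U)) < s + card U" for U s
    using Suc.IH[OF greedy _ that] Suc.prems(2) by simp
  have direct: ?case if "(\<Sum>j=1..?k. min (?b j) ?v) < r + ?v"
  proof -
    have "spanned \<alpha> (xmonomial n ` smaller n l ((\<Sum>i=1..Suc l. m i) + r) m)
        (\<lambda>q. snd q (Suc l) ^ m (Suc l) * (?P q * hsym V r (snd q)))"
      by (rule smaller_shift_single[OF IH[OF _ that] l(2,1)]) (use Suc.prems(3) in auto)
    then have "spanned \<alpha> (xmonomial n ` smaller n (Suc l) ((\<Sum>i=1..Suc l. m i) + r) m)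
        (\<lambda>q. snd q (Suc l) ^ m (Suc l) * (?P q * hsym V r (snd q)))"
      using smaller_Suc by (blast intro: spanned_subset)
    then show ?thesis by (rule spanned_cong) (simp add: algebra_simps)
  qed
  show ?case
  proof (cases "?v < ?b ?r")
    case True
    have "(\<Sum>j=1..?k. min (?b' j) ?v) = (\<Sum>j=1..?k. min (?b j) ?v)"
      by (rule sum.cong) (use True in \<open>auto simp: remaining_Suc\<close>)
    then show ?thesis using direct Suc.prems(4) by simp
  next
    case False
    have "(\<Sum>j=1..?k. min (?b j) ?v) = (\<Sum>j=1..?k. min (?b' j) ?v + (if j = ?r then 1 else 0))"
      by (rule sum.cong) (use False r(2) in \<open>auto simp: remaining_Suc\<close>)
    also have "\<dots> = (\<Sum>j=1..?k. min (?b' j) ?v) + 1"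
      using r(1) by (simp add: sum.distrib)
    finally have D: "(\<Sum>j=1..?k. min (?b j) ?v) \<le> r + ?v" using Suc.prems(4) by simp
    show ?thesis
    proof (cases "(\<Sum>j=1..?k. min (?b j) ?v) < r + ?v")
      case True
      then show ?thesis by (rule direct)
    next
      case notless: False
      then have D: "(\<Sum>j=1..?k. min (?b j) ?v) = r + ?v" using D by simp
      define c where "c = card {j \<in> {1..?k}. ?v < ?b j}"
      have c: "c \<le> m (Suc l)"
        unfolding c_def r(3) row_rank_def using False by (intro card_mono) auto
      let ?U = "insert (Suc l) V" and ?R = "r + c"
      have notin: "Suc l \<notin> V" using Suc.prems(3) by auto
      have cardU: "card ?U = Suc ?v" using fin notin by simp
      have whole: "spanned \<alpha> (xmonomial n ` smaller n l (?S + ?R) m)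
          (\<lambda>q. ?P q * hsym ?U ?R (snd q))"
      proof (rule IH)
        show "?U \<subseteq> {Suc l..n}" using Suc.prems(2,3) by auto
        show "(\<Sum>j=1..?k. min (?b j) (card ?U)) < ?R + card ?U"
          using sum_min_Suc[of "{1..?k}" ?b ?v] D by (simp add: cardU c_def)
      qed
      have small: "spanned \<alpha> (xmonomial n ` smaller n l (?S + ?R) m)
          (\<lambda>q. snd q (Suc l) ^ p * (?P q * hsym V (?R - p) (snd q)))" if "p < c" for p
      proof (rule smaller_shift_single[OF IH l(2,1)])
        show "V \<subseteq> {Suc l..n}" using Suc.prems(3) by auto
        show "(\<Sum>j=1..?k. min (?b j) ?v) < ?R - p + ?v" using D that by simp
      qed (use that in simp)
      let ?d = "(\<Sum>i=1..Suc l. m i) + r" and ?e = "m (Suc l) - c"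
      let ?G = "xmonomial n ` smaller n (Suc l) ?d m"
      have lift: "spanned \<alpha> ?G (\<lambda>q. snd q (Suc l) ^ ?e * f q)"
        if "spanned \<alpha> (xmonomial n ` smaller n l (?S + ?R) m) f" for f
      proof -
        have "spanned \<alpha> (xmonomial n ` smaller n l ?d m) (\<lambda>q. snd q (Suc l) ^ ?e * f q)"
          by (rule smaller_shift_single[OF that l(2,1)]) (use c in simp)
        then show ?thesis using smaller_Suc by (blast intro: spanned_subset)
      qed
      have large: "spanned \<alpha> ?G
          (\<lambda>q. snd q (Suc l) ^ ?e * (snd q (Suc l) ^ p * (?P q * hsym V (?R - p) (snd q))))"
        if p: "c < p" "p \<le> ?R" for p
      proof -
        have "spanned \<alpha> ?G (\<lambda>q. (snd q (Suc l) ^ (?e + p) * ?P q) * hsym V (?R - p) (snd q))"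
        proof (rule spanned_mult[OF hsym_spanned[OF fin]])
          show "V \<subseteq> {1..n}" using Suc.prems(3) by auto
          fix g assume "g \<in> xmonomial n ` {m. (\<forall>i. i \<notin> V \<longrightarrow> m i = 0) \<and> xdegree n m = ?R - p}"
          then obtain m' where m': "g = xmonomial n m'" "\<forall>i. i \<notin> V \<longrightarrow> m' i = 0"
              "xdegree n m' = ?R - p" by blast
          let ?m1 = "\<lambda>i. if i \<in> {1..l} then m i else 0"
          let ?m2 = "\<lambda>i. if i = Suc l then ?e + p else 0"
          let ?m = "\<lambda>i. ?m1 i + (?m2 i + m' i)"
          have ln: "{1..n} \<inter> {1..l} = {1..l}" using Suc.prems(2) by auto
          have P: "xmonomial n ?m1 q = ?P q" for q
          proof -
            have "?P q = (\<Prod>i=1..n. snd q i ^ ?m1 i)"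
              using Suc.prems(2) by (intro prod.mono_neutral_cong_left) auto
            then show ?thesis by (simp add: xmonomial_def)
          qed
          have "xdegree n ?m1 = ?S"
            unfolding xdegree_def using Suc.prems(2) by (intro sum.mono_neutral_cong_right) auto
          then have "xdegree n ?m = ?d"
            using p c m'(3) l(1) by (simp add: xdegree_add xdegree_single)
          moreover have "lex_above (Suc l) m ?m"
            unfolding lex_above_def
          proof (intro bexI[of _ "Suc l"] conjI ballI)
            fix j assume j: "j \<in> {1..<Suc l}"
            then have "j \<notin> V" using Suc.prems(3) by auto
            then show "?m j = m j" using j m'(2) by simp
          qed (use p c in auto)
          ultimately have "spanned \<alpha> ?G (xmonomial n ?m)"
              by (intro spanned_base imageI) (simp add: smaller_def)
          then show "spanned \<alpha> ?G (\<lambda>q. (snd q (Suc l) ^ (?e + p) * ?P q) * g q)"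
            by (rule spanned_cong) (simp only: m'(1) xmonomial_add P xmonomial_single[OF l(1)]
                ac_simps)
        qed
        then show ?thesis by (rule spanned_cong) (simp add: power_add ac_simps)
      qed
      let ?t = "\<lambda>p q. snd q (Suc l) ^ ?e * (snd q (Suc l) ^ p * (?P q * hsym V (?R - p) (snd q)))"
      have "spanned \<alpha> ?G (\<lambda>q. snd q (Suc l) ^ ?e * (?P q * hsym ?U ?R (snd q)) -
          (\<Sum>p\<in>{0..?R} - {c}. ?t p q))"
      proof (rule spanned_diff[OF lift[OF whole] spanned_sum])
        fix p assume "p \<in> {0..?R} - {c}"
        then consider "p < c" | "c < p" "p \<le> ?R" by fastforce
        then show "spanned \<alpha> ?G (\<lambda>q. ?t p q)"
        proof cases
          case 1
          then show ?thesis by (rule lift[OF small])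
        next
          case 2
          then show ?thesis by (rule large)
        qed
      qed
      then show ?thesis
      proof (rule spanned_cong)
        fix q
        have "snd q (Suc l) ^ ?e * (?P q * hsym ?U ?R (snd q)) = (\<Sum>p\<in>{0..?R}. ?t p q)"
          unfolding hsym_insert[OF fin notin] sum_distrib_left
              by (rule sum.cong) (simp_all only: ac_simps)
        also have "\<dots> = ?t c q + (\<Sum>p\<in>{0..?R} - {c}. ?t p q)" by (rule sum.remove) auto
        also have "?t c q = snd q (Suc l) ^ (?e + c) * (?P q * hsym V r (snd q))"
          by (simp add: power_add)
        finally show "(\<Prod>i=1..Suc l. snd q i ^ m i) * hsym V r (snd q) =
            snd q (Suc l) ^ ?e * (?P q * hsym ?U ?R (snd q)) - (\<Sum>p\<in>{0..?R} - {c}. ?t p q)"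
          using c by (simp add: ac_simps)
      qed
    qed
  qed
qed

text \<open>Ranks of distinct rows differ, and a nonempty row has only nonempty rows before it.\<close>

lemma row_rank_surj:
  assumes "x < card {r \<in> {1..k}. 0 < \<beta> r}"
  obtains r where "r \<in> {1..k}" "0 < \<beta> r" "row_rank k \<beta> r = x"
proof -
  let ?A = "{r \<in> {1..k}. 0 < \<beta> r}"
  let ?L = "\<lambda>r. {j \<in> {1..k}. \<beta> r < \<beta> j \<or> (\<beta> j = \<beta> r \<and> j < r)}"
  have less: "row_rank k \<beta> r < row_rank k \<beta> s"
    if "r \<in> {1..k}" "\<beta> s < \<beta> r \<or> (\<beta> r = \<beta> s \<and> r < s)" for r s
  proof -
    have "r \<in> ?L s - ?L r" using that by auto
    moreover have "?L r \<subseteq> ?L s" using that by auto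
    ultimately have "?L r \<subset> ?L s" by blast
    then show ?thesis unfolding row_rank_def by (intro psubset_card_mono) auto
  qed
  have "inj_on (row_rank k \<beta>) ?A"
  proof (rule inj_onI)
    fix r s assume "r \<in> ?A" "s \<in> ?A" "row_rank k \<beta> r = row_rank k \<beta> s"
    then show "r = s" using less[of r s] less[of s r] by (cases r s rule: linorder_cases) force+
  qed
  then have card: "card (row_rank k \<beta> ` ?A) = card ?A" by (rule card_image)
  have "row_rank k \<beta> r < card ?A" if "r \<in> ?A" for r
  proof -
    have "?L r \<subseteq> ?A" using that by auto
    moreover have "r \<in> ?A - ?L r" using that by auto
    ultimately have "?L r \<subset> ?A" by blast
    then show ?thesis unfolding row_rank_def by (intro psubset_card_mono) auto
  qed
  then have "row_rank k \<beta> ` ?A = {..<card ?A}"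
    using card by (intro card_subset_eq) auto
  then have "x \<in> row_rank k \<beta> ` ?A" using assms by simp
  then show thesis using that by blast
qed

lemma remaining_cong:
  "(\<And>i. i \<in> {1..l} \<Longrightarrow> \<rho> i = \<rho>' i) \<Longrightarrow> remaining \<alpha> \<rho> l r = remaining \<alpha> \<rho>' l r"
  unfolding remaining_def by (intro arg_cong2[where f = "(-)"] arg_cong[where f = card]) auto

lemma greedy_or_stuck:
  "(\<exists>\<rho>. greedy \<alpha> m \<rho> n) \<or>
   (\<exists>\<rho> l. l < n \<and> greedy \<alpha> m \<rho> l \<and> card {r \<in> {1..length \<alpha>}. 0 < remaining \<alpha> \<rho> l r} \<le> m (Suc l))"
proof (induction n)
  case 0
  then show ?case by (simp add: greedy_def)
next
  case (Suc n)
  show ?case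
  proof (cases "\<exists>\<rho>. greedy \<alpha> m \<rho> n")
    case True
    then obtain \<rho> where \<rho>: "greedy \<alpha> m \<rho> n" ..
    show ?thesis
    proof (cases "m (Suc n) < card {r \<in> {1..length \<alpha>}. 0 < remaining \<alpha> \<rho> n r}")
      case True
      then obtain r where r: "r \<in> {1..length \<alpha>}" "0 < remaining \<alpha> \<rho> n r"
          "row_rank (length \<alpha>) (remaining \<alpha> \<rho> n) r = m (Suc n)"
        by (rule row_rank_surj)
      let ?\<rho> = "\<rho>(Suc n := r)"
      have same: "remaining \<alpha> ?\<rho> l = remaining \<alpha> \<rho> l" if "l \<le> n" for l
        using that by (intro ext remaining_cong) auto
      have "greedy \<alpha> m ?\<rho> (Suc n)"
        unfolding greedy_def
      proof
        fix i assume i: "i \<in> {1..Suc n}"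
        show "?\<rho> i \<in> {1..length \<alpha>} \<and> 0 < remaining \<alpha> ?\<rho> (i - 1) (?\<rho> i) \<and>
            m i = row_rank (length \<alpha>) (remaining \<alpha> ?\<rho> (i - 1)) (?\<rho> i)"
        proof (cases "i = Suc n")
          case True
          then show ?thesis using r same[of n] by simp
        next
          case False
          then have i: "i \<in> {1..n}" "i - 1 \<le> n" using i by auto
          then show ?thesis using \<rho>[unfolded greedy_def, THEN bspec, OF i(1)] False same[OF i(2)]
              by simp
        qed
      qed
      then show ?thesis by blast
    next
      case False
      then show ?thesis using \<rho> by (intro disjI2 exI[of _ \<rho>] exI[of _ n]) simp
    qed
  next
    case False
    then show ?thesis using Suc.IH less_SucI by blast
  qed
qed

text \<open>If the greedy placement is stuck at entry \<open>l + 1\<close>, at most \<open>m (l + 1)\<close> rows are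
  nonempty, and the relation for the single variable \<open>x\<^bsub>l+1\<^esub>\<close> rewrites its power with exponent
  \<open>m (l + 1)\<close>.\<close>

lemma straightening:
  assumes pos: "\<forall>a\<in>set \<alpha>. 0 < a" and n: "n = sum_list \<alpha>"
  shows "(\<exists>\<rho>. greedy \<alpha> m \<rho> n) \<or> spanned \<alpha> (xmonomial n ` smaller n n (xdegree n m) m)
      (xmonomial n m)"
  using greedy_or_stuck[of \<alpha> m n]
proof
  assume "\<exists>\<rho> l. l < n \<and> greedy \<alpha> m \<rho> l \<and>
    card {r \<in> {1..length \<alpha>}. 0 < remaining \<alpha> \<rho> l r} \<le> m (Suc l)"
  then obtain \<rho> l where l: "l < n" "greedy \<alpha> m \<rho> l"
    and stuck: "card {r \<in> {1..length \<alpha>}. 0 < remaining \<alpha> \<rho> l r} \<le> m (Suc l)" by blast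
  let ?e = "\<lambda>i. if Suc l < i then m i else 0"
  have "(\<Sum>j=1..length \<alpha>. min (remaining \<alpha> \<rho> l j) 1) = card {r \<in> {1..length \<alpha>}. 0 < remaining \<alpha> \<rho> l
      r}"
    using sum_min_Suc[of "{1..length \<alpha>}" "remaining \<alpha> \<rho> l" 0] by simp
  then have "spanned \<alpha> (xmonomial n ` smaller n l ((\<Sum>i=1..l. m i) + m (Suc l)) m)
      (\<lambda>q. (\<Prod>i=1..l. snd q i ^ m i) * hsym {Suc l} (m (Suc l)) (snd q))"
    using l stuck by (intro greedy_straightening[OF pos n l(2)]) simp_all
  moreover have single: "hsym {Suc l} r t = t (Suc l) ^ r" for r t
    by (simp add: hsym_def)
  ultimately have "spanned \<alpha> (xmonomial n ` smaller n l ((\<Sum>i=1..Suc l. m i) + xdegree n ?e) m)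
      (\<lambda>q. xmonomial n ?e q * (\<Prod>i=1..Suc l. snd q i ^ m i))"
    using smaller_shift[of \<alpha> n l "\<Sum>i=1..Suc l. m i" m "\<lambda>q. \<Prod>i=1..Suc l. snd q i ^ m i" ?e] by simp
  moreover have "(\<Sum>i=1..Suc l. m i) + xdegree n ?e = xdegree n m"
  proof -
    have "(\<Sum>i=1..Suc l. m i) = (\<Sum>i=1..n. if Suc l < i then 0 else m i)"
      using l(1) by (intro sum.mono_neutral_cong_left) auto
    then show ?thesis unfolding xdegree_def
      by (simp only: sum.distrib[symmetric]) (rule sum.cong, auto)
  qed
  moreover have "xmonomial n ?e q * (\<Prod>i=1..Suc l. snd q i ^ m i) = xmonomial n m q" for q
  proof -
    have "(\<Prod>i=1..Suc l. snd q i ^ m i) = (\<Prod>i=1..n. if Suc l < i then 1 else snd q i ^ m i)"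
      using l(1) by (intro prod.mono_neutral_cong_left) auto
    then show ?thesis unfolding xmonomial_def
      by (simp only: prod.distrib[symmetric]) (rule prod.cong, auto)
  qed
  moreover have "smaller n l d m \<subseteq> smaller n n d m" for d
    using l(1) by (fastforce simp: smaller_def lex_above_def)
  ultimately have "spanned \<alpha> (xmonomial n ` smaller n n (xdegree n m) m) (xmonomial n m)"
    by (metis (no_types, lifting) spanned_cong spanned_subset image_mono)
  then show ?thesis ..
qed blast

section \<open>Fillings and their inversion vectors\<close>

lemma card_diagram: "card (diagram \<alpha>) = sum_list \<alpha>" and finite_diagram: "finite (diagram \<alpha>)"
proof -
  have eq: "diagram \<alpha> = Sigma {1..length \<alpha>} (\<lambda>r. {1..\<alpha> ! (r - 1)})"
    by (auto simp: diagram_def)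
  then show "finite (diagram \<alpha>)" by simp
  have "card (diagram \<alpha>) = (\<Sum>r=1..length \<alpha>. \<alpha> ! (r - 1))" unfolding eq by simp
  also have "\<dots> = (\<Sum>r<length \<alpha>. \<alpha> ! r)"
    by (rule sum.reindex_bij_witness[of _ Suc "\<lambda>r. r - 1"]) auto
  finally show "card (diagram \<alpha>) = sum_list \<alpha>" by (simp add: sum_list_sum_nth atLeast0LessThan)
qed

lemma remaining_antimono: "l \<le> l' \<Longrightarrow> remaining \<alpha> \<rho> l' r \<le> remaining \<alpha> \<rho> l r"
  unfolding remaining_def by (intro diff_le_mono2 card_mono) auto

lemma remaining_le: "remaining \<alpha> \<rho> l r \<le> \<alpha> ! (r - 1)"
  by (simp add: remaining_def)

text \<open>The filling is the inverse of the bijection \<open>box\<close> from entries to boxes. A box \<open>(j, c)\<close>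
  has an entry larger than \<open>i\<close> iff it is still free after \<open>i\<close> entries (\<open>entry\<close>), and this turns
  Springer inversions into rows counted by the rank.\<close>

lemma greedy_filling:
  assumes n: "n = sum_list \<alpha>" and greedy: "greedy \<alpha> m \<rho> n"
  obtains T where "T \<in> RSCT \<alpha>" "\<And>i. i \<in> {1..n} \<Longrightarrow> inversion_vector \<alpha> T i = m i"
proof -
  define box where "box i = (\<rho> i, remaining \<alpha> \<rho> (i - 1) (\<rho> i))" for i
  have g: "\<rho> i \<in> {1..length \<alpha>}" "0 < remaining \<alpha> \<rho> (i - 1) (\<rho> i)"
      "m i = row_rank (length \<alpha>) (remaining \<alpha> \<rho> (i - 1)) (\<rho> i)" if "i \<in> {1..n}" for i
    using greedy that by (auto simp: greedy_def)
  have drop: "remaining \<alpha> \<rho> i (\<rho> i) = remaining \<alpha> \<rho> (i - 1) (\<rho> i) - 1" if "i \<in> {1..n}" for i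
    using that remaining_Suc[of \<alpha> \<rho> "i - 1" "\<rho> i"] by simp
  have later: "remaining \<alpha> \<rho> (i' - 1) (\<rho> i) < remaining \<alpha> \<rho> (i - 1) (\<rho> i)"
    if "i \<in> {1..n}" "i < i'" for i i'
  proof -
    have "remaining \<alpha> \<rho> (i' - 1) (\<rho> i) \<le> remaining \<alpha> \<rho> i (\<rho> i)"
      using that by (intro remaining_antimono) simp
    then show ?thesis using drop[OF that(1)] g(2)[OF that(1)] by simp
  qed
  have inj: "inj_on box {1..n}"
  proof (rule inj_onI)
    fix i i' assume i: "i \<in> {1..n}" "i' \<in> {1..n}" and eq: "box i = box i'"
    then show "i = i'"
      using later[of i i'] later[of i' i] by (cases i i' rule: linorder_cases) (auto simp: box_def)
  qed
  have "box ` {1..n} \<subseteq> diagram \<alpha>"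
  proof
    fix b assume "b \<in> box ` {1..n}"
    then obtain i where i: "i \<in> {1..n}" "b = box i" by blast
    show "b \<in> diagram \<alpha>"
      unfolding i(2) box_def diagram_def
      using g[OF i(1)] remaining_le[of \<alpha> \<rho> "i - 1" "\<rho> i"] by auto
  qed
  moreover have "card (box ` {1..n}) = card (diagram \<alpha>)"
    unfolding card_image[OF inj] card_diagram by (simp add: n)
  ultimately have surj: "box ` {1..n} = diagram \<alpha>"
    by (rule card_subset_eq[OF finite_diagram])
  have bij: "bij_betw box {1..n} (diagram \<alpha>)" using inj surj by (simp add: bij_betw_def)
  define T where "T = restrict (inv_into {1..n} box) (diagram \<alpha>)"
  have Tbox: "T (box i) = i" if "i \<in> {1..n}" for i
    using that surj inv_into_f_f[OF inj that] by (auto simp: T_def)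
  have boxT: "box (T b) = b" "T b \<in> {1..n}" if "b \<in> diagram \<alpha>" for b
    using that surj f_inv_into_f[of b box "{1..n}"] inv_into_into[of b box "{1..n}"]
        by (simp_all add: T_def)
  have "bij_betw (inv_into {1..n} box) (diagram \<alpha>) {1..n}" by (rule bij_betw_inv_into[OF bij])
  then have "bij_betw T (diagram \<alpha>) {1..n}"
    by (rule bij_betw_cong[THEN iffD1, rotated]) (simp add: T_def)
  moreover have "T (r, c') < T (r, c)"
    if "(r, c) \<in> diagram \<alpha>" "(r, c') \<in> diagram \<alpha>" "c < c'" for r c c'
  proof -
    have b: "box (T (r, c)) = (r, c)" "box (T (r, c')) = (r, c')" "T (r, c) \<in> {1..n}"
        "T (r, c') \<in> {1..n}"
      using boxT that by blast+
    have "\<not> T (r, c) < T (r, c')"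
    proof
      assume "T (r, c) < T (r, c')"
      from later[OF b(3) this] show False using b(1,2) that(3) by (auto simp: box_def)
    qed
    moreover have "T (r, c) \<noteq> T (r, c')" using b(1,2) that(3) by auto
    ultimately show ?thesis by simp
  qed
  ultimately have RSCT: "T \<in> RSCT \<alpha>" by (auto simp: RSCT_def T_def n)
  have entry: "i < T (j, c) \<longleftrightarrow> c \<le> remaining \<alpha> \<rho> i j" if "(j, c) \<in> diagram \<alpha>" for i j c
  proof -
    let ?i = "T (j, c)"
    have b: "\<rho> ?i = j" "remaining \<alpha> \<rho> (?i - 1) j = c" "?i \<in> {1..n}"
      using boxT[OF that] by (auto simp: box_def)
    show ?thesis
    proof (cases "i < ?i")
      case True
      then have "remaining \<alpha> \<rho> (?i - 1) j \<le> remaining \<alpha> \<rho> i j" by (intro remaining_antimono) simp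
      then show ?thesis using True b by simp
    next
      case False
      then have "remaining \<alpha> \<rho> i j \<le> remaining \<alpha> \<rho> ?i j" by (intro remaining_antimono) simp
      then show ?thesis using False b drop[OF b(3)] g(2)[OF b(3)] by simp
    qed
  qed
  have last_column: "(\<exists>c'. 1 \<le> c' \<and> c' \<le> b \<and> (c' = c \<and> P \<or> c < c')) \<longleftrightarrow> c < b \<or> (b = c \<and> P)"
    if "0 < c" for b c :: nat and P
    using that by (intro iffI, force, intro exI[of _ b]) auto
  have "inversion_vector \<alpha> T i = m i" if i: "i \<in> {1..n}" for i
  proof -
    let ?r = "\<rho> i" and ?c = "remaining \<alpha> \<rho> (i - 1) (\<rho> i)"
    have box_i: "(r, c) \<in> diagram \<alpha> \<and> T (r, c) = i \<longleftrightarrow> r = ?r \<and> c = ?c" for r c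
      using boxT[of "(r, c)"] Tbox[OF i] surj i by (auto simp: box_def)
    have now: "remaining \<alpha> \<rho> i j = (if j = ?r then ?c - 1 else remaining \<alpha> \<rho> (i - 1) j)" for j
      using remaining_Suc[of \<alpha> \<rho> "i - 1" j] i by auto
    have "springer_inversion \<alpha> T i j \<longleftrightarrow> j \<in> {1..length \<alpha>} \<and>
        (?c < remaining \<alpha> \<rho> (i - 1) j \<or> (remaining \<alpha> \<rho> (i - 1) j = ?c \<and> j < ?r))" for j
    proof -
      have "springer_inversion \<alpha> T i j \<longleftrightarrow>
          (\<exists>c'. (j, c') \<in> diagram \<alpha> \<and> i < T (j, c') \<and> (c' = ?c \<and> j < ?r \<or> ?c < c'))"
        unfolding springer_inversion_def conj_assoc[symmetric] box_i by auto
      also have "\<dots> \<longleftrightarrow> (\<exists>c'. (j, c') \<in> diagram \<alpha> \<and> c' \<le> remaining \<alpha> \<rho> i j \<and>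
          (c' = ?c \<and> j < ?r \<or> ?c < c'))"
        using entry by blast
      also have "\<dots> \<longleftrightarrow> j \<in> {1..length \<alpha>} \<and>
          (\<exists>c'. 1 \<le> c' \<and> c' \<le> remaining \<alpha> \<rho> i j \<and> (c' = ?c \<and> j < ?r \<or> ?c < c'))"
        using remaining_le[of \<alpha> \<rho> i j] by (auto simp: diagram_def)
      also have "(\<exists>c'. 1 \<le> c' \<and> c' \<le> remaining \<alpha> \<rho> i j \<and> (c' = ?c \<and> j < ?r \<or> ?c < c')) \<longleftrightarrow>
          ?c < remaining \<alpha> \<rho> (i - 1) j \<or> (remaining \<alpha> \<rho> (i - 1) j = ?c \<and> j < ?r)"
      proof (cases "j = ?r")
        case False
        then show ?thesis unfolding now[of j]
          using g(2)[OF i] last_column[of ?c "remaining \<alpha> \<rho> (i - 1) j" "j < ?r"] by simp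
      next
        case True
        then have "remaining \<alpha> \<rho> i j = ?c - 1" using now[of j] by simp
        then show ?thesis using True by auto
      qed
      finally show ?thesis .
    qed
    then show ?thesis
      unfolding inversion_vector_def g(3)[OF i] row_rank_def
      by (intro arg_cong[where f = card] Collect_cong)
  qed
  then show thesis using that[OF RSCT] by blast
qed

text \<open>Every row counted contains an entry larger than \<open>i\<close>, and entries of different rows are
  different.\<close>

lemma inversion_vector_le:
  assumes "T \<in> RSCT \<alpha>"
  shows "inversion_vector \<alpha> T i \<le> sum_list \<alpha> - i"
proof -
  have bij: "bij_betw T (diagram \<alpha>) {1..sum_list \<alpha>}" using assms by (simp add: RSCT_def)
  have "{j. springer_inversion \<alpha> T i j} \<subseteq> (\<lambda>e. fst (inv_into (diagram \<alpha>) T e)) ` {i<..sum_list \<alpha>}"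
  proof
    fix j assume "j \<in> {j. springer_inversion \<alpha> T i j}"
    then obtain c where c: "(j, c) \<in> diagram \<alpha>" "i < T (j, c)"
        by (auto simp: springer_inversion_def)
    have "inv_into (diagram \<alpha>) T (T (j, c)) = (j, c)"
      using bij c(1) by (simp add: bij_betw_inv_into_left)
    moreover have "T (j, c) \<in> {i<..sum_list \<alpha>}" using bij_betwE[OF bij] c by auto
    ultimately show "j \<in> (\<lambda>e. fst (inv_into (diagram \<alpha>) T e)) ` {i<..sum_list \<alpha>}"
      by (metis fst_conv image_eqI)
  qed
  from surj_card_le[OF _ this] show ?thesis by (simp add: inversion_vector_def)
qed

lemma u_perm:
  assumes "T \<in> RSCT \<alpha>"
  shows "u_perm \<alpha> T permutes {1..sum_list \<alpha>}"
    and "k \<in> {1..sum_list \<alpha>} \<Longrightarrow> lehmer (sum_list \<alpha>) (u_perm \<alpha> T) k = inversion_vector \<alpha> T k"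
proof -
  let ?n = "sum_list \<alpha>" and ?c = "\<lambda>k. if k < sum_list \<alpha> then inversion_vector \<alpha> T k else 0"
  have "\<exists>!w. w permutes {1..?n} \<and> (\<forall>k\<in>{1..?n}. lehmer ?n w k = ?c k)"
    by (rule lehmer_code_ex1) (simp add: inversion_vector_le[OF assms])
  from theI'[OF this]
  have u: "u_perm \<alpha> T permutes {1..?n} \<and> (\<forall>k\<in>{1..?n}. lehmer ?n (u_perm \<alpha> T) k = ?c k)"
    unfolding u_perm_def .
  then show "u_perm \<alpha> T permutes {1..?n}" by blast
  assume k: "k \<in> {1..?n}"
  show "lehmer ?n (u_perm \<alpha> T) k = inversion_vector \<alpha> T k"
    using u k inversion_vector_le[OF assms, of k] by auto
qed

section \<open>The Schubert classes span\<close>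

lemma monomial_value:
  assumes "keys \<mu> \<subseteq> yxvars n"
  shows "(\<Prod>v\<in>keys \<mu>. yxcoord q v ^ lookup \<mu> v) =
    (\<Prod>i=1..n. fst q i ^ lookup \<mu> (Y i)) * xmonomial n (\<lambda>i. lookup \<mu> (X i)) q"
proof -
  have "finite (yxvars n)" by (simp add: yxvars_def)
  then have "(\<Prod>v\<in>keys \<mu>. yxcoord q v ^ lookup \<mu> v) =
      (\<Prod>v\<in>yxvars n. yxcoord q v ^ lookup \<mu> v)"
    by (rule monom_eval_superset[OF _ assms])
  also have "\<dots> = (\<Prod>v\<in>Y ` {1..n}. yxcoord q v ^ lookup \<mu> v) *
      (\<Prod>v\<in>X ` {1..n}. yxcoord q v ^ lookup \<mu> v)"
    unfolding yxvars_def by (rule prod.union_disjoint) auto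
  also have "\<dots> = (\<Prod>i=1..n. fst q i ^ lookup \<mu> (Y i)) *
      (\<Prod>i=1..n. snd q i ^ lookup \<mu> (X i))"
    by (cases q) (simp add: prod.reindex inj_on_def)
  finally show ?thesis by (simp add: xmonomial_def)
qed

lemma spanned_peval:
  assumes n: "n = sum_list \<alpha>"
    and "\<And>\<mu>. \<mu> \<in> keys p \<Longrightarrow> keys \<mu> \<subseteq> yxvars n"
    and "\<And>\<mu>. \<mu> \<in> keys p \<Longrightarrow> (\<lambda>i. lookup \<mu> (X i)) \<in> M"
  shows "spanned \<alpha> (xmonomial n ` M) (\<lambda>q. peval (yxcoord q) p)"
  unfolding pinsert_def
proof (rule spanned_sum)
  fix \<mu> assume \<mu>: "\<mu> \<in> keys p"
  have "spanned \<alpha> (xmonomial n ` M) (\<lambda>q. (\<lambda>h. lookup p \<mu> *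
      (\<Prod>i=1..n. h i ^ lookup \<mu> (Y i))) (fst q) *
      xmonomial n (\<lambda>i. lookup \<mu> (X i)) q)"
    by (intro spanned_scalar spanned_base imageI assms(3) \<mu> scalar_mult scalar_const scalar_prod
        scalar_power
        scalar_coord) (simp add: n)
  then show "spanned \<alpha> (xmonomial n ` M) (\<lambda>q. lookup p \<mu> *
      (\<Prod>v\<in>keys \<mu>. yxcoord q v ^ lookup \<mu> v))"
    by (rule spanned_cong) (simp add: monomial_value[OF assms(2)[OF \<mu>]])
qed

text \<open>A monomial with a \<open>y\<close>-variable has lower degree in \<open>x\<close> because the polynomial is
  homogeneous in all variables together.\<close>

lemma double_schubert_expansion:
  assumes n: "n = sum_list \<alpha>" and w: "w permutes {1..n}"
  shows "spanned \<alpha> (xmonomial n ` smaller n n (xdegree n (lehmer n w)) (lehmer n w))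
      (\<lambda>q. peval (yxcoord q) (double_schubert n w) - xmonomial n (lehmer n w) q)"
    and "pvars (double_schubert n w) \<subseteq> yxvars n"
proof -
  obtain g where g: "double_schubert n w = single (xexponent n (lehmer n w)) 1 + g"
      "keys g \<subseteq> tail_monomials n (lehmer n w)"
    using double_schubert_leading[OF w] by (auto simp: has_leading_code_def)
  have keys: "keys \<mu> \<subseteq> yxvars n" if "\<mu> \<in> keys g" for \<mu>
    using that g(2) by (auto simp: tail_monomials_def)
  have "(\<lambda>i. lookup \<mu> (X i)) \<in> smaller n n (xdegree n (lehmer n w)) (lehmer n w)"
    if \<mu>: "\<mu> \<in> keys g" for \<mu>
  proof -
    have tail: "\<mu> \<in> tail_monomials n (lehmer n w)" using \<mu> g(2) by blast
    then have deg: "(\<Sum>i=1..n. lookup \<mu> (Y i)) + xdegree n (\<lambda>i. lookup \<mu> (X i)) =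
        xdegree n (lehmer n w)"
      by (simp add: tail_monomials_def sum_lookup_yxvars xdegree_def)
    show ?thesis
    proof (cases "(\<Sum>i=1..n. lookup \<mu> (Y i)) = 0")
      case True
      have "lookup \<mu> (Y i) = 0" for i
      proof (cases "i \<in> {1..n}")
        case False
        then have "Y i \<notin> keys \<mu>" using keys[OF \<mu>] by (auto simp: yxvars_def)
        then show ?thesis by (simp add: in_keys_iff)
      qed (use True in simp)
      then have "lex_above n (lehmer n w) (\<lambda>i. lookup \<mu> (X i))"
        using tail by (simp add: tail_monomials_def)
      then show ?thesis using deg True by (simp add: smaller_def)
    next
      case False
      then have "xdegree n (\<lambda>i. lookup \<mu> (X i)) < xdegree n (lehmer n w)" using deg by linarith
      then show ?thesis by (simp add: smaller_def)
    qed
  qed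
  then have "spanned \<alpha> (xmonomial n ` smaller n n (xdegree n (lehmer n w)) (lehmer n w))
      (\<lambda>q. peval (yxcoord q) g)"
    using keys by (intro spanned_peval[OF n]) auto
  then show "spanned \<alpha> (xmonomial n ` smaller n n (xdegree n (lehmer n w)) (lehmer n w))
      (\<lambda>q. peval (yxcoord q) (double_schubert n w) - xmonomial n (lehmer n w) q)"
  proof (rule spanned_cong)
    fix q
    have "xmonomial n (\<lambda>i. lookup (xexponent n (lehmer n w)) (X i)) q = xmonomial n (lehmer n w) q"
      unfolding xmonomial_def by (rule prod.cong) (auto simp: lookup_xexponent)
    then have "peval (yxcoord q) (single (xexponent n (lehmer n w)) 1) = xmonomial n (lehmer n w) q"
      by (simp add: peval_single monomial_value[OF keys_xexponent] lookup_xexponent)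
    then show "peval (yxcoord q) (double_schubert n w) - xmonomial n (lehmer n w)
        q = peval (yxcoord q) g"
      by (simp add: g(1) peval_add)
  qed
  show "pvars (double_schubert n w) \<subseteq> yxvars n"
    using keys keys_xexponent[of n "lehmer n w"]
        keys_add[of "single (xexponent n (lehmer n w)) (1::complex)" g]
    unfolding g(1) pvars_def by fastforce
qed

text \<open>A measure for the induction within one degree, where the smaller vectors are those
  lexicographically above.\<close>

definition above_count :: "nat \<Rightarrow> (nat \<Rightarrow> nat) \<Rightarrow> nat" where
  "above_count n m = card {m' \<in> PiE {1..n} (\<lambda>_. {..xdegree n m}). xdegree n m' = xdegree n m \<and>
      lex_above n m m'}"

lemma lex_above_trans:
  assumes "lex_above n c m" "lex_above n m m'"
  shows "lex_above n c m'"
proof -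
  obtain l where l: "l \<in> {1..n}" "\<forall>j\<in>{1..<l}. m j = c j" "c l < m l"
    using assms(1) by (auto simp: lex_above_def)
  obtain l' where l': "l' \<in> {1..n}" "\<forall>j\<in>{1..<l'}. m' j = m j" "m l' < m' l'"
    using assms(2) by (auto simp: lex_above_def)
  consider "l < l'" | "l = l'" | "l' < l" by linarith
  then show ?thesis
  proof cases
    case 1
    then show ?thesis unfolding lex_above_def using l l' by (intro bexI[of _ l]) auto
  next
    case 2
    then show ?thesis unfolding lex_above_def using l l' by (intro bexI[of _ l]) auto
  next
    case 3
    then show ?thesis unfolding lex_above_def using l l' by (intro bexI[of _ l']) auto
  qed
qed

lemma lex_above_irrefl: "\<not> lex_above n m m"
  by (auto simp: lex_above_def)

lemma lex_above_cong:
  assumes "\<And>i. i \<in> {1..n} \<Longrightarrow> m i = c i" "\<And>i. i \<in> {1..n} \<Longrightarrow> m' i = c' i"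
  shows "lex_above n m m' \<longleftrightarrow> lex_above n c c'"
  unfolding lex_above_def using assms by (intro bex_cong refl conj_cong ball_cong) auto

lemma xdegree_cong: "(\<And>i. i \<in> {1..n} \<Longrightarrow> m i = c i) \<Longrightarrow> xdegree n m = xdegree n c"
  unfolding xdegree_def by (rule sum.cong) auto

lemma above_count_less:
  assumes "xdegree n m' = xdegree n m" "lex_above n m m'"
  shows "above_count n m' < above_count n m"
proof -
  let ?A = "\<lambda>m. {m' \<in> PiE {1..n} (\<lambda>_. {..xdegree n m}). xdegree n m' = xdegree n m \<and> lex_above n m
      m'}"
  let ?r = "restrict m' {1..n}"
  have "finite (PiE {1..n} (\<lambda>_. {..xdegree n m}))" by (intro finite_PiE) auto
  then have fin: "finite (?A m)" by simp
  have le: "m' i \<le> xdegree n m" if "i \<in> {1..n}" for i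
  proof -
    have "m' i \<le> xdegree n m'" unfolding xdegree_def using that by (intro member_le_sum) auto
    then show ?thesis using assms(1) by simp
  qed
  have r: "xdegree n ?r = xdegree n m'" "lex_above n c ?r = lex_above n c m'" for c
    by (intro xdegree_cong lex_above_cong; simp)+
  have "?r \<in> ?A m" using le assms r(1) r(2)[of m] by auto
  moreover have "?r \<notin> ?A m'" using r(2)[of m'] lex_above_irrefl[of n m'] by auto
  moreover have "?A m' \<subseteq> ?A m" using assms lex_above_trans by auto
  ultimately have "?A m' \<subset> ?A m" by blast
  then show ?thesis unfolding above_count_def by (intro psubset_card_mono[OF fin])
qed

definition schubert_classes :: "nat list \<Rightarrow> (zpoint \<Rightarrow> complex) set" where
  "schubert_classes \<alpha> = {restr_Z \<alpha> (schubert_fun (sum_list \<alpha>) w) |w. w \<in> W_set \<alpha>}"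

lemma schubert_class_eq:
  "restr_Z \<alpha> (schubert_fun (sum_list \<alpha>) w) = poly_fun yxcoord (Zvar \<alpha>)
      (double_schubert (sum_list \<alpha>) w)"
  unfolding schubert_fun_def by (rule restr_Z_poly_fun)

text \<open>If the exponent vector is the inversion vector of a filling \<open>T\<close>, then it is the code of
  \<open>u\<^sub>T\<close>, and \<open>x\<^sup>m\<close> is the Schubert class of \<open>u\<^sub>T\<close> up to smaller monomials. Otherwise \<open>x\<^sup>m\<close>
  itself reduces to smaller monomials.\<close>

lemma xmonomial_spanned_schubert:
  assumes pos: "\<forall>a\<in>set \<alpha>. 0 < a" and n: "n = sum_list \<alpha>"
  shows "spanned \<alpha> (schubert_classes \<alpha>) (xmonomial n m)"
proof (induction "(xdegree n m, above_count n m)" arbitrary: m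
    rule: wf_induct_rule[OF wf_lex_prod[OF wf_less_than wf_less_than]])
  case (1 m)
  have lower: "spanned \<alpha> (schubert_classes \<alpha>) g"
      if g: "g \<in> xmonomial n ` smaller n n (xdegree n m) m" for g
  proof -
    obtain m' where m': "g = xmonomial n m'" "m' \<in> smaller n n (xdegree n m) m" using g by blast
    then have "((xdegree n m', above_count n m'), (xdegree n m, above_count n m)) \<in> less_than
        <*lex*> less_than"
      using above_count_less[of n m' m] by (auto simp: smaller_def)
    then show ?thesis using 1 m'(1) by blast
  qed
  consider "\<exists>\<rho>. greedy \<alpha> m \<rho> n" |
      "spanned \<alpha> (xmonomial n ` smaller n n (xdegree n m) m) (xmonomial n m)"
    using straightening[OF pos n] by blast
  then show ?case
  proof cases
    case 1
    then obtain \<rho> where \<rho>: "greedy \<alpha> m \<rho> n" ..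
    obtain T where T: "T \<in> RSCT \<alpha>" "\<And>i. i \<in> {1..n} \<Longrightarrow> inversion_vector \<alpha> T i = m i"
      using greedy_filling[OF n \<rho>] by blast
    define w where "w = u_perm \<alpha> T"
    have w: "w permutes {1..n}" using u_perm(1)[OF T(1)] by (simp add: w_def n)
    have code: "lehmer n w i = m i" if "i \<in> {1..n}" for i
      using u_perm(2)[OF T(1), of i] T(2)[OF that] that by (simp add: w_def n)
    have smaller: "smaller n n (xdegree n (lehmer n w)) (lehmer n w) = smaller n n (xdegree n m) m"
      using xdegree_cong[of n "lehmer n w" m] lex_above_cong[of n "lehmer n w" m] code
      by (auto simp: smaller_def)
    have pow: "xmonomial n (lehmer n w) q = xmonomial n m q" for q
      unfolding xmonomial_def by (rule prod.cong) (simp_all add: code)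
    let ?s = "\<lambda>q. peval (yxcoord q) (double_schubert n w)"
    have "restr_Z \<alpha> (schubert_fun n w) \<in> schubert_classes \<alpha>"
      unfolding schubert_classes_def n using T(1) by (auto simp: W_set_def w_def)
    then have "spanned \<alpha> (schubert_classes \<alpha>) (restr_Z \<alpha> (schubert_fun n w))" by (rule spanned_base)
    then have "spanned \<alpha> (schubert_classes \<alpha>) ?s"
      by (rule spanned_cong) (simp add: schubert_class_eq n poly_fun_def)
    moreover have "spanned \<alpha> (schubert_classes \<alpha>) (\<lambda>q. ?s q - xmonomial n m q)"
      using double_schubert_expansion(1)[OF n w] unfolding smaller pow
          by (rule spanned_trans) (rule lower)
    ultimately have "spanned \<alpha> (schubert_classes \<alpha>) (\<lambda>q. ?s q - (?s q - xmonomial n m q))"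
      by (rule spanned_diff)
    then show ?thesis by simp
  next
    case 2
    then show ?thesis by (rule spanned_trans) (rule lower)
  qed
qed

lemma carrier_spanned_schubert:
  assumes "\<forall>a\<in>set \<alpha>. 0 < a" "f \<in> carrier (alg_A \<alpha>)"
  shows "spanned \<alpha> (schubert_classes \<alpha>) f"
proof -
  obtain p where p: "f = poly_fun yxcoord (Zvar \<alpha>) p" "pvars p \<subseteq> yxvars (sum_list \<alpha>)"
    using assms(2) by (auto simp: alg_A_simps coord_ring_simps)
  have "spanned \<alpha> (xmonomial (sum_list \<alpha>) ` UNIV) (\<lambda>q. peval (yxcoord q) p)"
    using p(2) by (intro spanned_peval refl) (auto simp: pvars_def)
  then have "spanned \<alpha> (schubert_classes \<alpha>) (\<lambda>q. peval (yxcoord q) p)"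
    by (rule spanned_trans) (auto intro: xmonomial_spanned_schubert[OF assms(1)])
  then show ?thesis by (rule spanned_cong) (simp add: p(1) poly_fun_def)
qed

lemma finite_RSCT: "finite (RSCT \<alpha>)"
proof -
  have "RSCT \<alpha> \<subseteq> PiE (diagram \<alpha>) (\<lambda>_. {1..sum_list \<alpha>})"
    by (auto simp: RSCT_def PiE_def dest: bij_betwE)
  then show ?thesis by (rule finite_subset) (simp add: finite_PiE finite_diagram)
qed

lemma schubert_classes_finite:
  "finite (schubert_classes \<alpha>)" "card (schubert_classes \<alpha>) \<le> card (RSCT \<alpha>)"
proof -
  have eq: "schubert_classes \<alpha> = (\<lambda>T. restr_Z \<alpha> (schubert_fun (sum_list \<alpha>) (u_perm \<alpha> T))) ` RSCT \<alpha>"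
    by (auto simp: schubert_classes_def W_set_def)
  show "finite (schubert_classes \<alpha>)" "card (schubert_classes \<alpha>) \<le> card (RSCT \<alpha>)"
    unfolding eq using finite_RSCT by (auto intro: card_image_le)
qed

lemma schubert_classes_carrier: "schubert_classes \<alpha> \<subseteq> carrier (alg_A \<alpha>)"
proof
  fix b assume "b \<in> schubert_classes \<alpha>"
  then obtain T where T: "T \<in> RSCT \<alpha>" "b = restr_Z \<alpha> (schubert_fun (sum_list \<alpha>) (u_perm \<alpha> T))"
    by (auto simp: schubert_classes_def W_set_def)
  show "b \<in> carrier (alg_A \<alpha>)"
    unfolding T(2) schubert_class_eq alg_A_simps
    by (intro poly_fun_closed double_schubert_expansion(2)[OF refl] u_perm(1) T(1))
qed

lemma spanned_coefficients:
  assumes "finite B" "spanned \<alpha> B f"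
  obtains c where "\<And>b. b \<in> B \<Longrightarrow> scalar \<alpha> (c b)"
    "\<And>q. q \<in> Zvar \<alpha> \<Longrightarrow> f q = (\<Sum>b\<in>B. c b (fst q) * b q)"
proof -
  have "\<exists>c. (\<forall>b\<in>B. scalar \<alpha> (c b)) \<and> (\<forall>q\<in>Zvar \<alpha>. f q = (\<Sum>b\<in>B. c b (fst q) * b q))"
    using assms(2)
  proof induction
    case (zero f)
    then show ?case by (intro exI[of _ "\<lambda>_ _. 0"]) (simp add: scalar_const)
  next
    case (step f g d f')
    then obtain c where c: "\<forall>b\<in>B. scalar \<alpha> (c b)" "\<forall>q\<in>Zvar \<alpha>. f q = (\<Sum>b\<in>B. c b (fst q) * b q)"
        by blast
    let ?c = "\<lambda>b h. c b h + (if b = g then d h else 0)"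
    have "f' q = (\<Sum>b\<in>B. ?c b (fst q) * b q)" if "q \<in> Zvar \<alpha>" for q
    proof -
      have "(\<Sum>b\<in>B. ?c b (fst q) * b q) = (\<Sum>b\<in>B. c b (fst q) * b q +
          (if b = g then d (fst q) * g q else 0))"
        by (rule sum.cong) (auto simp: algebra_simps)
      also have "\<dots> = (\<Sum>b\<in>B. c b (fst q) * b q) + d (fst q) * g q"
        using assms(1) step.hyps(2) by (simp add: sum.distrib)
      finally show ?thesis using c(2) step.hyps(4) that by simp
    qed
    moreover have "scalar \<alpha> (?c b)" if "b \<in> B" for b
      using c(1) step.hyps(3) that by (cases "b = g") (simp_all add: scalar_add)
    ultimately show ?case by (intro exI[of _ ?c]) blast
  qed
  then show thesis using that by blast
qed

section \<open>Small spanning families are independent\<close>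

text \<open>A linear dependence would make one member redundant. Then fewer than \<open>card R\<close> vectors
  would span the \<open>card R\<close> unit vectors of the function space on \<open>R\<close>.\<close>

lemma spanning_family_independent:
  fixes f :: "'b \<Rightarrow> 'r \<Rightarrow> complex"
  assumes fin: "finite R" "finite B" and card: "card B \<le> card R"
    and span: "\<And>x. x \<in> R \<Longrightarrow> \<exists>a. \<forall>y\<in>R. (\<Sum>b\<in>B. a b * f b y) = (if y = x then 1 else 0)"
    and dep: "\<And>y. y \<in> R \<Longrightarrow> (\<Sum>b\<in>B. c b * f b y) = 0" and b0: "b0 \<in> B"
  shows "c b0 = 0"
proof (rule ccontr)
  assume c0: "c b0 \<noteq> 0"
  interpret vector_space "\<lambda>c (v :: 'r \<Rightarrow> complex) x. c * v x"
    by unfold_locales (auto simp: fun_eq_iff algebra_simps)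
  let ?v = "\<lambda>b y. if y \<in> R then f b y else 0" and ?u = "\<lambda>x y. if y = x then 1 else (0::complex)"
  let ?S = "?v ` (B - {b0})"
  have sum_apply: "(\<Sum>b\<in>A. g b) y = (\<Sum>b\<in>A. g b y)" for A :: "'i set" and g :: "'i \<Rightarrow> 'r \<Rightarrow> complex"
      and y
    by (induction A rule: infinite_finite_induct) auto
  have base: "?v b \<in> local.span ?S" if "b \<in> B - {b0}" for b using that by (intro span_base) blast
  have "?v b0 = (\<Sum>b\<in>B - {b0}. (\<lambda>y. (- c b / c b0) * ?v b y))"
  proof
    fix y
    show "?v b0 y = (\<Sum>b\<in>B - {b0}. (\<lambda>y. (- c b / c b0) * ?v b y)) y"
    proof (cases "y \<in> R")
      case True
      have "c b0 * f b0 y + (\<Sum>b\<in>B - {b0}. c b * f b y) = 0"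
        using dep[OF True] sum.remove[OF fin(2) b0, of "\<lambda>b. c b * f b y"] by simp
      then have "f b0 y = - (\<Sum>b\<in>B - {b0}. c b * f b y) / c b0"
        using c0 by (simp add: field_simps eq_neg_iff_add_eq_0)
      also have "\<dots> = (\<Sum>b\<in>B - {b0}. - c b / c b0 * f b y)"
        by (simp add: sum_divide_distrib sum_negf)
      finally show ?thesis using True by (simp add: sum_apply)
    qed (simp add: sum_apply)
  qed
  moreover have "(\<Sum>b\<in>B - {b0}. (\<lambda>y. (- c b / c b0) * ?v b y)) \<in> local.span ?S"
    by (intro span_sum span_scale base)
  ultimately have "?v b0 \<in> local.span ?S" by simp
  then have all: "?v b \<in> local.span ?S" if "b \<in> B" for b using base that by (cases "b = b0") auto
  have units: "?u ` R \<subseteq> local.span ?S"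
  proof
    fix g assume "g \<in> ?u ` R"
    then obtain x where x: "x \<in> R" "g = ?u x" by blast
    obtain a where a: "\<And>y. y \<in> R \<Longrightarrow> (\<Sum>b\<in>B. a b * f b y) = (if y = x then 1 else 0)"
      using span[OF x(1)] by blast
    have "g = (\<Sum>b\<in>B. (\<lambda>y. a b * ?v b y))"
    proof
      fix y
      show "g y = (\<Sum>b\<in>B. (\<lambda>y. a b * ?v b y)) y"
        using a[of y] x by (cases "y \<in> R") (auto simp: sum_apply)
    qed
    moreover have "(\<Sum>b\<in>B. (\<lambda>y. a b * ?v b y)) \<in> local.span ?S"
      by (intro span_sum span_scale all)
    ultimately show "g \<in> local.span ?S" by simp
  qed
  have "independent (?u ` R)"
  proof (rule independent_if_scalars_zero)
    show "finite (?u ` R)" using fin(1) by simp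
    fix g v assume sum0: "(\<Sum>x\<in>?u ` R. (\<lambda>y. g x * x y)) = 0" and "v \<in> ?u ` R"
    then obtain x where x: "x \<in> R" "v = ?u x" by blast
    have "inj_on ?u R" by (rule inj_onI) (metis zero_neq_one)
    then have "(\<Sum>z\<in>?u ` R. (\<lambda>y. g z * z y)) x = (\<Sum>z\<in>R. g (?u z) * ?u z x)"
      by (simp add: sum_apply sum.reindex)
    also have "\<dots> = (\<Sum>z\<in>R. if z = x then g (?u z) else 0)" by (rule sum.cong) auto
    also have "\<dots> = g v" using fin(1) x by simp
    finally show "g v = 0" using sum0 by simp
  qed
  from independent_span_bound[OF _ this units] fin
  have "card (?u ` R) \<le> card ?S" by simp
  moreover have "card (?u ` R) = card R"
    by (rule card_image) (rule inj_onI, metis zero_neq_one)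
  moreover have "card ?S \<le> card (B - {b0})" using fin by (intro card_image_le) simp
  moreover have "card (B - {b0}) < card B" using fin b0 by (intro psubset_card_mono) auto
  ultimately show False using card by simp
qed

section \<open>Generic fibres\<close>

text \<open>The boxes of the diagram correspond to the positions \<open>1, \<dots>, n\<close>, row \<open>r\<close> to block \<open>r\<close>;
  reading the filling in this order gives the permutation.\<close>

lemma perm_of_filling:
  assumes T: "T \<in> RSCT \<alpha>"
  obtains w where "w permutes {1..sum_list \<alpha>}"
    "\<And>r c. (r, c) \<in> diagram \<alpha> \<Longrightarrow> block_end \<alpha> (r - 1) + c \<in> block \<alpha> r \<and> w
        (block_end \<alpha> (r - 1) + c) = T (r, c)"
proof -
  let ?n = "sum_list \<alpha>"
  let ?box = "\<lambda>p. (block_of \<alpha> p, p - block_end \<alpha> (block_of \<alpha> p - 1))"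
  let ?pos = "\<lambda>(r, c). block_end \<alpha> (r - 1) + c"
  have suc: "block_end \<alpha> r = block_end \<alpha> (r - 1) + \<alpha> ! (r - 1)" if "r \<in> {1..length \<alpha>}" for r
    using block_end_Suc[of "r - 1" \<alpha>] that by (cases r) auto
  have pos: "?pos (r, c) \<in> block \<alpha> r" "r \<in> {1..length \<alpha>}" if "(r, c) \<in> diagram \<alpha>" for r c
    using that suc[of r] by (auto simp: diagram_def block_eq)
  have bij: "bij_betw ?box {1..?n} (diagram \<alpha>)"
  proof (rule bij_betw_byWitness[where f' = ?pos])
    show "\<forall>p\<in>{1..?n}. ?pos (?box p) = p" using block_of(2) by (fastforce simp: block_eq)
    show "\<forall>b\<in>diagram \<alpha>. ?box (?pos b) = b"
    proof
      fix b assume "b \<in> diagram \<alpha>"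
      then show "?box (?pos b) = b" using pos[of "fst b" "snd b"]
          by (cases b) (simp add: block_of_eqI)
    qed
    show "?box ` {1..?n} \<subseteq> diagram \<alpha>"
    proof
      fix b assume "b \<in> ?box ` {1..?n}"
      then obtain p where p: "p \<in> {1..?n}" "b = ?box p" by blast
      from block_of[OF p(1)] suc[of "block_of \<alpha> p"] show "b \<in> diagram \<alpha>"
        unfolding p(2) diagram_def by (auto simp: block_eq)
    qed
    show "?pos ` diagram \<alpha> \<subseteq> {1..?n}" using pos block_subset by fast
  qed
  have "bij_betw (T \<circ> ?box) {1..?n} {1..?n}"
    by (rule bij_betw_trans[OF bij]) (use T in \<open>simp add: RSCT_def\<close>)
  then have "bij_betw (\<lambda>p. if p \<in> {1..?n} then T (?box p) else p) {1..?n} {1..?n}"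
    by (rule bij_betw_cong[THEN iffD1, rotated]) simp
  then have "(\<lambda>p. if p \<in> {1..?n} then T (?box p) else p) permutes {1..?n}"
    by (rule bij_imp_permutes) (rule if_not_P)
  then show thesis
  proof (rule that)
    fix r c assume rc: "(r, c) \<in> diagram \<alpha>"
    from pos[OF rc] have "block_of \<alpha> (?pos (r, c)) = r" "?pos (r, c) \<in> {1..?n}"
      using block_of_eqI block_subset by blast+
    then show "block_end \<alpha> (r - 1) + c \<in> block \<alpha> r \<and>
        (if block_end \<alpha> (r - 1) + c \<in> {1..?n} then T (?box (block_end \<alpha> (r - 1) + c))
          else block_end \<alpha> (r - 1) + c) = T (r, c)"
      using pos(1)[OF rc] by simp
  qed
qed

lemma filling_point:
  assumes pos: "\<forall>a\<in>set \<alpha>. 0 < a" and T: "T \<in> RSCT \<alpha>" and h: "h \<in> levi_center \<alpha>"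
  obtains t where "(h, t) \<in> Zvar \<alpha>"
    "\<And>r c. (r, c) \<in> diagram \<alpha> \<Longrightarrow> t (T (r, c)) = h (block_end \<alpha> r)"
proof -
  obtain w where w: "w permutes {1..sum_list \<alpha>}"
    "\<And>r c. (r, c) \<in> diagram \<alpha> \<Longrightarrow> block_end \<alpha> (r - 1) + c \<in> block \<alpha> r \<and> w
        (block_end \<alpha> (r - 1) + c) = T (r, c)"
    using perm_of_filling[OF T] by blast
  obtain z where z: "\<forall>r\<in>{1..length \<alpha>}. \<forall>i\<in>block \<alpha> r. h i = z r"
    using h by (auto simp: levi_center_def)
  show thesis
  proof (rule that)
    show "(h, perm_act w h) \<in> Zvar \<alpha>" using w(1) h by (auto simp: Zvar_def)
    fix r c assume rc: "(r, c) \<in> diagram \<alpha>"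
    then have r: "r \<in> {1..length \<alpha>}" by (simp add: diagram_def)
    have "inv_into UNIV w (T (r, c)) = block_end \<alpha> (r - 1) + c"
      using w(2)[OF rc] permutes_inverses(2)[OF w(1)] by metis
    then show "perm_act w h (T (r, c)) = h (block_end \<alpha> r)"
      using z r w(2)[OF rc] block_end_in_block[OF pos r] by (simp add: perm_act_def)
  qed
qed

text \<open>By induction, at the first disagreement the larger of the two values could not be
  attained by the other sequence.\<close>

lemma strictly_decreasing_unique:
  fixes f g :: "nat \<Rightarrow> nat"
  assumes f: "\<And>c c'. c \<in> {1..a} \<Longrightarrow> c' \<in> {1..a} \<Longrightarrow> c < c' \<Longrightarrow> f c' < f c"
    and g: "\<And>c c'. c \<in> {1..a} \<Longrightarrow> c' \<in> {1..a} \<Longrightarrow> c < c' \<Longrightarrow> g c' < g c"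
    and im: "f ` {1..a} = g ` {1..a}" and c: "c \<in> {1..a}"
  shows "f c = g c"
  using c
proof (induction c rule: less_induct)
  case (less c)
  have aux: "\<not> u c < v c"
    if u: "\<And>c c'. c \<in> {1..a} \<Longrightarrow> c' \<in> {1..a} \<Longrightarrow> c < c' \<Longrightarrow> u c' < u c"
      and v: "\<And>c c'. c \<in> {1..a} \<Longrightarrow> c' \<in> {1..a} \<Longrightarrow> c < c' \<Longrightarrow> v c' < v c"
      and im: "v ` {1..a} \<subseteq> u ` {1..a}" and eq: "\<And>d. d < c \<Longrightarrow> d \<in> {1..a} \<Longrightarrow> u d = v d"
    for u v :: "nat \<Rightarrow> nat"
  proof
    assume lt: "u c < v c"
    obtain d where d: "d \<in> {1..a}" "v c = u d" using im less.prems by blast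
    have "d < c"
    proof (rule ccontr)
      assume "\<not> d < c"
      then have "u d \<le> u c" using u[of c d] d(1) less.prems by (cases "d = c") force+
      then show False using lt d(2) by simp
    qed
    then show False using eq[of d] d v[of d c] less.prems by simp
  qed
  have "\<not> f c < g c"
    by (rule aux[of f g]) (simp_all only: f g im less.IH subset_refl)
  moreover have "\<not> g c < f c"
    by (rule aux[of g f]) (simp_all only: f g im less.IH subset_refl)
  ultimately show ?case by simp
qed

text \<open>The premise says that every entry lies in the same row of both fillings; within a row
  the order of the entries is forced.\<close>

lemma filling_determined_by_rows:
  assumes T: "T \<in> RSCT \<alpha>" and T': "T' \<in> RSCT \<alpha>"
    and rows: "\<And>r c s d. (r, c) \<in> diagram \<alpha> \<Longrightarrow> (s, d) \<in> diagram \<alpha> \<Longrightarrow> T (r, c) = T' (s, d) \<Longrightarrow> r = s"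
  shows "T = T'"
proof (rule extensionalityI)
  show "T \<in> extensional (diagram \<alpha>)" "T' \<in> extensional (diagram \<alpha>)"
    using T T' by (simp_all add: RSCT_def)
  have bij: "bij_betw T (diagram \<alpha>) {1..sum_list \<alpha>}" "bij_betw T' (diagram \<alpha>) {1..sum_list \<alpha>}"
    using T T' by (simp_all add: RSCT_def)
  fix b assume "b \<in> diagram \<alpha>"
  then obtain r c where b: "b = (r, c)" "(r, c) \<in> diagram \<alpha>" by (cases b) auto
  then have r: "r \<in> {1..length \<alpha>}" and c: "c \<in> {1..\<alpha> ! (r - 1)}" by (auto simp: diagram_def)
  have row: "(r, d) \<in> diagram \<alpha> \<longleftrightarrow> d \<in> {1..\<alpha> ! (r - 1)}" for d using r by (auto simp: diagram_def)
  have sub: "(\<lambda>d. U (r, d)) ` {1..\<alpha> ! (r - 1)} \<subseteq> (\<lambda>d. U' (r, d)) ` {1..\<alpha> ! (r - 1)}"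
    if "bij_betw U (diagram \<alpha>) {1..sum_list \<alpha>}" "bij_betw U' (diagram \<alpha>) {1..sum_list \<alpha>}"
      "\<And>r c s d. (r, c) \<in> diagram \<alpha> \<Longrightarrow> (s, d) \<in> diagram \<alpha> \<Longrightarrow> U (r, c) = U' (s, d) \<Longrightarrow> r = s"
    for U U'
  proof
    fix e assume "e \<in> (\<lambda>d. U (r, d)) ` {1..\<alpha> ! (r - 1)}"
    then obtain d where d: "(r, d) \<in> diagram \<alpha>" "e = U (r, d)" using row by blast
    then have "e \<in> U' ` diagram \<alpha>" using that(1,2) by (auto simp: bij_betw_def)
    then obtain s d' where s: "(s, d') \<in> diagram \<alpha>" "e = U' (s, d')" by auto
    then have "r = s" using that(3)[OF d(1) s(1)] d(2) by simp
    then show "e \<in> (\<lambda>d. U' (r, d)) ` {1..\<alpha> ! (r - 1)}" using s row by blast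
  qed
  have "(\<lambda>d. T (r, d)) c = (\<lambda>d. T' (r, d)) c"
  proof (rule strictly_decreasing_unique[OF _ _ _ c])
    show "(\<lambda>d. T (r, d)) ` {1..\<alpha> ! (r - 1)} = (\<lambda>d. T' (r, d)) ` {1..\<alpha> ! (r - 1)}"
      using sub[OF bij] sub[OF bij(2,1)] rows by (metis subset_antisym)
  qed (use T T' row in \<open>auto simp: RSCT_def\<close>)
  then show "T b = T' b" by (simp add: b)
qed

definition generic :: "nat list \<Rightarrow> (nat \<Rightarrow> complex) \<Rightarrow> bool" where
  "generic \<alpha> h \<longleftrightarrow> h \<in> levi_center \<alpha> \<and> inj_on (\<lambda>r. h (block_end \<alpha> r)) {1..length \<alpha>}"

text \<open>A product of affine functions of one coordinate each, one for every point to be avoided.\<close>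

lemma interpolation:
  assumes fin: "finite I" and q: "q \<in> Zvar \<alpha>"
    and sep: "\<And>x. x \<in> I \<Longrightarrow> \<exists>i\<in>{1..sum_list \<alpha>}. snd q i \<noteq> snd (p x) i"
  obtains f where "f \<in> carrier (alg_A \<alpha>)" "f q = 1" "\<And>x. x \<in> I \<Longrightarrow> p x \<in> Zvar \<alpha> \<Longrightarrow> f (p x) = 0"
proof -
  let ?R = "coord_ring (yxvars (sum_list \<alpha>)) yxcoord (Zvar \<alpha>)"
  \<comment> \<open>\<open>i x\<close> is a coordinate that separates \<open>q\<close> from the point \<open>p x\<close>.\<close>
  obtain i where i: "\<And>x. x \<in> I \<Longrightarrow> i x \<in> {1..sum_list \<alpha>} \<and> snd q (i x) \<noteq> snd (p x) (i x)"
    using sep by metis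
  let ?l = "\<lambda>x q'. (snd q' (i x) + - snd (p x) (i x)) * inverse (snd q (i x) - snd (p x) (i x))"
  have coord: "(\<lambda>q\<in>Zvar \<alpha>. snd q j) \<in> carrier ?R" if "j \<in> {1..sum_list \<alpha>}" for j
  proof -
    have "(\<lambda>q\<in>Zvar \<alpha>. snd q j) = poly_fun yxcoord (Zvar \<alpha>) (pvar (X j))"
      by (auto simp: poly_fun_def peval_pvar fun_eq_iff restrict_def)
    moreover have "pvars (pvar (X j)) \<subseteq> yxvars (sum_list \<alpha>)"
      using that by (auto simp: pvars_def pvar_def yxvars_def)
    ultimately show ?thesis using poly_fun_closed by metis
  qed
  have linear: "(\<lambda>q'\<in>Zvar \<alpha>. ?l x q') \<in> carrier ?R" if "x \<in> I" for x
  proof -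
    have "(\<lambda>q'\<in>Zvar \<alpha>. (\<lambda>q'\<in>Zvar \<alpha>. (\<lambda>q'\<in>Zvar \<alpha>. snd q' (i x)) q' + (\<lambda>q'\<in>Zvar \<alpha>. - snd (p x) (i x))
        q') q' *
        (\<lambda>q'\<in>Zvar \<alpha>. inverse (snd q (i x) - snd (p x) (i x))) q') \<in> carrier ?R"
      using i[OF that] by (intro coord_ring_mult_closed coord_ring_add_closed
          coord_ring_const_closed coord) simp
    then show ?thesis by (simp cong: restrict_cong)
  qed
  show thesis
  proof (rule that)
    show "(\<lambda>q'\<in>Zvar \<alpha>. \<Prod>x\<in>I. ?l x q') \<in> carrier (alg_A \<alpha>)"
      unfolding alg_A_simps by (rule coord_ring_prod_closed[OF linear])
    have "(\<Prod>x\<in>I. ?l x q) = 1" by (rule prod.neutral) (use i in auto)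
    then show "(\<lambda>q'\<in>Zvar \<alpha>. \<Prod>x\<in>I. ?l x q') q = 1" using q by simp
    show "(\<lambda>q'\<in>Zvar \<alpha>. \<Prod>x\<in>I. ?l x q') (p x) = 0" if "x \<in> I" "p x \<in> Zvar \<alpha>" for x
      using that fin by (auto intro!: prod_zero)
  qed
qed

text \<open>Over a generic \<open>h\<close> the points of \<open>filling_point\<close> are distinct: the values of the
  coordinates recover the rows of the entries. Polynomials separate these points, so
  \<open>spanning_family_independent\<close> applies to the values of the Schubert classes at them.\<close>

lemma relation_vanishes_generic:
  assumes pos: "\<forall>a\<in>set \<alpha>. 0 < a" and gen: "generic \<alpha> h"
    and rel: "\<And>q. q \<in> Zvar \<alpha> \<Longrightarrow> (\<Sum>b\<in>schubert_classes \<alpha>. c b (fst q) * b q) = 0"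
    and b0: "b0 \<in> schubert_classes \<alpha>"
  shows "c b0 h = 0"
proof -
  have h: "h \<in> levi_center \<alpha>" and inj: "inj_on (\<lambda>r. h (block_end \<alpha> r)) {1..length \<alpha>}"
    using gen by (simp_all add: generic_def)
  have "\<exists>t. \<forall>T\<in>RSCT \<alpha>. (h, t T) \<in> Zvar \<alpha> \<and>
      (\<forall>r c. (r, c) \<in> diagram \<alpha> \<longrightarrow> t T (T (r, c)) = h (block_end \<alpha> r))"
    by (rule bchoice) (use filling_point[OF pos _ h] in blast)
  then obtain t where t: "\<And>T. T \<in> RSCT \<alpha> \<Longrightarrow> (h, t T) \<in> Zvar \<alpha>"
    "\<And>T r c. T \<in> RSCT \<alpha> \<Longrightarrow> (r, c) \<in> diagram \<alpha> \<Longrightarrow> t T (T (r, c)) = h (block_end \<alpha> r)"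
    by blast
  have sep: "\<exists>i\<in>{1..sum_list \<alpha>}. t T i \<noteq> t T' i" if T: "T \<in> RSCT \<alpha>" "T' \<in> RSCT \<alpha>" "T \<noteq> T'" for T T'
  proof (rule ccontr)
    assume "\<not> ?thesis"
    then have same: "\<And>i. i \<in> {1..sum_list \<alpha>} \<Longrightarrow> t T i = t T' i" by blast
    have "T = T'"
    proof (rule filling_determined_by_rows[OF T(1,2)])
      fix r c s d assume rc: "(r, c) \<in> diagram \<alpha>" and sd: "(s, d) \<in> diagram \<alpha>"
          and eq: "T (r, c) = T' (s, d)"
      have "T (r, c) \<in> {1..sum_list \<alpha>}" using T(1) rc by (auto simp: RSCT_def dest: bij_betwE)
      then have "h (block_end \<alpha> r) = h (block_end \<alpha> s)"
        using same t(2)[OF T(1) rc] t(2)[OF T(2) sd] eq by metis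
      moreover have "r \<in> {1..length \<alpha>}" "s \<in> {1..length \<alpha>}" using rc sd by (auto simp: diagram_def)
      ultimately show "r = s" using inj by (auto dest: inj_onD)
    qed
    then show False using T(3) by blast
  qed
  show ?thesis
  proof (rule spanning_family_independent[OF finite_RSCT schubert_classes_finite,
        where f = "\<lambda>b T. b (h, t T)" and c = "\<lambda>b. c b h", OF _ _ b0])
    fix T assume T: "T \<in> RSCT \<alpha>"
    show "(\<Sum>b\<in>schubert_classes \<alpha>. c b h * b (h, t T)) = 0" using rel[OF t(1)[OF T]] by simp
    obtain f where f: "f \<in> carrier (alg_A \<alpha>)" "f (h, t T) = 1"
      "\<And>T'. T' \<in> RSCT \<alpha> - {T} \<Longrightarrow> (h, t T') \<in> Zvar \<alpha> \<Longrightarrow> f (h, t T') = 0"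
    proof (rule interpolation[of "RSCT \<alpha> - {T}" "(h, t T)" \<alpha> "\<lambda>T'. (h, t T')"])
      show "finite (RSCT \<alpha> - {T})" using finite_RSCT by blast
      show "(h, t T) \<in> Zvar \<alpha>" by (rule t(1)[OF T])
      show "\<exists>i\<in>{1..sum_list \<alpha>}. snd (h, t T) i \<noteq> snd (h, t T') i" if "T' \<in> RSCT \<alpha> - {T}" for T'
        using sep[OF T, of T'] that by auto
    qed blast
    obtain a where a: "\<And>q. q \<in> Zvar \<alpha> \<Longrightarrow> f q = (\<Sum>b\<in>schubert_classes \<alpha>. a b (fst q) * b q)"
      using spanned_coefficients[OF schubert_classes_finite(1)
          carrier_spanned_schubert[OF pos f(1)]] by blast
    show "\<exists>a. \<forall>T'\<in>RSCT \<alpha>. (\<Sum>b\<in>schubert_classes \<alpha>. a b * b (h, t T')) = (if T' = T then 1 else 0)"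
    proof (intro exI[of _ "\<lambda>b. a b h"] ballI)
      fix T' assume T': "T' \<in> RSCT \<alpha>"
      show "(\<Sum>b\<in>schubert_classes \<alpha>. a b h * b (h, t T')) = (if T' = T then 1 else 0)"
        using a[OF t(1)[OF T']] f(2) f(3)[of T'] t(1)[OF T'] T' by auto
    qed
  qed
qed

lemma peval_cong: "(\<And>v. v \<in> pvars p \<Longrightarrow> a v = b v) \<Longrightarrow> peval a p = peval b p"
  unfolding pinsert_def by (intro sum.cong prod.cong arg_cong2[where f = "(*)"]
      arg_cong2[where f = "(^)"] refl)
    (auto simp: pvars_def)

text \<open>The values \<open>z\<^sub>r = r\<close> are shifted by their average over all positions to have trace zero.\<close>

lemma generic_ex:
  assumes pos: "\<forall>a\<in>set \<alpha>. 0 < a"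
  obtains h0 where "generic \<alpha> h0"
proof -
  let ?n = "sum_list \<alpha>"
  define avg where "avg = (\<Sum>i=1..?n. of_nat (block_of \<alpha> i)) / (of_nat ?n :: complex)"
  define h0 where "h0 = (\<lambda>i\<in>{1..?n}. of_nat (block_of \<alpha> i) - avg)"
  have "(\<Sum>i=1..?n. h0 i) = (\<Sum>i=1..?n. of_nat (block_of \<alpha> i)) - of_nat ?n * avg"
    by (simp add: h0_def sum_subtractf)
  also have "\<dots> = 0" by (cases "?n = 0") (simp_all add: avg_def)
  finally have torus: "h0 \<in> torus_lie ?n" by (simp add: torus_lie_def h0_def)
  have val: "h0 i = of_nat r - avg" if "r \<in> {1..length \<alpha>}" "i \<in> block \<alpha> r" for r i
  proof -
    have "i \<in> {1..?n}" using that block_subset by blast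
    then show ?thesis by (simp add: h0_def block_of_eqI[OF that])
  qed
  have "h0 \<in> levi_center \<alpha>"
    using torus val by (auto simp: levi_center_def intro!: exI[of _ "\<lambda>r. of_nat r - avg"])
  moreover have "inj_on (\<lambda>r. h0 (block_end \<alpha> r)) {1..length \<alpha>}"
    by (rule inj_onI) (simp add: val block_end_in_block[OF pos])
  ultimately show thesis using that by (auto simp: generic_def)
qed

text \<open>On the line from \<open>h\<close> in a generic direction all but finitely many points are generic, so
  by continuity \<open>c\<close> vanishes at \<open>h\<close>.\<close>

lemma vanishing_on_generic:
  assumes pos: "\<forall>a\<in>set \<alpha>. 0 < a" and c: "c \<in> carrier (sym_s \<alpha>)"
    and zero: "\<And>h. generic \<alpha> h \<Longrightarrow> c h = 0" and h: "h \<in> levi_center \<alpha>"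
  shows "c h = 0"
proof -
  let ?n = "sum_list \<alpha>"
  obtain p where p: "c = poly_fun (\<lambda>h. h) (levi_center \<alpha>) p" "pvars p \<subseteq> {1..?n}"
    using c by (auto simp: sym_s_def coord_ring_simps)
  obtain h0 where h0: "generic \<alpha> h0" using generic_ex[OF pos] by blast
  define l where "l \<epsilon> = (\<lambda>i\<in>{1..?n}. h i + \<epsilon> * h0 i)" for \<epsilon> :: complex
  define \<phi> where "\<phi> \<epsilon> = peval (\<lambda>i. h i + \<epsilon> * h0 i) p" for \<epsilon> :: complex
  obtain z where z: "\<forall>r\<in>{1..length \<alpha>}. \<forall>i\<in>block \<alpha> r. h i = z r"
    using h by (auto simp: levi_center_def)
  obtain z0 where z0: "\<forall>r\<in>{1..length \<alpha>}. \<forall>i\<in>block \<alpha> r. h0 i = z0 r"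
    using h0 by (auto simp: levi_center_def generic_def)
  have sum0: "(\<Sum>i=1..?n. h i) = 0" "(\<Sum>i=1..?n. h0 i) = 0"
    using h h0 by (simp_all add: levi_center_def torus_lie_def generic_def)
  have l: "l \<epsilon> \<in> levi_center \<alpha>" for \<epsilon>
  proof -
    have "(\<Sum>i=1..?n. l \<epsilon> i) = (\<Sum>i=1..?n. h i) + \<epsilon> * (\<Sum>i=1..?n. h0 i)"
      by (simp add: l_def sum.distrib sum_distrib_left)
    then have "l \<epsilon> \<in> torus_lie ?n" using sum0 by (simp add: torus_lie_def l_def)
    moreover have "l \<epsilon> i = z r + \<epsilon> * z0 r" if "r \<in> {1..length \<alpha>}" "i \<in> block \<alpha> r" for r i
    proof -
      have "i \<in> {1..?n}" using that block_subset by blast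
      then show ?thesis using z z0 that by (simp add: l_def)
    qed
    ultimately show ?thesis by (auto simp: levi_center_def intro!: exI[of _ "\<lambda>r. z r + \<epsilon> * z0 r"])
  qed
  have val: "c (l \<epsilon>) = \<phi> \<epsilon>" for \<epsilon>
    unfolding p(1) \<phi>_def using l p(2) by (auto simp: poly_fun_def l_def intro!: peval_cong)
  let ?k = "length \<alpha>" and ?e = "block_end \<alpha>"
  let ?bad = "(\<lambda>(r, s). (h (?e r) - h (?e s)) / (h0 (?e s) - h0 (?e r))) ` ({1..?k} \<times> {1..?k})"
  have gen: "generic \<alpha> (l \<epsilon>)" if "\<epsilon> \<notin> ?bad" for \<epsilon>
    unfolding generic_def
  proof (intro conjI l inj_onI)
    fix r s assume r: "r \<in> {1..?k}" and s: "s \<in> {1..?k}" and eq: "l \<epsilon> (?e r) = l \<epsilon> (?e s)"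
    show "r = s"
    proof (rule ccontr)
      assume "r \<noteq> s"
      then have ne: "h0 (?e s) - h0 (?e r) \<noteq> 0"
        using h0 r s by (auto simp: generic_def inj_on_def)
      have "?e r \<in> {1..?n}" "?e s \<in> {1..?n}"
        using r s block_end_in_block[OF pos] block_subset by blast+
      then have "\<epsilon> * (h0 (?e s) - h0 (?e r)) = h (?e r) - h (?e s)"
        using eq by (simp add: l_def algebra_simps)
      then have "\<epsilon> = (h (?e r) - h (?e s)) / (h0 (?e s) - h0 (?e r))" using ne
          by (simp add: field_simps)
      then show False using that r s by (auto intro!: rev_image_eqI[of "(r, s)"])
    qed
  qed
  define U where "U = - (?bad - {0})"
  \<comment> \<open>\<open>U\<close> contains 0 also when \<open>h\<close> itself is not generic.\<close>
  have "open U" unfolding U_def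
      by (intro open_Compl finite_imp_closed finite_Diff finite_imageI) simp
  moreover have "0 \<in> U" by (simp add: U_def)
  moreover have "\<phi> \<epsilon> = 0" if "\<epsilon> \<in> U" "\<epsilon> \<noteq> 0" for \<epsilon>
  proof -
    have "\<epsilon> \<notin> ?bad" using that unfolding U_def by blast
    then show ?thesis using zero[OF gen] val by simp
  qed
  ultimately have "\<forall>\<^sub>F \<epsilon> in at 0. \<phi> \<epsilon> = 0"
    unfolding eventually_at_topological by blast
  then have "\<phi> \<midarrow>0\<rightarrow> 0" by (rule tendsto_eventually)
  moreover have "isCont \<phi> 0"
    unfolding \<phi>_def pinsert_def by (intro continuous_intros)
  then have "\<phi> \<midarrow>0\<rightarrow> \<phi> 0" by (simp add: isCont_def)
  ultimately have "\<phi> 0 = 0" using LIM_unique by blast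
  then have "peval h p = 0" by (simp add: \<phi>_def)
  then show ?thesis using h by (simp add: p(1) poly_fun_def)
qed

section \<open>The basis\<close>

lemma finsum_alg_A:
  assumes "finite F" "F \<subseteq> carrier (alg_A \<alpha>)" "c \<in> F \<rightarrow> carrier (sym_s \<alpha>)"
  shows "(\<Oplus>\<^bsub>alg_A \<alpha>\<^esub>b\<in>F. c b \<odot>\<^bsub>alg_A \<alpha>\<^esub> b) = (\<lambda>q\<in>Zvar \<alpha>. \<Sum>b\<in>F. c b (fst q) * b q)"
proof -
  interpret algebra "sym_s \<alpha>" "alg_A \<alpha>" by (rule algebra_alg_A)
  show ?thesis
    using assms
  proof (induction F)
    case empty
    then show ?case by (simp add: alg_A_simps)
  next
    case (insert b F)
    have "(\<Oplus>\<^bsub>alg_A \<alpha>\<^esub>b\<in>insert b F. c b \<odot>\<^bsub>alg_A \<alpha>\<^esub> b) =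
        (c b \<odot>\<^bsub>alg_A \<alpha>\<^esub> b) \<oplus>\<^bsub>alg_A \<alpha>\<^esub> (\<Oplus>\<^bsub>alg_A \<alpha>\<^esub>b\<in>F. c b \<odot>\<^bsub>alg_A \<alpha>\<^esub> b)"
      using insert by (intro M.finsum_insert) (auto intro!: smult_closed)
    also have "(\<Oplus>\<^bsub>alg_A \<alpha>\<^esub>b\<in>F. c b \<odot>\<^bsub>alg_A \<alpha>\<^esub> b) = (\<lambda>q\<in>Zvar \<alpha>. \<Sum>b\<in>F. c b (fst q) * b q)"
      by (rule insert.IH) (use insert.prems in auto)
    finally show ?case using insert.hyps by (simp add: alg_A_simps(3,6) cong: restrict_cong)
  qed
qed

theorem schubert_classes_basis:
  assumes pos: "\<forall>a\<in>set \<alpha>. 0 < a"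
  shows "module_basis (sym_s \<alpha>) (alg_A \<alpha>) (schubert_classes \<alpha>)"
  unfolding module_basis_def
proof (intro conjI)
  interpret algebra "sym_s \<alpha>" "alg_A \<alpha>" by (rule algebra_alg_A)
  show "Module.module (sym_s \<alpha>) (alg_A \<alpha>)" by (rule module_axioms)
  show "schubert_classes \<alpha> \<subseteq> carrier (alg_A \<alpha>)" by (rule schubert_classes_carrier)
  show "module_independent (sym_s \<alpha>) (alg_A \<alpha>) (schubert_classes \<alpha>)"
    unfolding module_independent_def
  proof (intro allI impI ballI, elim conjE)
    fix F c b0
    assume F: "finite F" "F \<subseteq> schubert_classes \<alpha>" "c \<in> F \<rightarrow> carrier (sym_s \<alpha>)"
      and sum0: "(\<Oplus>\<^bsub>alg_A \<alpha>\<^esub>b\<in>F. c b \<odot>\<^bsub>alg_A \<alpha>\<^esub> b) = \<zero>\<^bsub>alg_A \<alpha>\<^esub>" and b0: "b0 \<in> F"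
    let ?c = "\<lambda>b h. if b \<in> F then c b h else 0"
    have FA: "F \<subseteq> carrier (alg_A \<alpha>)" using F(2) schubert_classes_carrier by blast
    have "(\<Sum>b\<in>schubert_classes \<alpha>. ?c b (fst q) * b q) = 0" if q: "q \<in> Zvar \<alpha>" for q
    proof -
      have "(\<Sum>b\<in>schubert_classes \<alpha>. ?c b (fst q) * b q) = (\<Sum>b\<in>F. c b (fst q) * b q)"
        using F(2) by (intro sum.mono_neutral_cong_right schubert_classes_finite) auto
      also have "\<dots> = (\<Oplus>\<^bsub>alg_A \<alpha>\<^esub>b\<in>F. c b \<odot>\<^bsub>alg_A \<alpha>\<^esub> b) q"
        using finsum_alg_A[OF F(1) FA F(3)] q by simp
      also have "\<dots> = 0" using sum0 q by (simp add: alg_A_simps)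
      finally show ?thesis .
    qed
    then have "?c b0 h = 0" if "generic \<alpha> h" for h
      using relation_vanishes_generic[OF pos that, of ?c b0] F(2) b0 by blast
    then have gen: "c b0 h = 0" if "generic \<alpha> h" for h using that b0 by simp
    have cb: "c b0 \<in> carrier (sym_s \<alpha>)" using F(3) b0 by blast
    show "c b0 = \<zero>\<^bsub>sym_s \<alpha>\<^esub>"
    proof
      fix h
      show "c b0 h = \<zero>\<^bsub>sym_s \<alpha>\<^esub> h"
      proof (cases "h \<in> levi_center \<alpha>")
        case True
        then show ?thesis using vanishing_on_generic[OF pos cb gen True]
            by (simp add: sym_s_def coord_ring_simps)
      next
        case False
        then show ?thesis using cb coord_ring_undefined[of "c b0"]
            by (simp add: sym_s_def coord_ring_simps(5))
      qed
    qed
  qed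
  show "module_span (sym_s \<alpha>) (alg_A \<alpha>) (schubert_classes \<alpha>) = carrier (alg_A \<alpha>)"
  proof
    show "module_span (sym_s \<alpha>) (alg_A \<alpha>) (schubert_classes \<alpha>) \<subseteq> carrier (alg_A \<alpha>)"
      using schubert_classes_carrier unfolding module_span_def
          by (auto intro!: M.finsum_closed smult_closed)
    show "carrier (alg_A \<alpha>) \<subseteq> module_span (sym_s \<alpha>) (alg_A \<alpha>) (schubert_classes \<alpha>)"
    proof
      fix f assume f: "f \<in> carrier (alg_A \<alpha>)"
      obtain c where c: "\<And>b. b \<in> schubert_classes \<alpha> \<Longrightarrow> scalar \<alpha> (c b)"
        "\<And>q. q \<in> Zvar \<alpha> \<Longrightarrow> f q = (\<Sum>b\<in>schubert_classes \<alpha>. c b (fst q) * b q)"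
        using spanned_coefficients[OF schubert_classes_finite(1)
            carrier_spanned_schubert[OF pos f]] by blast
      let ?c = "\<lambda>b. restrict (c b) (levi_center \<alpha>)"
      have cS: "?c \<in> schubert_classes \<alpha> \<rightarrow> carrier (sym_s \<alpha>)" using c(1) by (simp add: scalar_def)
      have "f = (\<lambda>q\<in>Zvar \<alpha>. \<Sum>b\<in>schubert_classes \<alpha>. ?c b (fst q) * b q)"
      proof
        fix q
        show "f q = (\<lambda>q\<in>Zvar \<alpha>. \<Sum>b\<in>schubert_classes \<alpha>. ?c b (fst q) * b q) q"
        proof (cases "q \<in> Zvar \<alpha>")
          case True
          then have "fst q \<in> levi_center \<alpha>" by (cases q) (simp add: Zvar_fst)
          then show ?thesis using True c(2) by simp
        next
          case False
          then show ?thesis using f coord_ring_undefined[of f] by (simp add: alg_A_simps)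
        qed
      qed
      then have "f = (\<Oplus>\<^bsub>alg_A \<alpha>\<^esub>b\<in>schubert_classes \<alpha>. ?c b \<odot>\<^bsub>alg_A \<alpha>\<^esub> b)"
        using finsum_alg_A[OF schubert_classes_finite(1) schubert_classes_carrier cS] by simp
      then show "f \<in> module_span (sym_s \<alpha>) (alg_A \<alpha>) (schubert_classes \<alpha>)"
        unfolding module_span_def mem_Collect_eq using cS schubert_classes_finite(1)
        by (intro exI[of _ "schubert_classes \<alpha>"] exI[of _ ?c] conjI order_refl)
    qed
  qed
qed

lemma module_basis_algebra_iso:
  assumes M: "algebra R M" and H: "algebra R H" and \<phi>: "\<phi> \<in> algebra_iso R M H"
    and basis: "module_basis R M B"
  shows "module_basis R H (\<phi> ` B)"
proof -
  interpret M: algebra R M by (rule M)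
  interpret H: algebra R H by (rule H)
  have iso: "\<phi> \<in> ring_iso M H"
      and smult: "\<And>c a. c \<in> carrier R \<Longrightarrow> a \<in> carrier M \<Longrightarrow> \<phi> (c \<odot>\<^bsub>M\<^esub> a) = c \<odot>\<^bsub>H\<^esub> \<phi> a"
    using \<phi> by (simp_all add: algebra_iso_def)
  have hom: "\<phi> \<in> ring_hom M H" and bij: "bij_betw \<phi> (carrier M) (carrier H)"
    using iso by (simp_all add: ring_iso_def)
  interpret h: ring_hom_cring M H \<phi>
    by (intro ring_hom_cring.intro ring_hom_cring_axioms.intro algebra.axioms(2)[OF M]
        algebra.axioms(2)[OF H] hom)
  have B: "B \<subseteq> carrier M" and ind: "module_independent R M B"
      and span: "module_span R M B = carrier M"
    using basis by (simp_all add: module_basis_def)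
  have inj: "inj_on \<phi> (carrier M)" using bij by (simp add: bij_betw_def)
  have lin: "\<phi> (\<Oplus>\<^bsub>M\<^esub>b\<in>F. c (\<phi> b) \<odot>\<^bsub>M\<^esub> b) = (\<Oplus>\<^bsub>H\<^esub>b\<in>\<phi> ` F. c b \<odot>\<^bsub>H\<^esub> b)"
    if F: "F \<subseteq> B" "c \<in> \<phi> ` F \<rightarrow> carrier R" for F c
  proof -
    have FM: "F \<subseteq> carrier M" using F(1) B by blast
    have "\<phi> (\<Oplus>\<^bsub>M\<^esub>b\<in>F. c (\<phi> b) \<odot>\<^bsub>M\<^esub> b) = (\<Oplus>\<^bsub>H\<^esub>b\<in>F. (\<phi> \<circ> (\<lambda>b. c (\<phi> b) \<odot>\<^bsub>M\<^esub> b)) b)"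
      by (rule h.hom_finsum) (use F FM in \<open>auto intro!: M.smult_closed\<close>)
    also have "\<dots> = (\<Oplus>\<^bsub>H\<^esub>b\<in>F. c (\<phi> b) \<odot>\<^bsub>H\<^esub> \<phi> b)"
    proof (rule H.M.finsum_cong')
      show "(\<lambda>b. c (\<phi> b) \<odot>\<^bsub>H\<^esub> \<phi> b) \<in> F \<rightarrow> carrier H"
        using F FM by (auto intro!: H.smult_closed)
      fix b assume "b \<in> F"
      then have "c (\<phi> b) \<in> carrier R" "b \<in> carrier M" using F FM by auto
      then show "(\<phi> \<circ> (\<lambda>b. c (\<phi> b) \<odot>\<^bsub>M\<^esub> b)) b = c (\<phi> b) \<odot>\<^bsub>H\<^esub> \<phi> b"
        by (simp add: smult)
    qed simp
    also have "\<dots> = (\<Oplus>\<^bsub>H\<^esub>b\<in>\<phi> ` F. c b \<odot>\<^bsub>H\<^esub> b)"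
      by (rule H.M.finsum_reindex[symmetric])
        (use F FM in \<open>auto intro!: H.smult_closed intro: inj_on_subset[OF inj]\<close>)
    finally show ?thesis .
  qed
  show ?thesis
    unfolding module_basis_def
  proof (intro conjI)
    show "Module.module R H" by (rule H.module_axioms)
    show "\<phi> ` B \<subseteq> carrier H" using B by auto
    show "module_independent R H (\<phi> ` B)"
      unfolding module_independent_def
    proof (intro allI impI ballI, elim conjE)
      fix G c g assume G: "finite G" "G \<subseteq> \<phi> ` B" "c \<in> G \<rightarrow> carrier R"
        and sum0: "(\<Oplus>\<^bsub>H\<^esub>b\<in>G. c b \<odot>\<^bsub>H\<^esub> b) = \<zero>\<^bsub>H\<^esub>" and g: "g \<in> G"
      obtain F where F: "F \<subseteq> B" "finite F" "G = \<phi> ` F" using finite_subset_image[OF G(1,2)] by blast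
      have FM: "F \<subseteq> carrier M" using F(1) B by blast
      have cF: "(\<lambda>b. c (\<phi> b)) \<in> F \<rightarrow> carrier R" using G(3) F(3) by auto
      have closed: "(\<Oplus>\<^bsub>M\<^esub>b\<in>F. c (\<phi> b) \<odot>\<^bsub>M\<^esub> b) \<in> carrier M"
        using cF FM by (auto intro!: M.M.finsum_closed M.smult_closed)
      have "\<phi> (\<Oplus>\<^bsub>M\<^esub>b\<in>F. c (\<phi> b) \<odot>\<^bsub>M\<^esub> b) = \<phi> \<zero>\<^bsub>M\<^esub>"
        using lin[OF F(1), of c] G(3) sum0 F(3) by simp
      then have "(\<Oplus>\<^bsub>M\<^esub>b\<in>F. c (\<phi> b) \<odot>\<^bsub>M\<^esub> b) = \<zero>\<^bsub>M\<^esub>"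
        by (rule inj_onD[OF inj]) (simp_all add: closed)
      with F(1,2) cF have "finite F \<and> F \<subseteq> B \<and> (\<lambda>b. c (\<phi> b)) \<in> F \<rightarrow> carrier R \<and>
          (\<Oplus>\<^bsub>M\<^esub>b\<in>F. c (\<phi> b) \<odot>\<^bsub>M\<^esub> b) = \<zero>\<^bsub>M\<^esub>" by blast
      then have "\<forall>b\<in>F. c (\<phi> b) = \<zero>\<^bsub>R\<^esub>"
        by (rule mp[OF spec[OF spec[OF ind[unfolded module_independent_def], where x = F],
              where x = "\<lambda>b. c (\<phi> b)"]])
      then show "c g = \<zero>\<^bsub>R\<^esub>" using g F(3) by blast
    qed
    show "module_span R H (\<phi> ` B) = carrier H"
    proof
      show "module_span R H (\<phi> ` B) \<subseteq> carrier H"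
        using B unfolding module_span_def by (fastforce intro!: H.M.finsum_closed H.smult_closed)
      show "carrier H \<subseteq> module_span R H (\<phi> ` B)"
      proof
        fix y assume "y \<in> carrier H"
        then obtain x where x: "x \<in> carrier M" "y = \<phi> x" using bij by (auto simp: bij_betw_def)
        then obtain F c where F: "x = (\<Oplus>\<^bsub>M\<^esub>b\<in>F. c b \<odot>\<^bsub>M\<^esub> b)" "finite F" "F \<subseteq> B" "c \<in> F \<rightarrow> carrier R"
          using span unfolding module_span_def by blast
        have FM: "F \<subseteq> carrier M" using F(3) B by blast
        define d where "d g = c (inv_into F \<phi> g)" for g
        have injF: "inj_on \<phi> F" using inj FM by (rule inj_on_subset)
        have dF: "d (\<phi> b) = c b" if "b \<in> F" for b using that injF by (simp add: d_def)
        have dR: "d \<in> \<phi> ` F \<rightarrow> carrier R" using F(4) dF by auto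
        have "x = (\<Oplus>\<^bsub>M\<^esub>b\<in>F. d (\<phi> b) \<odot>\<^bsub>M\<^esub> b)"
          unfolding F(1) by (rule M.M.finsum_cong')
              (use F(4) FM dF in \<open>auto intro!: M.smult_closed\<close>)
        then have "y = (\<Oplus>\<^bsub>H\<^esub>b\<in>\<phi> ` F. d b \<odot>\<^bsub>H\<^esub> b)" using lin[OF F(3) dR] x(2) by simp
        then show "y \<in> module_span R H (\<phi> ` B)"
          unfolding module_span_def mem_Collect_eq using F(2,3) dR
          by (intro exI[of _ "\<phi> ` F"] exI[of _ d] conjI) auto
      qed
    qed
  qed
qed

theorem corollary5p14:
  fixes n :: nat and \<alpha> :: "nat list"
    and H :: "((nat \<Rightarrow> complex) \<Rightarrow> complex, 'h) module"
  assumes "strong_composition n \<alpha>"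
  shows "module_basis (sym_s \<alpha>) (alg_A \<alpha>) {restr_Z \<alpha> (schubert_fun n w) |w. w \<in> W_set \<alpha>} \<and>
    (\<forall>\<phi>. algebra (sym_s \<alpha>) H \<and> \<phi> \<in> algebra_iso (sym_s \<alpha>) (alg_A \<alpha>) H \<longrightarrow>
      module_basis (sym_s \<alpha>) H (\<phi> ` {restr_Z \<alpha> (schubert_fun n w) |w. w \<in> W_set \<alpha>}))"
proof -
  have pos: "\<forall>a\<in>set \<alpha>. 0 < a" and n: "n = sum_list \<alpha>"
    using assms by (simp_all add: strong_composition_def)
  have B: "{restr_Z \<alpha> (schubert_fun n w) |w. w \<in> W_set \<alpha>} = schubert_classes \<alpha>"
    by (simp add: schubert_classes_def n)
  show ?thesis
    unfolding B using schubert_classes_basis[OF pos] module_basis_algebra_iso[OF algebra_alg_A]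
        by blast
qed

end
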